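(* Let $d,p\in\mathbb N$, and let $\mathbf a,\mathbf b\in\mathbb R^d$ and $T>0$ be fixed. Let $(\mathbf Z_t)_{t\ge0}$ be the linear process given by the stochastic differential equation $$\mathrm d\mathbf Z_t=\big(Q(t)\mathbf Z_t+\mathbf r(t)\big)\,\mathrm dt+\Sigma(t)\,\mathrm d\mathbf B_t,\qquad t\ge0,$$ with initial condition $\mathbf Z_0=\mathbf 0$, and assume that the matrices $\kappa(s,t)$ (defined in the context) are positive definite for all $0\le s<t$. Then the process $(\mathbf Y_t)_{t\in[0,T]}$ given by $$\mathbf Y_t:=\Gamma(t,T)\Gamma(0,T)^{-1}\mathbf a+\mathbf Z_t-\Gamma(0,t)^\top\big(\Gamma(0,T)^\top\big)^{-1}(\mathbf Z_T-\mathbf b),\qquad t\in[0,T],$$ equals in law the linear process bridge $(\mathbf U_t)_{t\in[0,T]}$ from $\mathbf a$ to $\mathbf b$ over $[0,T]$ derived from $\mathbf Z$.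
   Context: $Q:\mathbb R_+\to\mathbb R^{d\times d}$, $\Sigma:\mathbb R_+\to\mathbb R^{d\times p}$, $\mathbf r:\mathbb R_+\to\mathbb R^d$ are continuous functions, and $(\mathbf B_t)_{t\ge0}$ is a $p$-dimensional standard Wiener process on a filtered probability space satisfying the usual conditions. Evolution matrices: $E(t,s)\in\mathbb R^{d\times d}$, $s,t\ge0$, is the unique solution of $\partial_1E(t,s)=Q(t)E(t,s)$, $E(s,s)=I_d$. One has $E(t,s)E(s,r)=E(t,r)$ and $E(t,s)^{-1}=E(s,t)$. For $0\le s\le t$: $\kappa(s,t):=\int_s^tE(t,u)\Sigma(u)\Sigma(u)^\top E(t,u)^\top\,\mathrm du$ and $\Gamma(s,t):=E(s,t)\kappa(s,t)=\int_s^tE(s,u)\Sigma(u)\Sigma(u)^\top E(t,u)^\top\,\mathrm du$ (so $\Gamma(s,s)=0$). For $\mathbf x\in\mathbb R^d$, $0\le s\le t$: $\mathbf m^+_{\mathbf x}(s,t):=\mathbf x+\int_s^tE(s,u)\mathbf r(u)\,\mathrm du$ and $\mathbf m^-_{\mathbf x}(s,t):=\mathbf x-\int_s^tE(t,u)\mathbf r(u)\,\mathrm du$. For $0\le s\le t<T$: $$\mathbf n_{\mathbf a,\mathbf b}(s,t):=\Gamma(t,T)\Gamma(s,T)^{-1}\mathbf m^+_{\mathbf a}(s,t)+\Gamma(s,t)^\top\big(\Gamma(s,T)^\top\big)^{-1}\mathbf m^-_{\mathbf b}(t,T).$$ The linear process bridge from $\mathbf a$ to $\mathbf b$ over $[0,T]$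 derived from $\mathbf Z$ is the almost surely continuous process $(\mathbf U_t)_{t\in[0,T]}$ with $$\mathbf U_t=\mathbf n_{\mathbf a,\mathbf b}(0,t)+\Gamma(t,T)\int_0^t\Gamma(u,T)^{-1}\Sigma(u)\,\mathrm d\mathbf B_u,\quad t\in[0,T),\qquad \mathbf U_T=\mathbf b.$$ "Equals in law" means having the same finite-dimensional distributions (equivalently, for almost surely continuous processes, the same law on the space of continuous functions on $[0,T]$). *)

theory Defs
  imports "HOL-Probability.Probability"
begin

section \<open>Filtered probability spaces and Wiener processes\<close>

text \<open>
  Continuous time is rendered by functions on \<^typ>\<open>real\<close> of which only the values at
  nonnegative arguments matter. For this reason the library locale of filtrations, which would
  constrain \<open>F\<close> on the whole index type, is not used.
\<close>

definition filtered_prob_space :: "'w measure \<Rightarrow> (real \<Rightarrow> 'w measure) \<Rightarrow> bool" where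
  "filtered_prob_space M F \<longleftrightarrow> prob_space M \<and>
     (\<forall>t\<ge>0. subalgebra M (F t)) \<and>
     (\<forall>s\<ge>0. \<forall>t\<ge>s. sets (F s) \<subseteq> sets (F t))"

definition usual_conditions :: "'w measure \<Rightarrow> (real \<Rightarrow> 'w measure) \<Rightarrow> bool" where
  "usual_conditions M F \<longleftrightarrow> complete_measure M \<and> null_sets M \<subseteq> sets (F 0) \<and>
     (\<forall>t\<ge>0. sets (F t) = (\<Inter>u\<in>{t<..}. sets (F u)))"

definition wiener_process ::
  "'w measure \<Rightarrow> (real \<Rightarrow> 'w measure) \<Rightarrow> (real \<Rightarrow> 'w \<Rightarrow> real ^ 'p) \<Rightarrow> bool" where
  "wiener_process M F B \<longleftrightarrow>
     (\<forall>t\<ge>0. B t \<in> borel_measurable (F t)) \<and>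
     (AE \<omega> in M. B 0 \<omega> = 0) \<and>
     (AE \<omega> in M. continuous_on {0..} (\<lambda>t. B t \<omega>)) \<and>
     (\<forall>s\<ge>0. \<forall>t>s.
        prob_space.indep_set M (sets (F s))
          {(\<lambda>\<omega>. B t \<omega> - B s \<omega>) -` A \<inter> space M | A. A \<in> sets borel} \<and>
        prob_space.indep_vars M (\<lambda>_. borel) (\<lambda>j \<omega>. (B t \<omega> - B s \<omega>) $ j) (UNIV :: 'p set) \<and>
        (\<forall>j. distributed M lborel (\<lambda>\<omega>. (B t \<omega> - B s \<omega>) $ j)
               (\<lambda>x. ennreal (normal_density 0 (sqrt (t - s)) x))))"

section \<open>The Ito integral\<close>

text \<open>
  A list of triples \<open>(s, t, \<xi>)\<close> encodes the simple process that is the sum of all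
  \<open>\<xi> 1\<^bsub>(s,t]\<^esub>\<close>; the intervals are allowed to overlap.
\<close>

definition simple_process ::
  "'w measure \<Rightarrow> (real \<Rightarrow> 'w measure) \<Rightarrow> real \<Rightarrow> (real \<times> real \<times> ('w \<Rightarrow> real)) list \<Rightarrow> bool" where
  "simple_process M F T H \<longleftrightarrow>
     (\<forall>(s, t, \<xi>) \<in> set H. 0 \<le> s \<and> s \<le> t \<and> t \<le> T \<and>
        \<xi> \<in> borel_measurable (F s) \<and> bounded (\<xi> ` space M))"

definition simple_value :: "(real \<times> real \<times> ('w \<Rightarrow> real)) list \<Rightarrow> real \<Rightarrow> 'w \<Rightarrow> real" where
  "simple_value H u \<omega> = (\<Sum>(s, t, \<xi>)\<leftarrow>H. \<xi> \<omega> * indicator {s<..t} u)"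

definition simple_integral ::
  "(real \<Rightarrow> 'w \<Rightarrow> real) \<Rightarrow> (real \<times> real \<times> ('w \<Rightarrow> real)) list \<Rightarrow> 'w \<Rightarrow> real" where
  "simple_integral W H \<omega> = (\<Sum>(s, t, \<xi>)\<leftarrow>H. \<xi> \<omega> * (W t \<omega> - W s \<omega>))"

text \<open>
  \<open>has_ito_integral M F W T X I\<close>: the random variable \<open>I\<close> is a version of
  \<open>\<integral>\<^sub>0\<^sup>T X\<^sub>u dW\<^sub>u\<close>, defined for progressively measurable \<open>X\<close> as the
  \<open>L\<^sup>2\<close> limit of the integrals of simple processes that converge to \<open>X\<close> in
  \<open>L\<^sup>2([0,T] \<times> \<Omega>)\<close>. It is a relation because the integral is determined only
  up to null sets.
\<close>

definition has_ito_integral ::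
  "'w measure \<Rightarrow> (real \<Rightarrow> 'w measure) \<Rightarrow> (real \<Rightarrow> 'w \<Rightarrow> real) \<Rightarrow> real \<Rightarrow>
   (real \<Rightarrow> 'w \<Rightarrow> real) \<Rightarrow> ('w \<Rightarrow> real) \<Rightarrow> bool" where
  "has_ito_integral M F W T X I \<longleftrightarrow>
     (\<forall>t\<in>{0..T}. (\<lambda>(u, \<omega>). X u \<omega>) \<in> borel_measurable (restrict_space borel {0..t} \<Otimes>\<^sub>M F t)) \<and>
     I \<in> borel_measurable M \<and>
     (\<exists>H. (\<forall>n::nat. simple_process M F T (H n)) \<and>
        (\<lambda>n. \<integral>\<^sup>+\<omega>. (\<integral>\<^sup>+u\<in>{0..T}. ennreal ((X u \<omega> - simple_value (H n) u \<omega>)\<^sup>2) \<partial>lborel) \<partial>M)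
          \<longlonglongrightarrow> 0 \<and>
        (\<lambda>n. \<integral>\<^sup>+\<omega>. ennreal ((I \<omega> - simple_integral W (H n) \<omega>)\<^sup>2) \<partial>M) \<longlonglongrightarrow> 0)"

definition has_ito_integral_matrix ::
  "'w measure \<Rightarrow> (real \<Rightarrow> 'w measure) \<Rightarrow> (real \<Rightarrow> 'w \<Rightarrow> real ^ 'p) \<Rightarrow> real \<Rightarrow>
   (real \<Rightarrow> 'w \<Rightarrow> real ^ 'p ^ 'd) \<Rightarrow> ('w \<Rightarrow> real ^ 'd) \<Rightarrow> bool" where
  "has_ito_integral_matrix M F B T X I \<longleftrightarrow>
     (\<exists>J. (\<forall>i j. has_ito_integral M F (\<lambda>u \<omega>. B u \<omega> $ j) T (\<lambda>u \<omega>. X u \<omega> $ i $ j) (J i j)) \<and>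
          (\<forall>\<omega>\<in>space M. \<forall>i. I \<omega> $ i = (\<Sum>j\<in>UNIV. J i j \<omega>)))"

section \<open>Linear processes\<close>

text \<open>
  \<open>Z\<close> is a strong solution of \<open>dZ\<^sub>t = (Q(t) Z\<^sub>t + r(t)) dt + \<Sigma>(t) dB\<^sub>t\<close>,
  \<open>Z\<^sub>0 = z0\<close>, in its integrated form.
\<close>

definition linear_sde_solution ::
  "'w measure \<Rightarrow> (real \<Rightarrow> 'w measure) \<Rightarrow> (real \<Rightarrow> 'w \<Rightarrow> real ^ 'p) \<Rightarrow>
   (real \<Rightarrow> real ^ 'd ^ 'd) \<Rightarrow> (real \<Rightarrow> real ^ 'd) \<Rightarrow> (real \<Rightarrow> real ^ 'p ^ 'd) \<Rightarrow> real ^ 'd \<Rightarrow>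
   (real \<Rightarrow> 'w \<Rightarrow> real ^ 'd) \<Rightarrow> bool" where
  "linear_sde_solution M F B Q r \<Sigma> z0 Z \<longleftrightarrow>
     (\<forall>t\<ge>0. Z t \<in> borel_measurable (F t)) \<and>
     (AE \<omega> in M. continuous_on {0..} (\<lambda>t. Z t \<omega>)) \<and>
     (AE \<omega> in M. Z 0 \<omega> = z0) \<and>
     (\<forall>t\<ge>0. \<exists>I. has_ito_integral_matrix M F B t (\<lambda>u \<omega>. \<Sigma> u) I \<and>
        (AE \<omega> in M. Z t \<omega> = z0 + integral {0..t} (\<lambda>u. Q u *v Z u \<omega> + r u) + I \<omega>))"

text \<open>
  These conditions determine \<open>E t s\<close> for \<open>s, t \<ge> 0\<close> when \<open>Q\<close> is continuous;
  the derivative at \<open>t = 0\<close> is one-sided.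
\<close>

definition evolution_matrices ::
  "(real \<Rightarrow> real ^ 'd ^ 'd) \<Rightarrow> (real \<Rightarrow> real \<Rightarrow> real ^ 'd ^ 'd) \<Rightarrow> bool" where
  "evolution_matrices Q E \<longleftrightarrow>
     (\<forall>s\<ge>0. E s s = mat 1 \<and>
        (\<forall>t\<ge>0. ((\<lambda>t. E t s) has_vector_derivative (Q t ** E t s)) (at t within {0..})))"

definition positive_definite :: "real ^ 'd ^ 'd \<Rightarrow> bool" where
  "positive_definite A \<longleftrightarrow> transpose A = A \<and> (\<forall>x. x \<noteq> 0 \<longrightarrow> 0 < x \<bullet> (A *v x))"

definition kappa ::
  "(real \<Rightarrow> real \<Rightarrow> real ^ 'd ^ 'd) \<Rightarrow> (real \<Rightarrow> real ^ 'p ^ 'd) \<Rightarrow> real \<Rightarrow> real \<Rightarrow> real ^ 'd ^ 'd" where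
  "kappa E \<Sigma> s t =
     integral {s..t} (\<lambda>u. E t u ** \<Sigma> u ** transpose (\<Sigma> u) ** transpose (E t u))"

text \<open>The matrix \<open>\<Gamma>(s,t)\<close>; the name avoids a clash with the library's Gamma function.\<close>

definition Gam ::
  "(real \<Rightarrow> real \<Rightarrow> real ^ 'd ^ 'd) \<Rightarrow> (real \<Rightarrow> real ^ 'p ^ 'd) \<Rightarrow> real \<Rightarrow> real \<Rightarrow> real ^ 'd ^ 'd" where
  "Gam E \<Sigma> s t = E s t ** kappa E \<Sigma> s t"

definition m_plus ::
  "(real \<Rightarrow> real \<Rightarrow> real ^ 'd ^ 'd) \<Rightarrow> (real \<Rightarrow> real ^ 'd) \<Rightarrow> real ^ 'd \<Rightarrow> real \<Rightarrow> real \<Rightarrow> real ^ 'd" where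
  "m_plus E r x s t = x + integral {s..t} (\<lambda>u. E s u *v r u)"

definition m_minus ::
  "(real \<Rightarrow> real \<Rightarrow> real ^ 'd ^ 'd) \<Rightarrow> (real \<Rightarrow> real ^ 'd) \<Rightarrow> real ^ 'd \<Rightarrow> real \<Rightarrow> real \<Rightarrow> real ^ 'd" where
  "m_minus E r x s t = x - integral {s..t} (\<lambda>u. E t u *v r u)"

definition bridge_mean ::
  "(real \<Rightarrow> real \<Rightarrow> real ^ 'd ^ 'd) \<Rightarrow> (real \<Rightarrow> real ^ 'd) \<Rightarrow> (real \<Rightarrow> real ^ 'p ^ 'd) \<Rightarrow> real \<Rightarrow>
   real ^ 'd \<Rightarrow> real ^ 'd \<Rightarrow> real \<Rightarrow> real \<Rightarrow> real ^ 'd" where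
  "bridge_mean E r \<Sigma> T a b s t =
     (Gam E \<Sigma> t T ** matrix_inv (Gam E \<Sigma> s T)) *v m_plus E r a s t +
     (transpose (Gam E \<Sigma> s t) ** matrix_inv (transpose (Gam E \<Sigma> s T))) *v m_minus E r b t T"

definition linear_process_bridge ::
  "'w measure \<Rightarrow> (real \<Rightarrow> 'w measure) \<Rightarrow> (real \<Rightarrow> 'w \<Rightarrow> real ^ 'p) \<Rightarrow>
   (real \<Rightarrow> real \<Rightarrow> real ^ 'd ^ 'd) \<Rightarrow> (real \<Rightarrow> real ^ 'd) \<Rightarrow> (real \<Rightarrow> real ^ 'p ^ 'd) \<Rightarrow> real \<Rightarrow>
   real ^ 'd \<Rightarrow> real ^ 'd \<Rightarrow> (real \<Rightarrow> 'w \<Rightarrow> real ^ 'd) \<Rightarrow> bool" where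
  "linear_process_bridge M F B E r \<Sigma> T a b U \<longleftrightarrow>
     (\<forall>t\<in>{0..T}. U t \<in> borel_measurable M) \<and>
     (AE \<omega> in M. continuous_on {0..T} (\<lambda>t. U t \<omega>)) \<and>
     (\<forall>t\<in>{0..<T}. \<exists>I.
        has_ito_integral_matrix M F B t (\<lambda>u \<omega>. matrix_inv (Gam E \<Sigma> u T) ** \<Sigma> u) I \<and>
        (AE \<omega> in M. U t \<omega> = bridge_mean E r \<Sigma> T a b 0 t + Gam E \<Sigma> t T *v I \<omega>)) \<and>
     (AE \<omega> in M. U T \<omega> = b)"

section \<open>Equality in law\<close>

text \<open>Equality of all finite-dimensional distributions with times in \<open>S\<close>.\<close>

definition equal_in_law ::
  "real set \<Rightarrow> 'v measure \<Rightarrow> (real \<Rightarrow> 'v \<Rightarrow> 'a::topological_space) \<Rightarrow>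
   'w measure \<Rightarrow> (real \<Rightarrow> 'w \<Rightarrow> 'a) \<Rightarrow> bool" where
  "equal_in_law S M X N Y \<longleftrightarrow>
     (\<forall>J. finite J \<and> J \<subseteq> S \<longrightarrow>
        distr M (Pi\<^sub>M J (\<lambda>_. borel)) (\<lambda>\<omega>. \<lambda>t\<in>J. X t \<omega>) =
        distr N (Pi\<^sub>M J (\<lambda>_. borel)) (\<lambda>\<omega>. \<lambda>t\<in>J. Y t \<omega>))"

end

theory Submission
  imports Defs
begin

text \<open>
  Write \<open>e\<^sub>t = E(t,0)\<close>, \<open>P\<^sub>t = \<integral>\<^sub>0\<^sup>t E(0,u) \<Sigma>(u) \<Sigma>(u)\<^sup>T E(0,u)\<^sup>T du\<close> and
  \<open>D\<^sub>t = P\<^sub>T - P\<^sub>t\<close>, so that \<open>\<Gamma>(s,t) = e\<^sub>s (P\<^sub>t - P\<^sub>s) e\<^sub>t\<^sup>T\<close>. Both \<open>Y\<close> and \<open>U\<close> are, almost surely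
  at each time, \<open>e\<^sub>t\<close> applied to a common deterministic mean plus a Wiener integral of a deterministic
  integrand. Hence every linear combination of their values is Gaussian, and it remains to compare
  covariances. By \<open>\<integral>\<^sub>0\<^sup>s D\<^sup>-\<^sup>1 dP D\<^sup>-\<^sup>1 = D\<^sub>s\<^sup>-\<^sup>1 - D\<^sub>0\<^sup>-\<^sup>1\<close> both of them are
  \<open>P\<^sub>s P\<^sub>T\<^sup>-\<^sup>1 D\<^sub>t\<close> for \<open>s \<le> t\<close>, up to the factors \<open>e\<close>.

  The Wiener integral representation of \<open>Z\<close> follows pathwise from variation of constants, applied with
  the continuous forcing term \<open>\<integral> \<Sigma> dB\<close>; the time integral of that term is a limit of Riemann sums of
  Wiener integrals. Laws are identified by their characteristic functions.
\<close>

section \<open>Matrix calculus\<close>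

text \<open>Multiplication by \<open>ev_inv t\<close> removes the linear drift: up to a
  deterministic shift, \<open>ev_inv t *v Z t\<close> is a Gaussian martingale with variance
  \<open>P t\<close>, a Brownian motion run in a matrix-valued clock. The claim becomes the
  agreement of two constructions of its bridge, one that subtracts the regression on the terminal
  value and one that integrates against \<open>D t ** K u\<close>. The common covariance is the
  variance at the earlier time minus what the terminal value explains. The obstacle is that
  stochastic integrals are given one time at a time, as a relation up to null sets. The product
  \<open>ev_inv t *v Z t\<close> is therefore treated path by path, by integration by parts in the
  time variable, which leaves a time integral of the noise. What the path argument yields for the
  Riemann sums of that integral is almost sure convergence. This is why Wiener integrals are defined
  through convergence in probability, while variances are read off from the integrands, which do
  converge in mean square.\<close>

lemma bounded_bilinear_matrix_vector_mult:
  "bounded_bilinear (\<lambda>(A :: real ^ 'n ^ 'm) x. A *v x)"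
  unfolding bilinear_conv_bounded_bilinear[symmetric] bilinear_def
  by (auto intro!: linearI simp: algebra_simps scaleR_matrix_vector_assoc matrix_vector_mult_scaleR)

lemma bounded_bilinear_matrix_matrix_mult:
  "bounded_bilinear (\<lambda>(A :: real ^ 'n ^ 'm) (B :: real ^ 'k ^ 'n). A ** B)"
  unfolding bilinear_conv_bounded_bilinear[symmetric] bilinear_def
  by (auto intro!: linearI simp: vec_eq_iff matrix_matrix_mult_def sum.distrib algebra_simps
      sum_distrib_left)

interpretation matrix_vector: bounded_bilinear "\<lambda>(A :: real ^ 'n ^ 'm) x. A *v x"
  by (rule bounded_bilinear_matrix_vector_mult)

interpretation matrix_matrix: bounded_bilinear "\<lambda>(A :: real ^ 'n ^ 'm) (B :: real ^ 'k ^ 'n). A ** B"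
  by (rule bounded_bilinear_matrix_matrix_mult)

lemma bounded_linear_transpose: "bounded_linear (transpose :: real ^ 'n ^ 'm \<Rightarrow> real ^ 'm ^ 'n)"
  unfolding linear_conv_bounded_linear[symmetric]
  by (auto intro!: linearI simp: transpose_def vec_eq_iff)

lemmas continuous_on_matrix_vector_mult [continuous_intros] =
  matrix_vector.continuous_on
lemmas continuous_on_matrix_matrix_mult [continuous_intros] =
  matrix_matrix.continuous_on
lemmas continuous_on_transpose [continuous_intros] =
  bounded_linear.continuous_on[OF bounded_linear_transpose]

section \<open>Continuity and derivative of the matrix inverse\<close>

lemma continuous_on_det [continuous_intros]:
  fixes A :: "'a::topological_space \<Rightarrow> real ^ 'n ^ 'n"
  assumes "\<And>i j. continuous_on S (\<lambda>u. A u $ i $ j)"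
  shows "continuous_on S (\<lambda>u. det (A u))"
  unfolding det_def by (intro continuous_intros assms)

text \<open>By Cramer's rule every entry of the inverse is a quotient of determinants, hence
  continuous where \<open>det (A u)\<close> does not vanish. The inverse enters as a function
  \<open>B\<close> constrained on \<open>S\<close> alone, so its values elsewhere may be
  arbitrary.\<close>

lemma continuous_on_matrix_inverse:
  fixes A B :: "'a::topological_space \<Rightarrow> real ^ 'n ^ 'n"
  assumes cont: "continuous_on S A" and inv: "\<And>u. u \<in> S \<Longrightarrow> A u ** B u = mat 1"
  shows "continuous_on S B"
proof -
  have entry: "continuous_on S (\<lambda>u. A u $ i $ j)" for i j
    using cont by (intro continuous_on_component) auto
  have nz: "det (A u) \<noteq> 0" if "u \<in> S" for u
    using inv[OF that] invertible_det_nz[of "A u"] matrix_left_right_inverse invertible_def by blast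
  have eq: "B u *v axis j 1 = (\<chi> k. det (\<chi> i l. if l = k then axis j 1 $ i else A u $ i $ l) / det (A u))"
    if "u \<in> S" for u j
    using cramer[OF nz[OF that], of "B u *v axis j 1" "axis j 1"] inv[OF that]
    by (simp add: matrix_vector_mul_assoc)
  have "continuous_on S (\<lambda>u. B u $ k $ j)" for k j
  proof -
    have B: "B u $ k $ j = (B u *v axis j 1) $ k" for u
      by (simp add: matrix_vector_mult_basis column_def)
    have "continuous_on S (\<lambda>u. if l = k then axis j (1::real) $ i else A u $ i $ l)" for i l
      by (cases "l = k") (auto intro: entry continuous_intros)
    then have "continuous_on S (\<lambda>u. det (\<chi> i l. if l = k then axis j 1 $ i else A u $ i $ l) / det (A u))"
      by (intro continuous_intros entry) (use nz in auto)
    then show ?thesis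
      using eq by (subst continuous_on_cong[OF refl, OF B]) (auto cong: continuous_on_cong)
  qed
  then have "continuous_on S (\<lambda>u. (\<chi> k j. B u $ k $ j))"
    by (intro continuous_on_vec_lambda)
  then show ?thesis by simp
qed

text \<open>The limit of difference quotients is the form in which a factor that is merely
  continuous can be multiplied in, as the derivative of an inverse requires.\<close>

lemma has_vector_derivative_iff_tendsto:
  "(f has_vector_derivative D) (at x within S) \<longleftrightarrow>
     ((\<lambda>y. (f y - f x) /\<^sub>R (y - x)) \<longlongrightarrow> D) (at x within S)"
proof -
  have "norm (f y - f x - (y - x) *\<^sub>R D) / norm (y - x) = norm ((f y - f x) /\<^sub>R (y - x) - D)"
    if "y \<noteq> x" for y
  proof -
    have "(f y - f x) /\<^sub>R (y - x) - D = (f y - f x - (y - x) *\<^sub>R D) /\<^sub>R (y - x)"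
      using that by (simp add: scaleR_diff_right)
    then show ?thesis by (simp add: divide_inverse mult.commute)
  qed
  then have "\<forall>\<^sub>F y in at x within S. norm (f y - f x - (y - x) *\<^sub>R D) / norm (y - x)
      = norm ((f y - f x) /\<^sub>R (y - x) - D)"
    by (auto simp: eventually_at_filter)
  then show ?thesis
    unfolding has_vector_derivative_def has_derivative_iff_norm
    using Lim_null[of "\<lambda>y. (f y - f x) /\<^sub>R (y - x)" D "at x within S"]
    by (simp add: bounded_linear_scaleR_left tendsto_cong tendsto_norm_zero_iff)
qed

text \<open>The identity \<open>B y - B x = - (B y ** (A y - A x) ** B x)\<close> reduces the claim
  to the derivative of \<open>A\<close> and the continuity of \<open>B\<close>.\<close>

lemma has_vector_derivative_matrix_inverse:
  fixes A B :: "real \<Rightarrow> real ^ 'n ^ 'n"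
  assumes A: "(A has_vector_derivative A') (at x within S)" and cont: "continuous_on S A"
    and inv: "\<And>u. u \<in> S \<Longrightarrow> A u ** B u = mat 1" and x: "x \<in> S"
  shows "(B has_vector_derivative - (B x ** A' ** B x)) (at x within S)"
proof -
  have inv': "B u ** A u = mat 1" if "u \<in> S" for u
    using inv[OF that] matrix_left_right_inverse by blast
  have "continuous_on S B"
    by (rule continuous_on_matrix_inverse[OF cont inv])
  then have B: "(B \<longlongrightarrow> B x) (at x within S)"
    using x by (simp add: continuous_on)
  have "((\<lambda>y. (A y - A x) /\<^sub>R (y - x)) \<longlongrightarrow> A') (at x within S)"
    using A by (simp add: has_vector_derivative_iff_tendsto)
  then have *: "((\<lambda>y. - (B y ** ((A y - A x) /\<^sub>R (y - x)) ** B x)) \<longlongrightarrow> - (B x ** A' ** B x)) (at x within S)"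
    by (intro tendsto_minus matrix_matrix.tendsto B tendsto_const)
  have "\<forall>\<^sub>F y in at x within S. - (B y ** ((A y - A x) /\<^sub>R (y - x)) ** B x) = (B y - B x) /\<^sub>R (y - x)"
  proof (rule eventually_at_topological[THEN iffD2], intro exI[of _ UNIV] conjI ballI impI)
    fix y assume "y \<in> S"
    have "B y - B x = - (B y ** (A y - A x) ** B x)"
      using inv[OF x] inv'[OF \<open>y \<in> S\<close>]
      by (simp add: matrix_matrix.diff_left matrix_matrix.diff_right matrix_mul_assoc[symmetric])
    then show "- (B y ** ((A y - A x) /\<^sub>R (y - x)) ** B x) = (B y - B x) /\<^sub>R (y - x)"
      by (simp add: matrix_matrix.scaleR_left matrix_matrix.scaleR_right)
  qed auto
  then show ?thesis
    using * by (simp add: has_vector_derivative_iff_tendsto tendsto_cong)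
qed

text \<open>A one-sided inverse of a square matrix is two-sided and unique, so the choice made in
  \<open>matrix_inv\<close> can only return \<open>B\<close>.\<close>

lemma matrix_inv_eq:
  fixes A B :: "real ^ 'n ^ 'n"
  assumes "A ** B = mat 1"
  shows "matrix_inv A = B"
proof -
  have BA: "B ** A = mat 1"
    using assms matrix_left_right_inverse by blast
  have "A ** matrix_inv A = mat 1"
    unfolding matrix_inv_def by (rule someI2[of _ B]) (use assms BA in auto)
  then have "B ** (A ** matrix_inv A) = B"
    by simp
  then show ?thesis
    by (simp add: matrix_mul_assoc BA)
qed

text \<open>Reassembles a row vector integrand from its scalar pieces, one for each entry of the
  matrix and each component of the Wiener process.\<close>

lemma sum_inner_mult_axis:
  fixes \<theta> :: "real ^ 'd" and G :: "real ^ 'p ^ 'd"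
  shows "(\<Sum>i\<in>UNIV. \<Sum>j\<in>UNIV. (\<theta> $ i * G $ i $ j) *\<^sub>R axis j 1) = \<theta> v* G"
proof -
  have "(\<Sum>j\<in>UNIV. (x j *\<^sub>R axis j 1 :: real ^ 'p) $ k) = x k" for x k
    by (simp add: axis_def if_distrib cong: if_cong)
  then show ?thesis
    by (simp add: vec_eq_iff vector_matrix_mult_def mult.commute del: vector_scaleR_component)
qed

section \<open>Row vectors, measurability and quadratic forms\<close>

lemma vector_matrix_mult_assoc: "(x :: real ^ 'm) v* (A ** (B :: real ^ 'k ^ 'n)) = (x v* A) v* B"
proof -
  have "x v* C = transpose C *v x" for C :: "real ^ 'z ^ 'm" by simp
  then show ?thesis
    by (metis matrix_transpose_mul matrix_vector_mul_assoc transpose_matrix_vector)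
qed

lemma bounded_bilinear_vector_matrix_mult:
  "bounded_bilinear (\<lambda>x (A :: real ^ 'n ^ 'm). x v* A)"
  unfolding bilinear_conv_bounded_bilinear[symmetric] bilinear_def
  by (auto intro!: linearI simp: algebra_simps scaleR_vector_matrix_assoc vector_scaleR_matrix_ac)

interpretation vector_matrix: bounded_bilinear "\<lambda>x (A :: real ^ 'n ^ 'm). x v* A"
  by (rule bounded_bilinear_vector_matrix_mult)

lemma borel_measurable_vector_matrix_mult [measurable (raw)]:
  fixes G :: "'a \<Rightarrow> real ^ 'n ^ 'm"
  assumes "G \<in> borel_measurable N"
  shows "(\<lambda>u. x v* G u) \<in> borel_measurable N"
  by (rule borel_measurable_continuous_on[OF _ assms])
    (rule linear_continuous_on[OF vector_matrix.bounded_linear_right])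

lemma borel_measurable_matrix_vector_mult [measurable (raw)]:
  fixes X :: "'a \<Rightarrow> real ^ 'n" and A :: "real ^ 'n ^ 'm"
  assumes "X \<in> borel_measurable N"
  shows "(\<lambda>u. A *v X u) \<in> borel_measurable N"
  by (rule borel_measurable_continuous_on[OF _ assms]) (rule linear_continuous_on[OF matrix_vector_mul_bounded_linear])

lemma borel_measurable_vec_componentsI:
  fixes X :: "'a \<Rightarrow> real ^ 'n"
  assumes "\<And>i. (\<lambda>u. X u $ i) \<in> borel_measurable N"
  shows "X \<in> borel_measurable N"
  using assms by (subst borel_measurable_euclidean_space) (auto simp: Basis_vec_def inner_axis)

lemma borel_measurable_matrix_matrix_mult [measurable (raw)]:
  fixes G :: "'a \<Rightarrow> real ^ 'k ^ 'n" and A :: "real ^ 'n ^ 'm"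
  assumes "G \<in> borel_measurable N"
  shows "(\<lambda>u. A ** G u) \<in> borel_measurable N"
  by (rule borel_measurable_continuous_on[OF _ assms])
    (rule linear_continuous_on[OF matrix_matrix.bounded_linear_right])

text \<open>Turns the inner product of two Wiener integrands into a form in the matrix
  \<open>A ** transpose C\<close>, which later is the density \<open>S\<close> of the
  variance.\<close>

lemma inner_vector_matrix_mult:
  fixes A :: "real ^ 'p ^ 'd" and C :: "real ^ 'p ^ 'e"
  shows "(x v* A) \<bullet> (y v* C) = x \<bullet> ((A ** transpose C) *v y)"
proof -
  have "(x v* A) \<bullet> (y v* C) = x \<bullet> (A *v (transpose C *v y))"
    by (simp add: dot_lmul_matrix)
  then show ?thesis by (simp only: matrix_vector_mul_assoc)
qed

lemma bounded_linear_quadratic: "bounded_linear (\<lambda>A :: real ^ 'n ^ 'm. x \<bullet> (A *v y))"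
  by (rule bounded_linear_compose[OF bounded_linear_inner_right
      matrix_vector.bounded_linear_left])

section \<open>Evolution matrices\<close>

locale linear_evolution =
  fixes Q :: "real \<Rightarrow> real ^ 'd ^ 'd" and E :: "real \<Rightarrow> real \<Rightarrow> real ^ 'd ^ 'd"
  assumes cont_Q: "continuous_on {0..} Q" and evolution: "evolution_matrices Q E"
begin

text \<open>The two-parameter family is replaced by functions of one time: \<open>E t s\<close>
  turns out to be \<open>ev t ** ev_inv s\<close>.\<close>

definition ev :: "real \<Rightarrow> real ^ 'd ^ 'd" where "ev t = E t 0"

definition ev_inv :: "real \<Rightarrow> real ^ 'd ^ 'd" where "ev_inv t = matrix_inv (E t 0)"

lemma deriv_E:
  assumes "0 \<le> s" "0 \<le> t"
  shows "((\<lambda>t. E t s) has_vector_derivative (Q t ** E t s)) (at t within {0..})"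
  using evolution assms unfolding evolution_matrices_def by blast

lemma E_refl: "0 \<le> s \<Longrightarrow> E s s = mat 1"
  using evolution unfolding evolution_matrices_def by blast

lemma deriv_ev: "0 \<le> t \<Longrightarrow> (ev has_vector_derivative (Q t ** ev t)) (at t within {0..})"
  using deriv_E[of 0 t] unfolding ev_def by simp

lemma continuous_on_ev: "continuous_on {0..} ev"
  using deriv_ev by (auto simp: continuous_on_eq_continuous_within intro: has_vector_derivative_continuous)

text \<open>Gronwall's inequality backwards in time: a solution that vanishes at \<open>s\<close> vanishes at \<open>0\<close>.\<close>

lemma ev_inj:
  assumes s: "0 \<le> s" and zero: "ev s *v v = 0"
  shows "v = 0"
proof -
  obtain K where K: "norm (A *v x) \<le> norm A * norm x * K" "0 \<le> K" for A :: "real ^ 'd ^ 'd" and x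
    using matrix_vector.nonneg_bounded by blast
  have "compact (Q ` {0..s})"
    by (rule compact_continuous_image[OF continuous_on_subset[OF cont_Q]]) auto
  then obtain C where C: "\<And>t. t \<in> {0..s} \<Longrightarrow> norm (Q t) \<le> C"
    using compact_imp_bounded[of "Q ` {0..s}"] unfolding bounded_iff by blast
  \<comment> \<open>\<open>C\<close> bounds \<open>Q\<close> on the interval and \<open>K\<close> is
    the constant of the bilinear product, so the derivative of the squared norm of \<open>x\<close>
    is at least \<open>- 2 * L\<close> times that squared norm. The weight
    \<open>exp (2 * L * t)\<close> then makes it nondecreasing.\<close>
  define L where "L = C * K"
  define x where "x t = ev t *v v" for t
  have dx: "(x has_vector_derivative (Q t *v x t)) (at t within {0..s})" if "t \<in> {0..s}" for t
  proof -
    have "(ev has_vector_derivative (Q t ** ev t)) (at t within {0..s})"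
      using deriv_ev[of t] that by (auto intro: has_vector_derivative_within_subset)
    from bounded_linear.has_vector_derivative[OF matrix_vector.bounded_linear_left[of v] this]
    show ?thesis unfolding x_def by (simp add: matrix_vector_mul_assoc)
  qed
  have dpsi: "((\<lambda>t. (x t \<bullet> x t) * exp (2 * L * t)) has_vector_derivative
      (2 * (x t \<bullet> (Q t *v x t)) + 2 * L * (x t \<bullet> x t)) * exp (2 * L * t)) (at t within {0..s})"
    if "t \<in> {0..s}" for t
    by (rule derivative_eq_intros refl bounded_bilinear.has_vector_derivative[OF bounded_bilinear_inner] dx that
        | simp add: has_real_derivative_iff_has_vector_derivative[symmetric])+
       (auto intro!: derivative_eq_intros simp: algebra_simps inner_commute)
  have "((\<lambda>t. (2 * (x t \<bullet> (Q t *v x t)) + 2 * L * (x t \<bullet> x t)) * exp (2 * L * t)) has_integral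
      (x s \<bullet> x s) * exp (2 * L * s) - (x 0 \<bullet> x 0) * exp (2 * L * 0)) {0..s}"
    by (rule fundamental_theorem_of_calculus[OF s dpsi])
  moreover have "0 \<le> (2 * (x t \<bullet> (Q t *v x t)) + 2 * L * (x t \<bullet> x t)) * exp (2 * L * t)"
    if "t \<in> {0..s}" for t
  proof -
    have "\<bar>x t \<bullet> (Q t *v x t)\<bar> \<le> norm (x t) * norm (Q t *v x t)"
      by (rule Cauchy_Schwarz_ineq2)
    also have "\<dots> \<le> norm (x t) * (C * norm (x t) * K)"
      using K C[OF that] by (intro mult_left_mono order_trans[OF K(1)] mult_right_mono) auto
    also have "\<dots> = L * (x t \<bullet> x t)"
      by (simp add: L_def power2_norm_eq_inner[symmetric] power2_eq_square)
    finally show ?thesis by simp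
  qed
  ultimately have "0 \<le> (x s \<bullet> x s) * exp (2 * L * s) - (x 0 \<bullet> x 0) * exp (2 * L * 0)"
    by (rule has_integral_nonneg)
  then have "x 0 \<bullet> x 0 \<le> 0"
    using zero by (simp add: x_def)
  then have "v \<bullet> v \<le> 0"
    using E_refl[of 0] by (simp add: x_def ev_def)
  then show ?thesis
    by (metis antisym inner_eq_zero_iff inner_ge_zero)
qed

lemma ev_inverse:
  assumes "0 \<le> t"
  shows "ev t ** ev_inv t = mat 1" "ev_inv t ** ev t = mat 1"
proof -
  obtain B where "B ** ev t = mat 1"
    using ev_inj[OF assms] matrix_left_invertible_ker[of "ev t"] by blast
  moreover from this have "ev t ** B = mat 1"
    using matrix_left_right_inverse by blast
  moreover from this have "ev_inv t = B"
    unfolding ev_inv_def ev_def[symmetric] by (rule matrix_inv_eq)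
  ultimately show "ev t ** ev_inv t = mat 1" "ev_inv t ** ev t = mat 1"
    by simp_all
qed

lemma continuous_on_ev_inv: "continuous_on {0..} ev_inv"
  by (rule continuous_on_matrix_inverse[OF continuous_on_ev]) (simp add: ev_inverse)

lemma deriv_ev_inv:
  assumes "0 \<le> t"
  shows "(ev_inv has_vector_derivative - (ev_inv t ** Q t)) (at t within {0..})"
proof -
  have "(ev_inv has_vector_derivative - (ev_inv t ** (Q t ** ev t) ** ev_inv t)) (at t within {0..})"
    by (rule has_vector_derivative_matrix_inverse[OF deriv_ev continuous_on_ev])
      (use assms in \<open>auto simp: ev_inverse\<close>)
  also have "ev_inv t ** (Q t ** ev t) ** ev_inv t = ev_inv t ** Q t"
    using ev_inverse[OF assms] by (simp add: matrix_mul_assoc[symmetric])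
  finally show ?thesis .
qed

text \<open>The two terms in the derivative of \<open>ev_inv t ** E t s\<close> cancel, so this
  product keeps the value \<open>ev_inv s\<close> that it has at \<open>t = s\<close>. The
  composition law of the evolution matrices is thus a consequence of the differential
  equation.\<close>

lemma E_eq:
  assumes s: "0 \<le> s" and t: "0 \<le> t"
  shows "E t s = ev t ** ev_inv s"
proof -
  have "((\<lambda>t. ev_inv t ** E t s) has_vector_derivative 0) (at u within {0..})" if "u \<in> {0..}" for u
  proof -
    have "((\<lambda>t. ev_inv t ** E t s) has_vector_derivative
        ev_inv u ** (Q u ** E u s) + - (ev_inv u ** Q u) ** E u s) (at u within {0..})"
      using that by (intro matrix_matrix.has_vector_derivative
          deriv_ev_inv deriv_E s) auto
    then show ?thesis
      by (simp add: matrix_mul_assoc matrix_matrix.minus_left)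
  qed
  then have "ev_inv t ** E t s = ev_inv s ** E s s"
    using has_vector_derivative_zero_constant[of "{0..}" "\<lambda>t. ev_inv t ** E t s"] s t by fastforce
  then have "ev t ** (ev_inv t ** E t s) = ev t ** ev_inv s"
    using E_refl[OF s] by simp
  then show ?thesis
    using ev_inverse[OF t] by (simp add: matrix_mul_assoc)
qed

text \<open>Variation of constants for \<open>z\<^sub>t = c\<^sub>t + \<integral>\<^sub>0\<^sup>t (Q\<^sub>u z\<^sub>u + r\<^sub>u) du\<close> with a forcing term \<open>c\<close> that
  need not be differentiable.\<close>

lemma variation_of_constants:
  fixes z r :: "real \<Rightarrow> real ^ 'd"
  assumes z: "continuous_on {0..} z" and r: "continuous_on {0..} r" and t: "0 \<le> t"
    and c: "\<And>u. 0 \<le> u \<Longrightarrow> c u = z u - integral {0..u} (\<lambda>v. Q v *v z v + r v)"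
  shows "ev_inv t *v z t = ev_inv t *v c t + integral {0..t} (\<lambda>u. ev_inv u *v r u)
           + integral {0..t} (\<lambda>u. (ev_inv u ** Q u) *v c u)" and "continuous_on {0..} c"
proof -
  define n where "n u = integral {0..u} (\<lambda>v. Q v *v z v + r v)" for u
  have cont: "continuous_on {0..} (\<lambda>v. Q v *v z v + r v)"
    by (intro continuous_intros z r cont_Q)
  have dn: "(n has_vector_derivative (Q u *v z u + r u)) (at u within {0..s})" if "u \<in> {0..s}" for u s
    unfolding n_def
    by (rule integral_has_vector_derivative[OF continuous_on_subset[OF cont] that]) auto
  have cont_n: "continuous_on {0..s} n" for s
    by (rule continuous_on_vector_derivative[OF dn])
  have restrict: "continuous_on {0..s} f" if "continuous_on {0..} f" for s and f :: "real \<Rightarrow> 'b::topological_space"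
    by (rule continuous_on_subset[OF that]) auto
  have cont_c': "continuous_on {0..s} c" for s
  proof -
    have "continuous_on {0..s} (\<lambda>u. z u - n u)"
      by (intro continuous_intros cont_n restrict z)
    then show ?thesis
      by (rule continuous_on_eq) (simp add: c n_def)
  qed
  show cont_c: "continuous_on {0..} c"
    unfolding continuous_on_eq_continuous_within
  proof
    fix x :: real assume x: "x \<in> {0..}"
    \<comment> \<open>Continuity is known on compact intervals. Ending the interval at
      \<open>x + 1\<close> keeps \<open>x\<close> away from its right end, so the one-sided
      neighbourhoods agree with those of the half-line.\<close>
    have "continuous (at x within {0..x+1}) c"
      using cont_c'[of "x+1"] x by (auto simp: continuous_on_eq_continuous_within)
    moreover have "at x within {0..x+1} = at x within {0..}"
      by (rule at_within_nhd[of _ "{..<x+1}"]) (use x in auto)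
    ultimately show "continuous (at x within {0..}) c"
      by simp
  qed
  \<comment> \<open>Only the integral part \<open>n = z - c\<close> is differentiable. The product
    rule gives \<open>ev_inv u *v (Q u *v z u + r u)\<close> minus
    \<open>(ev_inv u ** Q u) *v n u\<close>, and the difference of \<open>z\<close> and
    \<open>n\<close> leaves \<open>c\<close>.\<close>
  have d: "((\<lambda>u. ev_inv u *v n u) has_vector_derivative
      (ev_inv u *v r u + (ev_inv u ** Q u) *v c u)) (at u within {0..t})" if "u \<in> {0..t}" for u
  proof -
    have "((\<lambda>u. ev_inv u *v n u) has_vector_derivative
        ev_inv u *v (Q u *v z u + r u) + (- (ev_inv u ** Q u)) *v n u) (at u within {0..t})"
      using that by (intro matrix_vector.has_vector_derivative
          dn has_vector_derivative_within_subset[OF deriv_ev_inv]) auto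
    moreover have "n u = z u - c u"
      using that by (simp add: c n_def)
    ultimately show ?thesis
      by (simp add: algebra_simps matrix_vector_mul_assoc
        matrix_vector.minus_left)
  qed
  have "ev_inv t *v n t - ev_inv 0 *v n 0 = integral {0..t} (\<lambda>u. ev_inv u *v r u + (ev_inv u ** Q u) *v c u)"
    by (rule integral_unique[OF fundamental_theorem_of_calculus[OF t d], symmetric])
  also have "\<dots> =
      integral {0..t} (\<lambda>u. ev_inv u *v r u) + integral {0..t} (\<lambda>u. (ev_inv u ** Q u) *v c u)"
    by (intro integral_add integrable_continuous_real continuous_intros restrict r cont_c
        continuous_on_ev_inv cont_Q)
  also have "ev_inv t *v n t - ev_inv 0 *v n 0 = ev_inv t *v z t - ev_inv t *v c t"
    using c[OF t] unfolding n_def[symmetric] by (simp add: n_def matrix_vector_mult_diff_distrib)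
  finally show "ev_inv t *v z t = ev_inv t *v c t + integral {0..t} (\<lambda>u. ev_inv u *v r u)
           + integral {0..t} (\<lambda>u. (ev_inv u ** Q u) *v c u)"
    by (simp only: diff_eq_eq add_ac)
qed

end

section \<open>Characteristic functions and finite-dimensional distributions\<close>

lemma borel_measurable_cis [measurable (raw)]:
  "f \<in> borel_measurable M \<Longrightarrow> (\<lambda>x. cis (f x)) \<in> borel_measurable M"
  unfolding cis_conv_exp by measurable

text \<open>The law of \<open>X\<close> under the measure with density proportional to
  \<open>w\<close>. The normalization makes it a probability measure, so that Levy's uniqueness
  theorem applies to weighted expectations.\<close>

definition weighted_distr :: "'a measure \<Rightarrow> ('a \<Rightarrow> real) \<Rightarrow> ('a \<Rightarrow> real) \<Rightarrow> real measure" where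
  "weighted_distr M w X = distr (density M (\<lambda>\<omega>. ennreal (w \<omega> / (LINT \<omega>|M. w \<omega>)))) borel X"

lemma weighted_distr:
  assumes [measurable]: "X \<in> borel_measurable M" "w \<in> borel_measurable M"
    and w: "integrable M w" "\<And>\<omega>. 0 \<le> w \<omega>" and pos: "0 < (LINT \<omega>|M. w \<omega>)"
  shows "real_distribution (weighted_distr M w X)"
    and "char (weighted_distr M w X) s = (LINT \<omega>|M. w \<omega> *\<^sub>R cis (s * X \<omega>)) / of_real (LINT \<omega>|M. w \<omega>)"
    and "A \<in> sets borel \<Longrightarrow> (LINT x|weighted_distr M w X. indicator A x) =
      (LINT \<omega>|M. w \<omega> * indicator A (X \<omega>)) / (LINT \<omega>|M. w \<omega>)"
proof -
  define c where "c = (LINT \<omega>|M. w \<omega>)"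
  have c: "0 < c" using pos by (simp add: c_def)
  have "prob_space (density M (\<lambda>\<omega>. ennreal (w \<omega> / c)))"
    by (intro prob_spaceI, subst emeasure_density)
      (use w c in \<open>auto simp: nn_integral_eq_integral c_def[symmetric] cong: nn_integral_cong\<close>)
  then show "real_distribution (weighted_distr M w X)"
    unfolding weighted_distr_def c_def[symmetric] real_distribution_def real_distribution_axioms_def
    by (auto intro: prob_space.prob_space_distr)
  show "char (weighted_distr M w X) s = (LINT \<omega>|M. w \<omega> *\<^sub>R cis (s * X \<omega>)) / of_real (LINT \<omega>|M. w \<omega>)"
    unfolding char_def weighted_distr_def c_def[symmetric] cis_conv_exp[symmetric] using w c
    by (subst integral_distr) (auto simp: integral_density scaleR_conv_of_real
        intro!: trans[OF _ integral_divide_zero] Bochner_Integration.integral_cong)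
  show "(LINT x|weighted_distr M w X. indicator A x) =
      (LINT \<omega>|M. w \<omega> * indicator A (X \<omega>)) / (LINT \<omega>|M. w \<omega>)" if [measurable]: "A \<in> sets borel"
    unfolding weighted_distr_def c_def[symmetric] using w c
    by (subst integral_distr) (auto simp: integral_density
        intro!: trans[OF _ integral_divide_zero] Bochner_Integration.integral_cong)
qed

text \<open>One-dimensional uniqueness for finite measures. The frequency \<open>s = 0\<close> shows
  that the total masses agree. If they vanish, both weights are null almost everywhere; otherwise
  both sides are normalized.\<close>

lemma weighted_integral_eqI:
  fixes X :: "'a \<Rightarrow> real" and Y :: "'b \<Rightarrow> real"
  assumes M: "prob_space M" and N: "prob_space N"
    and [measurable]: "X \<in> borel_measurable M" "Y \<in> borel_measurable N"
      "w \<in> borel_measurable M" "v \<in> borel_measurable N"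
    and w: "\<And>\<omega>. 0 \<le> w \<omega>" "\<And>\<omega>. w \<omega> \<le> (C::real)" and v: "\<And>\<omega>. 0 \<le> v \<omega>" "\<And>\<omega>. v \<omega> \<le> C"
    and eq: "\<And>s. (LINT \<omega>|M. w \<omega> *\<^sub>R cis (s * X \<omega>)) = (LINT \<omega>|N. v \<omega> *\<^sub>R cis (s * Y \<omega>))"
    and A[measurable]: "A \<in> sets borel"
  shows "(LINT \<omega>|M. w \<omega> * indicator A (X \<omega>)) = (LINT \<omega>|N. v \<omega> * indicator A (Y \<omega>))"
proof -
  interpret M: prob_space M by fact
  interpret N: prob_space N by fact
  have int_w: "integrable M w"
    by (rule M.integrable_const_bound[of _ C]) (use w in auto)
  have int_v: "integrable N v"
    by (rule N.integrable_const_bound[of _ C]) (use v in auto)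
  have total: "(LINT \<omega>|M. w \<omega>) = (LINT \<omega>|N. v \<omega>)"
    using eq[of 0] by (simp add: of_real_def[symmetric])
  have "0 \<le> (LINT \<omega>|M. w \<omega>)"
    using w by simp
  then consider "(LINT \<omega>|M. w \<omega>) = 0" | "0 < (LINT \<omega>|M. w \<omega>)" by linarith
  then show ?thesis
  proof cases
    case 1
    have "AE \<omega> in M. w \<omega> = 0"
      using integral_nonneg_eq_0_iff_AE[OF int_w] w 1 by simp
    then have "(LINT \<omega>|M. w \<omega> * indicator A (X \<omega>)) = (LINT \<omega>|M. 0)"
      by (intro integral_cong_AE) auto
    moreover have "AE \<omega> in N. v \<omega> = 0"
      using integral_nonneg_eq_0_iff_AE[OF int_v] v 1 total by simp
    then have "(LINT \<omega>|N. v \<omega> * indicator A (Y \<omega>)) = (LINT \<omega>|N. 0)"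
      by (intro integral_cong_AE) auto
    ultimately show ?thesis by simp
  next
    case 2
    have pos: "0 < (LINT \<omega>|N. v \<omega>)" using 2 total by simp
    note Mw = weighted_distr[OF assms(3,5) int_w w(1) 2]
    note Nv = weighted_distr[OF assms(4,6) int_v v(1) pos]
    have "weighted_distr M w X = weighted_distr N v Y"
      by (rule Levy_uniqueness) (simp_all add: Mw Nv fun_eq_iff eq total)
    then show ?thesis
      using Mw(3)[OF A] Nv(3)[OF A] 2 total by simp
  qed
qed

section \<open>Nonnegative weights in place of complex exponentials\<close>

lemma weight_bounds:
  fixes g b :: real
  assumes "0 \<le> g" "g \<le> 1"
  shows "0 \<le> g * (1 + cos b)" "g * (1 + cos b) \<le> 2" "0 \<le> g * (1 + sin b)" "g * (1 + sin b) \<le> 2"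
proof -
  have "0 \<le> 1 + cos b" "1 + cos b \<le> 2" "0 \<le> 1 + sin b" "1 + sin b \<le> 2"
    using cos_ge_minus_one[of b] sin_ge_minus_one[of b] cos_le_one[of b] sin_le_one[of b] by linarith+
  then show "0 \<le> g * (1 + cos b)" "g * (1 + cos b) \<le> 2" "0 \<le> g * (1 + sin b)" "g * (1 + sin b) \<le> 2"
    using mult_mono[OF assms(2), of "1 + cos b" 2] mult_mono[OF assms(2), of "1 + sin b" 2] assms by auto
qed

text \<open>Here and in \<open>weight_sin\<close> a trigonometric weight only shifts the phase by
  \<open>b\<close> or \<open>- b\<close>, so the weighted characteristic function is a combination
  of unweighted ones at three phases.\<close>

lemma weight_cos: "(g * (1 + cos b)) *\<^sub>R cis a
    = g *\<^sub>R cis a + (g *\<^sub>R cis (a + b) + g *\<^sub>R cis (a - b)) / 2"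
  by (simp add: complex_eq_iff cos_add sin_add cos_diff sin_diff algebra_simps)

lemma weight_sin: "(g * (1 + sin b)) *\<^sub>R cis a
    = g *\<^sub>R cis a + (- \<i> / 2) * (g *\<^sub>R cis (a + b) - g *\<^sub>R cis (a - b))"
  by (simp add: complex_eq_iff cos_add sin_add cos_diff sin_diff field_simps)

text \<open>Recovers the complex exponential from the weights \<open>1 + cos b\<close> and
  \<open>1 + sin b\<close>; subtracting the plain weight \<open>g\<close> undoes the shift by 1 that
  made them nonnegative.\<close>

lemma weight_split: "(x * g) *\<^sub>R cis b = of_real (g * (1 + cos b) * x) - of_real (g * x)
    + \<i> * (of_real (g * (1 + sin b) * x) - of_real (g * x))"
  by (simp add: complex_eq_iff algebra_simps)

lemma integrable_weight:
  fixes w :: "'a \<Rightarrow> real"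
  assumes M: "prob_space M" and [measurable]: "w \<in> borel_measurable M" "X \<in> borel_measurable M" "A \<in> sets borel"
    and w: "\<And>\<omega>. 0 \<le> w \<omega>" "\<And>\<omega>. w \<omega> \<le> C"
  shows "integrable M (\<lambda>\<omega>. w \<omega> * indicator A (X \<omega>))"
proof -
  interpret prob_space M by fact
  have "0 \<le> C" using w order_trans by blast
  then show ?thesis
    by (intro integrable_const_bound[of _ C]) (use w in \<open>auto simp: indicator_def\<close>)
qed

lemma integral_of_real_parts:
  assumes "integrable K a" "integrable K b" "integrable K c"
  shows "(LINT \<omega>|K. complex_of_real (a \<omega>) - of_real (b \<omega>) + \<i> * (of_real (c \<omega>) - of_real (b \<omega>)))
    = of_real (LINT \<omega>|K. a \<omega>) - of_real (LINT \<omega>|K. b \<omega>) + \<i> * (of_real (LINT \<omega>|K. c \<omega>) - of_real (LINT \<omega>|K. b \<omega>))"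
  using assms by (simp add: integrable_of_real)

text \<open>One coordinate at a time the exponential is replaced by an indicator function. The complex weight is
  split into nonnegative weights so that the one-dimensional uniqueness theorem applies.\<close>

lemma indicator_char_eq:
  fixes X :: "'i \<Rightarrow> 'a \<Rightarrow> real" and Y :: "'i \<Rightarrow> 'b \<Rightarrow> real"
  assumes M: "prob_space M" and N: "prob_space N" and I: "finite I"
    and X[measurable]: "\<And>i. i \<in> I \<Longrightarrow> X i \<in> borel_measurable M"
    and Y[measurable]: "\<And>i. i \<in> I \<Longrightarrow> Y i \<in> borel_measurable N"
    and eq: "\<And>\<theta>. (LINT \<omega>|M. cis (\<Sum>i\<in>I. \<theta> i * X i \<omega>)) = (LINT \<omega>|N. cis (\<Sum>i\<in>I. \<theta> i * Y i \<omega>))"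
    and L: "L \<subseteq> I" and A: "\<And>i. i \<in> I \<Longrightarrow> A i \<in> sets borel"
  shows "(LINT \<omega>|M. (\<Prod>i\<in>L. indicator (A i) (X i \<omega>)) *\<^sub>R cis (\<Sum>i\<in>I - L. \<theta> i * X i \<omega>))
       = (LINT \<omega>|N. (\<Prod>i\<in>L. indicator (A i) (Y i \<omega>)) *\<^sub>R cis (\<Sum>i\<in>I - L. \<theta> i * Y i \<omega>))"
proof -
  interpret M: prob_space M by fact
  interpret N: prob_space N by fact
  have "finite L" using L I finite_subset by blast
  then show ?thesis using L
  proof (induction L arbitrary: \<theta>)
    case empty
    then show ?case using eq by simp
  next
    case (insert j L)
    define g where "g \<omega> = (\<Prod>i\<in>L. indicator (A i) (X i \<omega>) :: real)" for \<omega>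
    define h where "h \<omega> = (\<Prod>i\<in>L. indicator (A i) (Y i \<omega>) :: real)" for \<omega>
    define S where "S \<omega> = (\<Sum>i\<in>I - insert j L. \<theta> i * X i \<omega>)" for \<omega>
    define R where "R \<omega> = (\<Sum>i\<in>I - insert j L. \<theta> i * Y i \<omega>)" for \<omega>
    have [measurable]: "j \<in> I" "A j \<in> sets borel" using insert.prems A by auto
    have [measurable]: "g \<in> borel_measurable M" "h \<in> borel_measurable N"
      "S \<in> borel_measurable M" "R \<in> borel_measurable N"
      unfolding g_def h_def S_def R_def using insert.prems A
      by (auto intro!: borel_measurable_prod borel_measurable_sum borel_measurable_indicator'
          borel_measurable_times simp: subset_eq measurable_sets pred_def)
    have g01: "0 \<le> g \<omega>" "g \<omega> \<le> 1" for \<omega>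
      unfolding g_def by (auto intro!: prod_nonneg prod_le_1)
    have h01: "0 \<le> h \<omega>" "h \<omega> \<le> 1" for \<omega>
      unfolding h_def by (auto intro!: prod_nonneg prod_le_1)
    have split: "I - L = insert j (I - insert j L)" "j \<notin> I - insert j L" "finite (I - insert j L)"
      using insert I by auto
    \<comment> \<open>The induction hypothesis is used with frequency \<open>s\<close> at the
      coordinate \<open>j\<close> and the remaining frequencies scaled by \<open>c\<close>. The
      values 0, 1 and -1 of \<open>c\<close> supply the three phases of \<open>weight_cos\<close>
      and \<open>weight_sin\<close>.\<close>
    have *: "(LINT \<omega>|M. g \<omega> *\<^sub>R cis (s * X j \<omega> + c * S \<omega>)) = (LINT \<omega>|N. h \<omega> *\<^sub>R cis (s * Y j \<omega> + c * R \<omega>))" for s c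
    proof -
      have "(\<Sum>i\<in>I - insert j L. (if i = j then s else c * \<theta> i) * X i \<omega>) = c * S \<omega>" for \<omega>
        unfolding S_def sum_distrib_left by (intro sum.cong) auto
      moreover have "(\<Sum>i\<in>I - insert j L. (if i = j then s else c * \<theta> i) * Y i \<omega>) = c * R \<omega>" for \<omega>
        unfolding R_def sum_distrib_left by (intro sum.cong) auto
      ultimately show ?thesis
        using insert.IH[of "\<lambda>i. if i = j then s else c * \<theta> i"] insert.prems split(2,3)
        unfolding g_def[symmetric] h_def[symmetric] split(1) by simp
    qed
    have intM: "integrable M (\<lambda>\<omega>. g \<omega> *\<^sub>R cis (s * X j \<omega> + c * S \<omega>))" for s c
      by (rule M.integrable_const_bound[of _ 1]) (use g01 in auto)
    have intN: "integrable N (\<lambda>\<omega>. h \<omega> *\<^sub>R cis (s * Y j \<omega> + c * R \<omega>))" for s c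
      by (rule N.integrable_const_bound[of _ 1]) (use h01 in auto)
    note intM' = intM[of _ 0, simplified] intM[of _ 1, simplified] intM[of _ "-1", simplified]
    note intN' = intN[of _ 0, simplified] intN[of _ 1, simplified] intN[of _ "-1", simplified]
    note eqs = *[of _ 0, simplified] *[of _ 1, simplified] *[of _ "-1", simplified]
    have w0: "(LINT \<omega>|M. g \<omega> * indicator (A j) (X j \<omega>)) = (LINT \<omega>|N. h \<omega> * indicator (A j) (Y j \<omega>))"
      by (rule weighted_integral_eqI[OF M N, where C=1]) (use g01 h01 eqs in auto)
    have w1: "(LINT \<omega>|M. (g \<omega> * (1 + cos (S \<omega>))) * indicator (A j) (X j \<omega>))
            = (LINT \<omega>|N. (h \<omega> * (1 + cos (R \<omega>))) * indicator (A j) (Y j \<omega>))"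
      by (rule weighted_integral_eqI[OF M N, where C=2])
        (simp_all only: weight_bounds[OF g01] weight_bounds[OF h01] weight_cos, auto simp: intM' intN' eqs)
    have w2: "(LINT \<omega>|M. (g \<omega> * (1 + sin (S \<omega>))) * indicator (A j) (X j \<omega>))
            = (LINT \<omega>|N. (h \<omega> * (1 + sin (R \<omega>))) * indicator (A j) (Y j \<omega>))"
      by (rule weighted_integral_eqI[OF M N, where C=2])
        (simp_all only: weight_bounds[OF g01] weight_bounds[OF h01] weight_sin, auto simp: intM' intN' eqs)
    have goalM: "(\<Prod>i\<in>insert j L. indicator (A i) (X i \<omega>)) = indicator (A j) (X j \<omega>) * g \<omega>" for \<omega>
      using insert by (simp add: g_def)
    have goalN: "(\<Prod>i\<in>insert j L. indicator (A i) (Y i \<omega>)) = indicator (A j) (Y j \<omega>) * h \<omega>" for \<omega>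
      using insert by (simp add: h_def)
    have ia: "integrable M (\<lambda>\<omega>. g \<omega> * (1 + cos (S \<omega>)) * indicator (A j) (X j \<omega>))"
      by (rule integrable_weight[OF M, where C=2]) (auto simp: weight_bounds[OF g01])
    have ib: "integrable M (\<lambda>\<omega>. g \<omega> * indicator (A j) (X j \<omega>))"
      by (rule integrable_weight[OF M, where C=1]) (auto simp: g01)
    have ic: "integrable M (\<lambda>\<omega>. g \<omega> * (1 + sin (S \<omega>)) * indicator (A j) (X j \<omega>))"
      by (rule integrable_weight[OF M, where C=2]) (auto simp: weight_bounds[OF g01])
    have ja: "integrable N (\<lambda>\<omega>. h \<omega> * (1 + cos (R \<omega>)) * indicator (A j) (Y j \<omega>))"
      by (rule integrable_weight[OF N, where C=2]) (auto simp: weight_bounds[OF h01])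
    have jb: "integrable N (\<lambda>\<omega>. h \<omega> * indicator (A j) (Y j \<omega>))"
      by (rule integrable_weight[OF N, where C=1]) (auto simp: h01)
    have jc: "integrable N (\<lambda>\<omega>. h \<omega> * (1 + sin (R \<omega>)) * indicator (A j) (Y j \<omega>))"
      by (rule integrable_weight[OF N, where C=2]) (auto simp: weight_bounds[OF h01])
    show ?case
      unfolding S_def[symmetric] R_def[symmetric] goalM goalN weight_split
      unfolding integral_of_real_parts[OF ia ib ic] integral_of_real_parts[OF ja jb jc] w0 w1 w2 ..
  qed
qed

text \<open>Replacing all coordinates, that is \<open>L = I\<close>, yields equal probabilities of
  all boxes \<open>Pi\<^sub>E I A\<close>, and boxes form an intersection-stable generator of the
  product sigma-algebra.\<close>

theorem distr_eq_if_char_eq: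
  fixes X :: "'i \<Rightarrow> 'a \<Rightarrow> real" and Y :: "'i \<Rightarrow> 'b \<Rightarrow> real"
  assumes M: "prob_space M" and N: "prob_space N" and I: "finite I"
    and X[measurable]: "\<And>i. i \<in> I \<Longrightarrow> X i \<in> borel_measurable M"
    and Y[measurable]: "\<And>i. i \<in> I \<Longrightarrow> Y i \<in> borel_measurable N"
    and eq: "\<And>\<theta>. (LINT \<omega>|M. cis (\<Sum>i\<in>I. \<theta> i * X i \<omega>)) = (LINT \<omega>|N. cis (\<Sum>i\<in>I. \<theta> i * Y i \<omega>))"
  shows "distr M (PiM I (\<lambda>_. borel)) (\<lambda>\<omega>. \<lambda>i\<in>I. X i \<omega>) = distr N (PiM I (\<lambda>_. borel)) (\<lambda>\<omega>. \<lambda>i\<in>I. Y i \<omega>)"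
proof (rule measure_eqI_PiM_finite[OF I])
  interpret M: prob_space M by fact
  interpret N: prob_space N by fact
  fix A :: "'i \<Rightarrow> real set"
  assume A: "\<And>i. i \<in> I \<Longrightarrow> A i \<in> sets borel"
  then have PA: "Pi\<^sub>E I A \<in> sets (PiM I (\<lambda>_. borel))"
    using I by (intro sets_PiM_I_finite) auto
  have mX: "(\<lambda>\<omega>. \<lambda>i\<in>I. X i \<omega>) \<in> measurable M (PiM I (\<lambda>_. borel))"
    by (intro measurable_restrict X)
  have mY: "(\<lambda>\<omega>. \<lambda>i\<in>I. Y i \<omega>) \<in> measurable N (PiM I (\<lambda>_. borel))"
    by (intro measurable_restrict Y)
  have ind: "(\<Prod>i\<in>I. indicator (A i) (f i)) = (indicator (Pi\<^sub>E I A) (\<lambda>i\<in>I. f i) :: real)" for f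
    using I by (auto simp: indicator_def prod_zero_iff intro!: prod.neutral)
  have "(LINT \<omega>|M. (indicator (Pi\<^sub>E I A) (\<lambda>i\<in>I. X i \<omega>) :: real) *\<^sub>R cis 0)
      = (LINT \<omega>|N. (indicator (Pi\<^sub>E I A) (\<lambda>i\<in>I. Y i \<omega>) :: real) *\<^sub>R cis 0)"
    using indicator_char_eq[OF M N I X Y eq order_refl, where \<theta> = "\<lambda>_. 0" and A = A] A unfolding ind by simp
  then have "(LINT \<omega>|M. (indicator (Pi\<^sub>E I A) (\<lambda>i\<in>I. X i \<omega>) :: real))
      = (LINT \<omega>|N. (indicator (Pi\<^sub>E I A) (\<lambda>i\<in>I. Y i \<omega>) :: real))"
    by (simp add: scaleR_conv_of_real)
  moreover have "(LINT \<omega>|M. (indicator (Pi\<^sub>E I A) (\<lambda>i\<in>I. X i \<omega>) :: real)) =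
      measure (distr M (PiM I (\<lambda>_. borel)) (\<lambda>\<omega>. \<lambda>i\<in>I. X i \<omega>)) (Pi\<^sub>E I A)"
    using PA integral_distr[OF mX, of "indicator (Pi\<^sub>E I A) :: _ \<Rightarrow> real"] sets.Int_space_eq2[OF PA] by simp
  moreover have "(LINT \<omega>|N. (indicator (Pi\<^sub>E I A) (\<lambda>i\<in>I. Y i \<omega>) :: real)) =
      measure (distr N (PiM I (\<lambda>_. borel)) (\<lambda>\<omega>. \<lambda>i\<in>I. Y i \<omega>)) (Pi\<^sub>E I A)"
    using PA integral_distr[OF mY, of "indicator (Pi\<^sub>E I A) :: _ \<Rightarrow> real"] sets.Int_space_eq2[OF PA] by simp
  ultimately show "emeasure (distr M (PiM I (\<lambda>_. borel)) (\<lambda>\<omega>. \<lambda>i\<in>I. X i \<omega>)) (Pi\<^sub>E I A)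
      = emeasure (distr N (PiM I (\<lambda>_. borel)) (\<lambda>\<omega>. \<lambda>i\<in>I. Y i \<omega>)) (Pi\<^sub>E I A)"
    by (simp add: finite_measure.emeasure_eq_measure[OF prob_space.finite_measure[OF M.prob_space_distr[OF mX]]]
        finite_measure.emeasure_eq_measure[OF prob_space.finite_measure[OF N.prob_space_distr[OF mY]]])
next
  interpret M: prob_space M by fact
  show "range (\<lambda>_::nat. space (PiM I (\<lambda>_. borel :: real measure))) \<subseteq> prod_algebra I (\<lambda>_. borel)"
    using space_in_prod_algebra[of I "\<lambda>_. borel :: real measure"] by (auto simp: space_PiM)
  fix i :: nat
  have mX: "(\<lambda>\<omega>. \<lambda>i\<in>I. X i \<omega>) \<in> measurable M (PiM I (\<lambda>_. borel))"
    by (intro measurable_restrict X)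
  show "emeasure (distr M (PiM I (\<lambda>_. borel)) (\<lambda>\<omega>. \<lambda>i\<in>I. X i \<omega>)) (space (PiM I (\<lambda>_. borel))) \<noteq> \<infinity>"
    using finite_measure.emeasure_finite[OF prob_space.finite_measure[OF M.prob_space_distr[OF mX]]] by simp
qed auto

text \<open>Pairs of a time and a coordinate form one finite index set to which the scalar statement
  applies. The measurable map \<open>G\<close> regroups the scalars into vectors and transports the
  equality of laws.\<close>

theorem equal_in_law_if_char_eq:
  fixes X :: "real \<Rightarrow> 'a \<Rightarrow> real ^ 'd" and Y :: "real \<Rightarrow> 'b \<Rightarrow> real ^ 'd"
  assumes M: "prob_space M" and N: "prob_space N"
    and X[measurable]: "\<And>t. t \<in> S \<Longrightarrow> X t \<in> borel_measurable M"
    and Y[measurable]: "\<And>t. t \<in> S \<Longrightarrow> Y t \<in> borel_measurable N"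
    and eq: "\<And>J \<theta>. finite J \<Longrightarrow> J \<subseteq> S \<Longrightarrow>
      (LINT \<omega>|M. cis (\<Sum>t\<in>J. \<theta> t \<bullet> X t \<omega>)) = (LINT \<omega>|N. cis (\<Sum>t\<in>J. \<theta> t \<bullet> Y t \<omega>))"
  shows "equal_in_law S M X N Y"
  unfolding equal_in_law_def
proof (intro allI impI)
  fix J assume J: "finite J \<and> J \<subseteq> S"
  define K where "K = J \<times> (UNIV :: 'd set)"
  define G where "G x = (\<lambda>t\<in>J. \<chi> i. x (t, i))" for x :: "real \<times> 'd \<Rightarrow> real"
  have K: "finite K" using J by (simp add: K_def)
  have mK: "(\<lambda>x. x (t, i)) \<in> borel_measurable (PiM K (\<lambda>_. borel :: real measure))" if "t \<in> J" for t i
    using that by (intro measurable_component_singleton) (auto simp: K_def)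
  have G: "G \<in> measurable (PiM K (\<lambda>_. borel)) (PiM J (\<lambda>_. borel))"
    unfolding G_def
    by (intro measurable_restrict, subst borel_measurable_euclidean_space)
      (auto simp: Basis_vec_def inner_axis intro!: mK)
  have comp: "(\<lambda>\<omega>. Z t \<omega> $ i) \<in> borel_measurable L" if "Z t \<in> borel_measurable L"
    for Z :: "real \<Rightarrow> 'z \<Rightarrow> real ^ 'd" and L t i
    using that by (intro borel_measurable_continuous_on[of "\<lambda>x. x $ i", OF _ that]) (auto intro: continuous_intros)
  have "distr M (PiM K (\<lambda>_. borel)) (\<lambda>\<omega>. \<lambda>p\<in>K. (case p of (t, i) \<Rightarrow> X t \<omega> $ i))
      = distr N (PiM K (\<lambda>_. borel)) (\<lambda>\<omega>. \<lambda>p\<in>K. (case p of (t, i) \<Rightarrow> Y t \<omega> $ i))"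
  proof (rule distr_eq_if_char_eq[OF M N K])
    fix \<theta> :: "real \<times> 'd \<Rightarrow> real"
    have "(\<Sum>p\<in>K. \<theta> p * (case p of (t, i) \<Rightarrow> x t $ i)) = (\<Sum>t\<in>J. (\<chi> i. \<theta> (t, i)) \<bullet> x t)"
      for x :: "real \<Rightarrow> real ^ 'd"
    proof -
      have "(\<Sum>p\<in>K. \<theta> p * (case p of (t, i) \<Rightarrow> x t $ i)) = (\<Sum>(t, i)\<in>J \<times> UNIV. \<theta> (t, i) * x t $ i)"
        unfolding K_def by (intro sum.cong) auto
      then show ?thesis
        by (simp add: sum.cartesian_product[symmetric] inner_vec_def)
    qed
    then show "(LINT \<omega>|M. cis (\<Sum>p\<in>K. \<theta> p * (case p of (t, i) \<Rightarrow> X t \<omega> $ i)))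
      = (LINT \<omega>|N. cis (\<Sum>p\<in>K. \<theta> p * (case p of (t, i) \<Rightarrow> Y t \<omega> $ i)))"
      using eq J by simp
  qed (use J in \<open>auto simp: K_def intro!: comp X Y\<close>)
  moreover have "distr L (PiM J (\<lambda>_. borel)) (\<lambda>\<omega>. \<lambda>t\<in>J. Z t \<omega>) =
      distr (distr L (PiM K (\<lambda>_. borel)) (\<lambda>\<omega>. \<lambda>p\<in>K. (case p of (t, i) \<Rightarrow> Z t \<omega> $ i))) (PiM J (\<lambda>_. borel)) G"
    if "\<And>t. t \<in> S \<Longrightarrow> Z t \<in> borel_measurable L" for Z :: "real \<Rightarrow> 'z \<Rightarrow> real ^ 'd" and L
  proof (subst distr_distr[OF G])
    show "(\<lambda>\<omega>. \<lambda>p\<in>K. (case p of (t, i) \<Rightarrow> Z t \<omega> $ i)) \<in> measurable L (PiM K (\<lambda>_. borel))"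
      using J by (intro measurable_restrict) (auto simp: K_def intro!: comp that)
    show "distr L (PiM J (\<lambda>_. borel)) (\<lambda>\<omega>. \<lambda>t\<in>J. Z t \<omega>) =
      distr L (PiM J (\<lambda>_. borel)) (G \<circ> (\<lambda>\<omega>. \<lambda>p\<in>K. (case p of (t, i) \<Rightarrow> Z t \<omega> $ i)))"
      by (intro distr_cong) (auto simp: G_def K_def fun_eq_iff vec_eq_iff)
  qed
  ultimately show "distr M (PiM J (\<lambda>_. borel)) (\<lambda>\<omega>. \<lambda>t\<in>J. X t \<omega>) =
      distr N (PiM J (\<lambda>_. borel)) (\<lambda>\<omega>. \<lambda>t\<in>J. Y t \<omega>)"
    using X Y by metis
qed

section \<open>The Ito isometry\<close>

lemma bounded_mult_imageE:
  fixes X Y :: "'a \<Rightarrow> real"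
  assumes "bounded (X ` S)" "bounded (Y ` S)"
  obtains C where "\<And>\<omega>. \<omega> \<in> S \<Longrightarrow> norm (X \<omega> * Y \<omega>) \<le> C"
proof -
  obtain a where a: "\<And>\<omega>. \<omega> \<in> S \<Longrightarrow> \<bar>X \<omega>\<bar> \<le> a"
    using assms(1) unfolding bounded_iff real_norm_def by blast
  obtain b where b: "\<And>\<omega>. \<omega> \<in> S \<Longrightarrow> \<bar>Y \<omega>\<bar> \<le> b"
    using assms(2) unfolding bounded_iff real_norm_def by blast
  have "norm (X \<omega> * Y \<omega>) \<le> a * b" if "\<omega> \<in> S" for \<omega>
    using mult_mono'[OF a[OF that] b[OF that]] by (simp add: abs_mult)
  then show ?thesis by (rule that)
qed

locale wiener_space = prob_space M
  for M :: "'w measure" +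
  fixes F :: "real \<Rightarrow> 'w measure" and B :: "real \<Rightarrow> 'w \<Rightarrow> real ^ 'p"
  assumes filtered: "filtered_prob_space M F" and wiener: "wiener_process M F B"
begin

definition incr :: "real \<Rightarrow> real \<Rightarrow> 'w \<Rightarrow> real ^ 'p" where
  "incr s t \<omega> = B t \<omega> - B s \<omega>"

lemma space_F: "0 \<le> s \<Longrightarrow> space (F s) = space M"
  using filtered by (auto simp: filtered_prob_space_def subalgebra_def)

lemma sets_F_mono: "0 \<le> s \<Longrightarrow> s \<le> t \<Longrightarrow> sets (F s) \<subseteq> sets (F t)"
  using filtered by (auto simp: filtered_prob_space_def)

lemma measurable_F_mono:
  assumes "f \<in> borel_measurable (F s)" "0 \<le> s" "s \<le> t"
  shows "f \<in> borel_measurable (F t)"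
proof -
  have "subalgebra (F t) (F s)"
    unfolding subalgebra_def using sets_F_mono assms(2,3) by (simp add: space_F)
  then show ?thesis
    by (rule measurable_from_subalg) fact
qed

lemma measurable_F_M:
  assumes "f \<in> borel_measurable (F s)" "0 \<le> s"
  shows "f \<in> borel_measurable M"
proof (rule measurable_from_subalg)
  show "subalgebra M (F s)"
    using filtered assms(2) unfolding filtered_prob_space_def by blast
qed fact

lemma measurable_B: "0 \<le> t \<Longrightarrow> B t \<in> borel_measurable (F t)"
  using wiener unfolding wiener_process_def by blast

lemmas wiener_incr = wiener[unfolded wiener_process_def, THEN conjunct2, THEN conjunct2, THEN conjunct2, rule_format]

lemma measurable_incr: "0 \<le> s \<Longrightarrow> s \<le> t \<Longrightarrow> incr s t \<in> borel_measurable (F t)"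
  unfolding incr_def[abs_def]
  by (intro borel_measurable_diff measurable_B measurable_F_mono[OF measurable_B]) auto

lemma measurable_incr_component: "0 \<le> s \<Longrightarrow> s \<le> t \<Longrightarrow> (\<lambda>\<omega>. incr s t \<omega> $ j) \<in> borel_measurable (F t)"
  by (rule borel_measurable_continuous_on[of "\<lambda>x. x $ j", OF _ measurable_incr])
    (auto intro: continuous_intros)

lemma incr_refl [simp]: "incr s s \<omega> = 0"
  by (simp add: incr_def)

lemma incr_add: "incr s t \<omega> = incr s u \<omega> + incr u t \<omega>"
  by (simp add: incr_def)

text \<open>The sigma-algebra generated by \<open>X\<close> lies in \<open>F s\<close>, and that of
  the transformed increment lies in the one generated by the increment; independence passes to
  sub-sigma-algebras.\<close>

lemma indep_incr:
  fixes X :: "'w \<Rightarrow> 'x::topological_space" and g :: "real ^ 'p \<Rightarrow> 'x"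
  assumes s: "0 \<le> s" "s < t" and X: "X \<in> borel_measurable (F s)" and g: "g \<in> borel_measurable borel"
  shows "indep_var borel X borel (\<lambda>\<omega>. g (incr s t \<omega>))"
proof -
  \<comment> \<open>The preimages in \<open>wiener_process\<close> already form the whole
    sigma-algebra \<open>V\<close>, so no extension from a generator is involved.\<close>
  define V where "V = vimage_algebra (space M) (incr s t) (borel :: (real ^ 'p) measure)"
  have ind: "indep_set (sets (F s)) {incr s t -` A \<inter> space M | A. A \<in> sets borel}"
    using wiener_incr[OF s, THEN conjunct1] by (simp only: incr_def[abs_def])
  have V: "sets V = {incr s t -` A \<inter> space M | A. A \<in> sets borel}"
    unfolding V_def by (rule sets_vimage_algebra2) auto
  have XM: "X \<in> borel_measurable M" using X s by (intro measurable_F_M) auto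
  have DM: "incr s t \<in> borel_measurable M" using s by (intro measurable_F_M[OF measurable_incr]) auto
  have gM: "(\<lambda>\<omega>. g (incr s t \<omega>)) \<in> borel_measurable M"
    using DM g by measurable
  have gV: "(\<lambda>\<omega>. g (incr s t \<omega>)) \<in> borel_measurable V"
  proof -
    have "incr s t \<in> measurable V borel"
      unfolding V_def by (rule measurable_vimage_algebra1) auto
    then show ?thesis using g by measurable
  qed
  define SX where "SX = sigma_sets (space M) {X -` A \<inter> space M | A. A \<in> sets borel}"
  define SD where "SD = sigma_sets (space M) {(\<lambda>\<omega>. g (incr s t \<omega>)) -` A \<inter> space M | A. A \<in> sets borel}"
  have sub1: "SX \<subseteq> sets (F s)"
  proof -
    have "{X -` A \<inter> space M | A. A \<in> sets borel} \<subseteq> sets (F s)"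
      using measurable_sets[OF X] s by (force simp: space_F)
    from sets.sigma_sets_subset[OF this] show ?thesis
      using s by (simp add: space_F SX_def)
  qed
  have sub2: "SD \<subseteq> sets V"
  proof -
    have "{(\<lambda>\<omega>. g (incr s t \<omega>)) -` A \<inter> space M | A. A \<in> sets borel} \<subseteq> sets V"
      using measurable_sets[OF gV] by (force simp: V_def)
    from sets.sigma_sets_subset[OF this] show ?thesis
      by (simp add: V_def SD_def)
  qed
  have "indep_set SX SD"
    unfolding indep_sets2_eq
  proof (intro conjI ballI)
    note ind' = ind[unfolded V[symmetric] indep_sets2_eq]
    show "SX \<subseteq> events" "SD \<subseteq> events"
      using sub1 sub2 ind' by (meson order_trans)+
    fix a b assume "a \<in> SX" "b \<in> SD"
    then have "a \<in> sets (F s)" "b \<in> sets V"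
      using sub1 sub2 by (meson subsetD)+
    then show "prob (a \<inter> b) = prob a * prob b"
      using ind' by metis
  qed
  then show ?thesis
    unfolding indep_var_eq SX_def SD_def using XM gM by simp
qed

lemma incr_distributed:
  assumes "0 \<le> s" "s < t"
  shows "distributed M lborel (\<lambda>\<omega>. incr s t \<omega> $ j) (normal_density 0 (sqrt (t - s)))"
  using wiener_incr[OF assms, THEN conjunct2, THEN conjunct2] by (simp only: incr_def)

section \<open>Moments of products of increments\<close>

lemma incr_moments:
  assumes "0 \<le> s" "s < t"
  shows "integrable M (\<lambda>\<omega>. incr s t \<omega> $ j)" "integrable M (\<lambda>\<omega>. (incr s t \<omega> $ j)\<^sup>2)"
    "expectation (\<lambda>\<omega>. incr s t \<omega> $ j) = 0" "expectation (\<lambda>\<omega>. (incr s t \<omega> $ j)\<^sup>2) = t - s"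
proof -
  note D = incr_distributed[OF assms, of j]
  have \<sigma>: "0 < sqrt (t - s)" using assms by simp
  show "integrable M (\<lambda>\<omega>. incr s t \<omega> $ j)"
    using distributed_integrable[OF D, of "\<lambda>x. x"] integrable_normal_moment_nz_1[OF \<sigma>, of 0] by simp
  show "integrable M (\<lambda>\<omega>. (incr s t \<omega> $ j)\<^sup>2)"
    using distributed_integrable[OF D, of "\<lambda>x. x\<^sup>2"] integrable_normal_moment[OF \<sigma>, of 0 2] by simp
  show "expectation (\<lambda>\<omega>. incr s t \<omega> $ j) = 0"
    by (rule normal_distributed_expectation[OF \<sigma> D])
  show "expectation (\<lambda>\<omega>. (incr s t \<omega> $ j)\<^sup>2) = t - s"
    using normal_distributed_variance[OF \<sigma> D] normal_distributed_expectation[OF \<sigma> D] assms by simp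
qed

text \<open>Independence of the past factors the expectations. The case \<open>s = t\<close> is
  separate because \<open>wiener_process\<close> speaks of increments over nondegenerate
  intervals.\<close>

lemma incr_mult_past:
  assumes st: "0 \<le> s" "s \<le> t" and X: "X \<in> borel_measurable (F s)" "integrable M X"
  shows "integrable M (\<lambda>\<omega>. X \<omega> * incr s t \<omega> $ j)" "expectation (\<lambda>\<omega>. X \<omega> * incr s t \<omega> $ j) = 0"
    "integrable M (\<lambda>\<omega>. X \<omega> * (incr s t \<omega> $ j)\<^sup>2)"
    "expectation (\<lambda>\<omega>. X \<omega> * (incr s t \<omega> $ j)\<^sup>2) = expectation X * (t - s)"
proof -
  have comp: "(\<lambda>x :: real ^ 'p. x $ j) \<in> borel_measurable borel"
    by (intro borel_measurable_continuous_onI continuous_intros)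
  have i1: "indep_var borel X borel (\<lambda>\<omega>. incr s t \<omega> $ j)" if "s < t"
    by (rule indep_incr[OF st(1) that X(1) comp])
  have i2: "indep_var borel X borel (\<lambda>\<omega>. (incr s t \<omega> $ j)\<^sup>2)" if "s < t"
    by (rule indep_incr[OF st(1) that X(1)]) (use comp in measurable)
  note m = incr_moments[OF st(1), of t j]
  show "integrable M (\<lambda>\<omega>. X \<omega> * incr s t \<omega> $ j)" "expectation (\<lambda>\<omega>. X \<omega> * incr s t \<omega> $ j) = 0"
    using indep_var_integrable[OF i1 X(2) m(1)] indep_var_lebesgue_integral[OF i1 X(2) m(1)] m(3) st(2)
    by (cases "s = t"; simp)+
  show "integrable M (\<lambda>\<omega>. X \<omega> * (incr s t \<omega> $ j)\<^sup>2)"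
    "expectation (\<lambda>\<omega>. X \<omega> * (incr s t \<omega> $ j)\<^sup>2) = expectation X * (t - s)"
    using indep_var_integrable[OF i2 X(2) m(2)] indep_var_lebesgue_integral[OF i2 X(2) m(2)] m(4) st(2)
    by (cases "s = t"; simp)+
qed

text \<open>The longer increment is split at the end of the shorter one. This gives the square of
  the shorter one plus a product whose last factor is centred and independent of the rest.\<close>

lemma incr_mult_same_start:
  assumes st: "0 \<le> s" "s \<le> t" "s \<le> t'" and X: "X \<in> borel_measurable (F s)" "integrable M X"
  shows "integrable M (\<lambda>\<omega>. X \<omega> * (incr s t \<omega> $ j * incr s t' \<omega> $ j)) \<and>
    expectation (\<lambda>\<omega>. X \<omega> * (incr s t \<omega> $ j * incr s t' \<omega> $ j)) = expectation X * (min t t' - s)"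
proof -
  have *: "integrable M (\<lambda>\<omega>. X \<omega> * (incr s t \<omega> $ j * incr s t' \<omega> $ j)) \<and>
    expectation (\<lambda>\<omega>. X \<omega> * (incr s t \<omega> $ j * incr s t' \<omega> $ j)) = expectation X * (t - s)"
    if st: "0 \<le> s" "s \<le> t" "t \<le> t'" for t t'
  proof -
    have eq: "X \<omega> * (incr s t \<omega> $ j * incr s t' \<omega> $ j) =
        X \<omega> * (incr s t \<omega> $ j)\<^sup>2 + (X \<omega> * incr s t \<omega> $ j) * incr t t' \<omega> $ j" for \<omega>
      using incr_add[of s t' \<omega> t] by (simp add: algebra_simps power2_eq_square)
    note a = incr_mult_past[OF st(1,2) X, of j]
    have "(\<lambda>\<omega>. X \<omega> * incr s t \<omega> $ j) \<in> borel_measurable (F t)"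
      by (intro borel_measurable_times measurable_F_mono[OF X(1)] measurable_incr_component st)
    note b = incr_mult_past[OF order_trans[OF st(1,2)] st(3) this a(1), of j]
    show ?thesis
      unfolding eq using a b by simp
  qed
  show ?thesis
    using *[of t t'] *[of t' t] st by (cases "t \<le> t'") (auto simp: mult.commute)
qed

text \<open>By symmetry \<open>s \<le> s'\<close>. The first increment is cut at \<open>s'\<close>:
  the part before is orthogonal to the second increment, the part after starts at the same time as
  the second one. Arbitrary overlaps are covered, as the lists that encode simple processes allow
  them.\<close>

lemma incr_mult_incr:
  assumes s: "0 \<le> s" "s \<le> t" "0 \<le> s'" "s' \<le> t'"
    and X: "X \<in> borel_measurable (F s)" "bounded (X ` space M)"
    and Y: "Y \<in> borel_measurable (F s')" "bounded (Y ` space M)"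
  shows "integrable M (\<lambda>\<omega>. (X \<omega> * incr s t \<omega> $ j) * (Y \<omega> * incr s' t' \<omega> $ j)) \<and>
    expectation (\<lambda>\<omega>. (X \<omega> * incr s t \<omega> $ j) * (Y \<omega> * incr s' t' \<omega> $ j)) =
    expectation (\<lambda>\<omega>. X \<omega> * Y \<omega>) * measure lborel ({s<..t} \<inter> {s'<..t'})"
proof -
  have *: "integrable M (\<lambda>\<omega>. (X \<omega> * incr s t \<omega> $ j) * (Y \<omega> * incr s' t' \<omega> $ j)) \<and>
    expectation (\<lambda>\<omega>. (X \<omega> * incr s t \<omega> $ j) * (Y \<omega> * incr s' t' \<omega> $ j)) =
    expectation (\<lambda>\<omega>. X \<omega> * Y \<omega>) * measure lborel ({s<..t} \<inter> {s'<..t'})"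
    if s: "0 \<le> s" "s \<le> t" "s \<le> s'" "s' \<le> t'"
      and X: "X \<in> borel_measurable (F s)" "bounded (X ` space M)"
      and Y: "Y \<in> borel_measurable (F s')" "bounded (Y ` space M)" for s t s' t' X Y
  proof -
    have s': "0 \<le> s'" using s by simp
    obtain C where C: "\<And>\<omega>. \<omega> \<in> space M \<Longrightarrow> norm (X \<omega> * Y \<omega>) \<le> C"
      using bounded_mult_imageE[OF X(2) Y(2)] by blast
    have mX: "X \<in> borel_measurable (F s')"
      using X s by (intro measurable_F_mono[OF X(1)]) auto
    have mXY: "(\<lambda>\<omega>. X \<omega> * Y \<omega>) \<in> borel_measurable (F s')"
      using mX Y by measurable
    have bXY: "AE \<omega> in M. norm (X \<omega> * Y \<omega>) \<le> C"
      using C by (intro AE_I2)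
    have iXY: "integrable M (\<lambda>\<omega>. X \<omega> * Y \<omega>)"
      by (rule integrable_const_bound[OF bXY]) (rule measurable_F_M[OF mXY s'])
    define m where "m = min t s'"
    have m: "0 \<le> s" "s \<le> m" "m \<le> s'" unfolding m_def using s by simp_all
    \<comment> \<open>\<open>Y\<close> is known at time \<open>s'\<close> only and may depend on
      this increment, so integrability comes from the bound \<open>C\<close> on the product of the
      weights and not from independence.\<close>
    have "integrable M (\<lambda>\<omega>. (X \<omega> * Y \<omega>) * incr s m \<omega> $ j)"
    proof (rule Bochner_Integration.integrable_bound)
      show "integrable M (\<lambda>\<omega>. C * incr s m \<omega> $ j)"
        by (rule incr_mult_past(1)[OF m(1,2)]) auto
      show "(\<lambda>\<omega>. (X \<omega> * Y \<omega>) * incr s m \<omega> $ j) \<in> borel_measurable M"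
        by (intro borel_measurable_times measurable_F_M[OF mXY s'] measurable_F_M[OF measurable_incr_component])
          (use m in auto)
      show "AE \<omega> in M. norm ((X \<omega> * Y \<omega>) * incr s m \<omega> $ j) \<le> norm (C * incr s m \<omega> $ j)"
        using bXY
      proof eventually_elim
        case (elim \<omega>)
        then have "norm (X \<omega> * Y \<omega>) \<le> \<bar>C\<bar>" by simp
        from mult_right_mono[OF this abs_ge_zero[of "incr s m \<omega> $ j"]]
        show ?case by (simp only: real_norm_def abs_mult)
      qed
    qed
    moreover have "(\<lambda>\<omega>. (X \<omega> * Y \<omega>) * incr s m \<omega> $ j) \<in> borel_measurable (F s')"
      by (intro borel_measurable_times mXY measurable_F_mono[OF measurable_incr_component]) (use m in auto)
    ultimately have a: "integrable M (\<lambda>\<omega>. (X \<omega> * Y \<omega>) * incr s m \<omega> $ j * incr s' t' \<omega> $ j)"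
      "expectation (\<lambda>\<omega>. (X \<omega> * Y \<omega>) * incr s m \<omega> $ j * incr s' t' \<omega> $ j) = 0"
      using incr_mult_past(1,2)[OF s' s(4)] by auto
    show ?thesis
    proof (cases "t \<le> s'")
      case True
      then have [simp]: "m = t" and disj: "{s<..t} \<inter> {s'<..t'} = {}"
        by (auto simp: m_def)
      have eq: "(X \<omega> * incr s t \<omega> $ j) * (Y \<omega> * incr s' t' \<omega> $ j) =
          (X \<omega> * Y \<omega>) * incr s m \<omega> $ j * incr s' t' \<omega> $ j" for \<omega>
        by simp
      show ?thesis
        unfolding eq disj using a by simp
    next
      case False
      then have [simp]: "m = s'" by (simp add: m_def)
      have eq: "(X \<omega> * incr s t \<omega> $ j) * (Y \<omega> * incr s' t' \<omega> $ j) =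
          (X \<omega> * Y \<omega>) * incr s m \<omega> $ j * incr s' t' \<omega> $ j
          + (X \<omega> * Y \<omega>) * (incr s' t \<omega> $ j * incr s' t' \<omega> $ j)" for \<omega>
        using incr_add[of s t \<omega> s'] by (simp add: algebra_simps)
      have "{s<..t} \<inter> {s'<..t'} = {s'<..min t t'}"
        using s by auto
      then have "measure lborel ({s<..t} \<inter> {s'<..t'}) = min t t' - s'"
        using s False by simp
      then show ?thesis
        unfolding eq using a incr_mult_same_start[OF s' _ s(4) mXY iXY, of t j] False by simp
    qed
  qed
  show ?thesis
  proof (cases "s \<le> s'")
    case True
    then show ?thesis using *[OF s(1,2) _ s(4) X Y] by simp
  next
    case False
    then show ?thesis using *[OF s(3,4) _ s(2) Y X] by (simp add: mult.commute Int_commute)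
  qed
qed

abbreviation simple_int :: "'p \<Rightarrow> (real \<times> real \<times> ('w \<Rightarrow> real)) list \<Rightarrow> 'w \<Rightarrow> real" where
  "simple_int j \<equiv> simple_integral (\<lambda>u \<omega>. B u \<omega> $ j)"

text \<open>Both sides expand into the same double sum over pairs of list entries, in which
  \<open>L i k\<close> is the length of the overlap of two intervals. Working with pairs avoids a
  refinement to disjoint intervals.\<close>

theorem ito_isometry_simple:
  assumes H: "simple_process M F T H"
  shows "(\<integral>\<^sup>+\<omega>. ennreal ((simple_int j H \<omega>)\<^sup>2) \<partial>M) =
    (\<integral>\<^sup>+\<omega>. (\<integral>\<^sup>+u. ennreal ((simple_value H u \<omega>)\<^sup>2) \<partial>lborel) \<partial>M)"
proof -
  define I where "I = {..<length H}"
  define s where "s i = fst (H ! i)" for i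
  define t where "t i = fst (snd (H ! i))" for i
  define x where "x i = snd (snd (H ! i))" for i
  have H': "0 \<le> s i" "s i \<le> t i" "x i \<in> borel_measurable (F (s i))" "bounded (x i ` space M)" if "i \<in> I" for i
  proof -
    have "(s i, t i, x i) \<in> set H"
      using that by (simp add: I_def s_def t_def x_def)
    then show "0 \<le> s i" "s i \<le> t i" "x i \<in> borel_measurable (F (s i))" "bounded (x i ` space M)"
      using H unfolding simple_process_def by blast+
  qed
  have val: "simple_value H u \<omega> = (\<Sum>i\<in>I. x i \<omega> * indicator {s i<..t i} u)" for u \<omega>
    unfolding simple_value_def I_def s_def t_def x_def
    by (simp add: sum_list_sum_nth atLeast0LessThan case_prod_unfold)
  have integ: "simple_int j H \<omega> = (\<Sum>i\<in>I. x i \<omega> * incr (s i) (t i) \<omega> $ j)" for \<omega>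
    unfolding simple_integral_def I_def s_def t_def x_def incr_def
    by (simp add: sum_list_sum_nth atLeast0LessThan case_prod_unfold)
  have sq: "(\<Sum>i\<in>I. f i)\<^sup>2 = (\<Sum>i\<in>I. \<Sum>k\<in>I. f i * f k :: real)" for f
    by (simp add: power2_eq_square sum_product)
  define L where "L i k = measure lborel ({s i<..t i} \<inter> {s k<..t k})" for i k
  have pair: "integrable M (\<lambda>\<omega>. (x i \<omega> * incr (s i) (t i) \<omega> $ j) * (x k \<omega> * incr (s k) (t k) \<omega> $ j))"
    "expectation (\<lambda>\<omega>. (x i \<omega> * incr (s i) (t i) \<omega> $ j) * (x k \<omega> * incr (s k) (t k) \<omega> $ j))
      = expectation (\<lambda>\<omega>. x i \<omega> * x k \<omega>) * L i k" if "i \<in> I" "k \<in> I" for i k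
    using incr_mult_incr H'[OF that(1)] H'[OF that(2)] unfolding L_def by auto
  have int_xx: "integrable M (\<lambda>\<omega>. x i \<omega> * x k \<omega>)" if "i \<in> I" "k \<in> I" for i k
  proof -
    note bounds = H'(4)[OF that(1)] H'(4)[OF that(2)]
    obtain C where C: "\<And>\<omega>. \<omega> \<in> space M \<Longrightarrow> norm (x i \<omega> * x k \<omega>) \<le> C"
      using bounded_mult_imageE[OF bounds] by blast
    show ?thesis
      by (intro integrable_const_bound[of _ C] borel_measurable_times
          measurable_F_M[OF H'(3)] that H'(1) AE_I2 C)
  qed
  have int_L: "integrable lborel (\<lambda>u. (x i \<omega> * indicator {s i<..t i} u) * (x k \<omega> * indicator {s k<..t k} u))"
    "(LINT u|lborel. (x i \<omega> * indicator {s i<..t i} u) * (x k \<omega> * indicator {s k<..t k} u)) = x i \<omega> * x k \<omega> * L i k"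
    for i k \<omega>
  proof -
    have eq: "(x i \<omega> * indicator {s i<..t i} u) * (x k \<omega> * indicator {s k<..t k} u) =
        (x i \<omega> * x k \<omega>) * indicator ({s i<..t i} \<inter> {s k<..t k}) u" for u
      by (auto simp: indicator_def)
    have "emeasure lborel ({s i<..t i} \<inter> {s k<..t k}) \<le> emeasure lborel {s i..t i}"
      by (rule emeasure_mono) auto
    also have "\<dots> < \<infinity>"
      by (simp add: emeasure_lborel_Icc_eq)
    finally have "integrable lborel (indicator ({s i<..t i} \<inter> {s k<..t k}) :: real \<Rightarrow> real)"
      by (intro integrable_real_indicator) simp_all
    then show "integrable lborel (\<lambda>u. (x i \<omega> * indicator {s i<..t i} u) * (x k \<omega> * indicator {s k<..t k} u))"
      "(LINT u|lborel. (x i \<omega> * indicator {s i<..t i} u) * (x k \<omega> * indicator {s k<..t k} u)) = x i \<omega> * x k \<omega> * L i k"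
      unfolding eq L_def by simp_all
  qed
  have int_I: "integrable M (\<lambda>\<omega>. (simple_int j H \<omega>)\<^sup>2)"
    unfolding integ sq by (intro Bochner_Integration.integrable_sum pair)
  have int_V: "integrable lborel (\<lambda>u. (simple_value H u \<omega>)\<^sup>2)" for \<omega>
    unfolding val sq by (intro Bochner_Integration.integrable_sum int_L)
  have V: "(LINT u|lborel. (simple_value H u \<omega>)\<^sup>2) = (\<Sum>i\<in>I. \<Sum>k\<in>I. x i \<omega> * x k \<omega> * L i k)" for \<omega>
    unfolding val sq by (subst Bochner_Integration.integral_sum,
      intro Bochner_Integration.integrable_sum int_L, intro sum.cong refl,
      subst Bochner_Integration.integral_sum, rule int_L, intro sum.cong refl int_L)
  have int_xxL: "integrable M (\<lambda>\<omega>. x i \<omega> * x k \<omega> * L i k)" if "i \<in> I" "k \<in> I" for i k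
    by (intro integrable_mult_left int_xx that)
  have int_EV: "integrable M (\<lambda>\<omega>. LINT u|lborel. (simple_value H u \<omega>)\<^sup>2)"
    unfolding V by (intro Bochner_Integration.integrable_sum int_xxL)
  have "expectation (\<lambda>\<omega>. (simple_int j H \<omega>)\<^sup>2) =
      (\<Sum>i\<in>I. \<Sum>k\<in>I. expectation (\<lambda>\<omega>. x i \<omega> * x k \<omega>) * L i k)"
    unfolding integ sq by (subst Bochner_Integration.integral_sum,
      intro Bochner_Integration.integrable_sum pair, assumption, assumption, intro sum.cong refl,
      subst Bochner_Integration.integral_sum, rule pair, assumption, assumption, intro sum.cong refl pair)
  also have "\<dots> = expectation (\<lambda>\<omega>. LINT u|lborel. (simple_value H u \<omega>)\<^sup>2)"
    unfolding V by (simp add: Bochner_Integration.integral_sum Bochner_Integration.integrable_sum int_xxL int_xx)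
  finally have eq: "expectation (\<lambda>\<omega>. (simple_int j H \<omega>)\<^sup>2) =
      expectation (\<lambda>\<omega>. LINT u|lborel. (simple_value H u \<omega>)\<^sup>2)" .
  have "(\<integral>\<^sup>+\<omega>. ennreal ((simple_int j H \<omega>)\<^sup>2) \<partial>M)
      = ennreal (expectation (\<lambda>\<omega>. (simple_int j H \<omega>)\<^sup>2))"
    by (rule nn_integral_eq_integral[OF int_I]) simp
  also have "\<dots> = (\<integral>\<^sup>+\<omega>. ennreal (LINT u|lborel. (simple_value H u \<omega>)\<^sup>2) \<partial>M)"
    unfolding eq by (rule nn_integral_eq_integral[OF int_EV, symmetric]) simp
  also have "\<dots> = (\<integral>\<^sup>+\<omega>. (\<integral>\<^sup>+u. ennreal ((simple_value H u \<omega>)\<^sup>2) \<partial>lborel) \<partial>M)"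
    by (intro nn_integral_cong nn_integral_eq_integral[OF int_V, symmetric]) simp
  finally show ?thesis .
qed

text \<open>The components are independent centred normal variables with variance
  \<open>t - s\<close>, so the characteristic function is a product of one-dimensional ones, each
  reduced to the standard normal law.\<close>

lemma char_incr:
  assumes st: "0 \<le> s" "s \<le> t"
  shows "expectation (\<lambda>\<omega>. cis (c \<bullet> incr s t \<omega>)) = of_real (exp (- ((norm c)\<^sup>2 * (t - s)) / 2))"
proof (cases "s = t")
  case False
  then have st: "0 \<le> s" "s < t" using st by auto
  define \<sigma> where "\<sigma> = sqrt (t - s)"
  have \<sigma>: "0 < \<sigma>" "\<sigma>\<^sup>2 = t - s" using st by (auto simp: \<sigma>_def)
  have ind: "indep_vars (\<lambda>_. borel) (\<lambda>j \<omega>. incr s t \<omega> $ j) UNIV"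
    using wiener_incr[OF st, THEN conjunct2, THEN conjunct1] by (simp only: incr_def)
  have ind': "indep_vars (\<lambda>_. borel) (\<lambda>j \<omega>. cis (c $ j * incr s t \<omega> $ j)) UNIV"
    by (rule indep_vars_compose2[OF ind]) measurable
  have meas: "(\<lambda>\<omega>. cis (c $ j * incr s t \<omega> $ j)) \<in> borel_measurable M" for j
    using st by (intro borel_measurable_cis borel_measurable_times measurable_F_M[OF measurable_incr_component]) auto
  have int: "integrable M (\<lambda>\<omega>. cis (c $ j * incr s t \<omega> $ j))" for j
    by (rule integrable_const_bound[of _ 1]) (auto intro: meas)
  have one: "expectation (\<lambda>\<omega>. cis (a * incr s t \<omega> $ j)) = of_real (exp (- (a\<^sup>2 * (t - s)) / 2))" for a j
  proof -
    have D: "distributed M lborel (\<lambda>\<omega>. incr s t \<omega> $ j / \<sigma>) std_normal_density"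
      using incr_distributed[OF st, of j] normal_standard_normal_convert[OF \<sigma>(1), of "\<lambda>\<omega>. incr s t \<omega> $ j" 0]
      by (simp add: \<sigma>_def)
    have "expectation (\<lambda>\<omega>. cis (a * incr s t \<omega> $ j)) = expectation (\<lambda>\<omega>. iexp (a * \<sigma> * (incr s t \<omega> $ j / \<sigma>)))"
      using \<sigma> by (intro Bochner_Integration.integral_cong) (auto simp: cis_conv_exp)
    also have "\<dots> = char (distr M lborel (\<lambda>\<omega>. incr s t \<omega> $ j / \<sigma>)) (a * \<sigma>)"
      unfolding char_def using distributed_measurable[OF D] by (subst integral_distr) auto
    also have "distr M lborel (\<lambda>\<omega>. incr s t \<omega> $ j / \<sigma>) = std_normal_distribution"
      using distributed_distr_eq_density[OF D] by simp
    also have "char std_normal_distribution (a * \<sigma>) = of_real (exp (- (a\<^sup>2 * (t - s)) / 2))"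
      using \<sigma> by (simp add: char_std_normal_distribution power_mult_distrib)
    finally show ?thesis .
  qed
  have "expectation (\<lambda>\<omega>. cis (c \<bullet> incr s t \<omega>)) = expectation (\<lambda>\<omega>. \<Prod>j\<in>UNIV. cis (c $ j * incr s t \<omega> $ j))"
    by (simp add: inner_vec_def cis_conv_exp exp_sum[symmetric] sum_distrib_left)
  also have "\<dots> = (\<Prod>j\<in>UNIV. of_real (exp (- ((c $ j)\<^sup>2 * (t - s)) / 2)))"
    using indep_vars_lebesgue_integral[OF finite ind' int] one by simp
  also have "\<dots> = of_real (exp (\<Sum>j\<in>UNIV. - ((c $ j)\<^sup>2 * (t - s)) / 2))"
    by (simp add: exp_sum)
  also have "(\<Sum>j\<in>UNIV. - ((c $ j)\<^sup>2 * (t - s)) / 2) = - ((norm c)\<^sup>2 * (t - s)) / 2"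
  proof -
    have "(norm c)\<^sup>2 = (\<Sum>j\<in>UNIV. (c $ j)\<^sup>2)"
      by (simp only: power2_norm_eq_inner) (simp add: inner_vec_def power2_eq_square)
    then show ?thesis
      by (simp add: sum_distrib_right sum_divide_distrib sum_negf)
  qed
  finally show ?thesis .
qed (simp add: prob_space)

lemma char_add_incr:
  assumes st: "0 \<le> s" "s \<le> t" and X: "X \<in> borel_measurable (F s)"
  shows "expectation (\<lambda>\<omega>. cis (X \<omega> + c \<bullet> incr s t \<omega>)) =
    expectation (\<lambda>\<omega>. cis (X \<omega>)) * of_real (exp (- ((norm c)\<^sup>2 * (t - s)) / 2))"
proof (cases "s = t")
  case False
  then have st': "0 \<le> s" "s < t" using st by auto
  have mX: "(\<lambda>\<omega>. cis (X \<omega>)) \<in> borel_measurable (F s)"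
    using X by measurable
  have g: "(\<lambda>x. cis (c \<bullet> x)) \<in> borel_measurable borel"
    by measurable
  have mD: "(\<lambda>\<omega>. cis (c \<bullet> incr s t \<omega>)) \<in> borel_measurable M"
    using measurable_F_M[OF measurable_incr[OF st] order_trans[OF st]] by measurable
  have "expectation (\<lambda>\<omega>. cis (X \<omega>) * cis (c \<bullet> incr s t \<omega>)) =
      expectation (\<lambda>\<omega>. cis (X \<omega>)) * expectation (\<lambda>\<omega>. cis (c \<bullet> incr s t \<omega>))"
    by (intro indep_var_lebesgue_integral indep_incr[OF st' mX g] integrable_const_bound[of _ 1] mD
        measurable_F_M[OF mX st(1)]) auto
  then show ?thesis
    by (simp add: cis_mult char_incr[OF st])
qed simp

end

section \<open>The Wiener integral\<close>

text \<open>Young's inequality, from the square of \<open>\<delta> * norm x - norm y\<close>. The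
  choice \<open>\<delta> = 1\<close> gives the usual factors 2; small \<open>\<delta>\<close> keeps
  the first factor close to 1, on which the convergence of variances rests.\<close>

lemma norm_add_power2_le:
  fixes x y :: "'a::real_normed_vector"
  assumes "0 < \<delta>"
  shows "(norm (x + y))\<^sup>2 \<le> (1 + \<delta>) * (norm x)\<^sup>2 + (1 + 1 / \<delta>) * (norm y)\<^sup>2"
proof -
  have "(norm (x + y))\<^sup>2 \<le> (norm x + norm y)\<^sup>2"
    by (intro power_mono norm_triangle_ineq) auto
  moreover have "0 \<le> (\<delta> * norm x - norm y)\<^sup>2 / \<delta>"
    using assms by simp
  then have "2 * norm x * norm y \<le> \<delta> * (norm x)\<^sup>2 + (norm y)\<^sup>2 / \<delta>"
    using assms by (simp add: power2_eq_square field_simps)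
  ultimately show ?thesis
    by (simp add: power2_sum algebra_simps)
qed

lemma nn_integral_power2_add_le:
  fixes X Y :: "'a \<Rightarrow> real"
  assumes [measurable]: "X \<in> borel_measurable N" "Y \<in> borel_measurable N"
  shows "(\<integral>\<^sup>+x. ennreal ((X x + Y x)\<^sup>2) \<partial>N) \<le> 2 * (\<integral>\<^sup>+x. ennreal ((X x)\<^sup>2) \<partial>N) + 2 * (\<integral>\<^sup>+x. ennreal ((Y x)\<^sup>2) \<partial>N)"
proof -
  have "(\<integral>\<^sup>+x. ennreal ((X x + Y x)\<^sup>2) \<partial>N) \<le> (\<integral>\<^sup>+x. 2 * ennreal ((X x)\<^sup>2) + 2 * ennreal ((Y x)\<^sup>2) \<partial>N)"
  proof (intro nn_integral_mono)
    fix x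
    have "ennreal ((X x + Y x)\<^sup>2) \<le> ennreal (2 * (X x)\<^sup>2 + 2 * (Y x)\<^sup>2)"
      using norm_add_power2_le[of 1 "X x" "Y x"] by (intro ennreal_leI) simp
    then show "ennreal ((X x + Y x)\<^sup>2) \<le> 2 * ennreal ((X x)\<^sup>2) + 2 * ennreal ((Y x)\<^sup>2)"
      by (simp add: ennreal_mult)
  qed
  also have "\<dots> = 2 * (\<integral>\<^sup>+x. ennreal ((X x)\<^sup>2) \<partial>N) + 2 * (\<integral>\<^sup>+x. ennreal ((Y x)\<^sup>2) \<partial>N)"
    by (simp add: nn_integral_add nn_integral_cmult)
  finally show ?thesis .
qed

text \<open>Combines the Lipschitz bound with the trivial bound 2, so that the truncated distance
  underlying \<open>l0\<close> controls characteristic functions.\<close>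

lemma norm_cis_diff_le: "norm (cis x - cis y) \<le> 2 * min 1 \<bar>x - y\<bar>"
proof -
  have "cis x - cis y = cis y * (cis (x - y) - 1)"
    by (simp add: right_diff_distrib cis_mult)
  then have "norm (cis x - cis y) = norm (cis (x - y) - 1)"
    by (simp add: norm_mult)
  also have "\<dots> \<le> \<bar>x - y\<bar>"
    using iexp_approx1[of "x - y" 0] by (simp add: cis_conv_exp)
  finally have "norm (cis x - cis y) \<le> \<bar>x - y\<bar>" .
  moreover have "norm (cis x - cis y) \<le> 2"
    using norm_triangle_ineq4[of "cis x" "cis y"] by simp
  ultimately show ?thesis
    using abs_ge_zero[of "x - y"] by (cases "\<bar>x - y\<bar> \<le> 1") (simp_all add: min_def del: abs_ge_zero)
qed

text \<open>Cutting off a continuous function can create jumps at \<open>a\<close> and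
  \<open>b\<close> only, a null set. Boundedness and continuity almost everywhere are what Riemann
  sums need.\<close>

lemma truncated_continuous:
  fixes f :: "real \<Rightarrow> 'v::euclidean_space"
  assumes f: "continuous_on {a..b} f"
  shows "(\<lambda>u. indicator {a..b} u *\<^sub>R f u) \<in> borel_measurable borel"
    and "\<exists>C\<ge>0. \<forall>u. norm (indicator {a..b} u *\<^sub>R f u) \<le> C"
    and "AE u in lborel. isCont (\<lambda>u. indicator {a..b} u *\<^sub>R f u) u"
proof -
  show "(\<lambda>u. indicator {a..b} u *\<^sub>R f u) \<in> borel_measurable borel"
    by (rule borel_measurable_continuous_on_indicator[OF _ f]) simp
  have "compact (f ` {a..b})"
    by (rule compact_continuous_image[OF f]) simp
  then obtain C where "\<And>x. x \<in> f ` {a..b} \<Longrightarrow> norm x \<le> C"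
    using compact_imp_bounded bounded_iff by metis
  then have "norm (indicator {a..b} u *\<^sub>R f u) \<le> max 0 C" for u
    by (auto simp: indicator_def le_max_iff_disj)
  then show "\<exists>C\<ge>0. \<forall>u. norm (indicator {a..b} u *\<^sub>R f u) \<le> C"
    by (intro exI[of _ "max 0 C"]) auto
  have "AE u in lborel. u \<noteq> a" "AE u in lborel. u \<noteq> b"
    by (rule AE_lborel_singleton)+
  then show "AE u in lborel. isCont (\<lambda>u. indicator {a..b} u *\<^sub>R f u) u"
  proof eventually_elim
    case (elim u)
    show ?case
    proof (cases "u \<in> {a<..<b}")
      case True
      have "continuous_on {a<..<b} f"
        by (rule continuous_on_subset[OF f]) auto
      then have "continuous_on {a<..<b} (\<lambda>u. indicator {a..b} u *\<^sub>R f u)"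
        by (rule continuous_on_eq) auto
      then show ?thesis
        using True by (simp add: continuous_on_eq_continuous_at)
    next
      case False
      have "continuous_on (- {a..b}) (\<lambda>u. indicator {a..b} u *\<^sub>R f u)"
        by (rule continuous_on_eq[of _ "\<lambda>_. 0"]) auto
      moreover have "u \<in> - {a..b}"
        using False elim by (simp add: not_le) linarith
      moreover have "open (- {a..b})"
        by (rule open_Compl) (rule closed_atLeastAtMost)
      ultimately show ?thesis
        using continuous_on_eq_continuous_at by blast
    qed
  qed
qed

lemma has_integral_indicator:
  fixes f :: "real \<Rightarrow> real"
  assumes "(f has_integral i) {0..s}" "s \<le> T"
  shows "((\<lambda>u. indicator {0..s} u * f u) has_integral i) {0..T}"
proof -
  have "indicator {0..s} u * f u = (if u \<in> {0..s} then f u else 0)" for u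
    by simp
  moreover have "{0..s} \<inter> {0..T} = {0..s}" using assms(2) by auto
  ultimately show ?thesis
    using assms(1) by (simp only: has_integral_restrict_Int)
qed

locale wiener_horizon = wiener_space M F B
  for M :: "'w measure" and F and B :: "real \<Rightarrow> 'w \<Rightarrow> real ^ 'p" +
  fixes T :: real
  assumes T_pos: "0 < T"
begin

definition l2sq :: "(real \<Rightarrow> real ^ 'p) \<Rightarrow> ennreal" where
  "l2sq g = (\<integral>\<^sup>+u\<in>{0..T}. ennreal ((norm (g u))\<^sup>2) \<partial>lborel)"

definition l0 :: "('w \<Rightarrow> real) \<Rightarrow> ennreal" where
  "l0 X = (\<integral>\<^sup>+\<omega>. ennreal (min 1 \<bar>X \<omega>\<bar>) \<partial>M)"

text \<open>Partitions are used with \<open>Suc n\<close> cells: for \<open>n = 0\<close> the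
  division by zero would place every node at 0.\<close>

definition node :: "nat \<Rightarrow> nat \<Rightarrow> real" where
  "node n k = real k * T / real n"

abbreviation cell :: "nat \<Rightarrow> nat \<Rightarrow> real set" where
  "cell n k \<equiv> {node n k<..node n (Suc k)}"

definition step :: "nat \<Rightarrow> (nat \<Rightarrow> 'v::real_vector) \<Rightarrow> real \<Rightarrow> 'v" where
  "step n c u = (\<Sum>k<n. indicator (cell n k) u *\<^sub>R c k)"

definition step_integral :: "nat \<Rightarrow> (nat \<Rightarrow> real ^ 'p) \<Rightarrow> 'w \<Rightarrow> real" where
  "step_integral n c \<omega> = (\<Sum>k<n. c k \<bullet> incr (node n k) (node n (Suc k)) \<omega>)"

text \<open>One and the same coefficient family \<open>c\<close> approximates the integrand in mean
  square and the random variable in probability; this coupling is what ties \<open>X\<close> to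
  \<open>g\<close>.\<close>

definition step_approx :: "nat \<Rightarrow> real \<Rightarrow> (real \<Rightarrow> real ^ 'p) \<Rightarrow> ('w \<Rightarrow> real) \<Rightarrow> bool" where
  "step_approx n \<epsilon> g X \<longleftrightarrow> (\<exists>c. l2sq (\<lambda>u. g u - step (Suc n) c u) < ennreal \<epsilon> \<and>
     l0 (\<lambda>\<omega>. X \<omega> - step_integral (Suc n) c \<omega>) < ennreal \<epsilon>)"

text \<open>The approximating step functions all live on the uniform partitions, so that approximations of
  several integrands can be added. Convergence of the integrals is only required in probability, which
  \<open>l0\<close> metrizes.\<close>

definition wiener_integral :: "(real \<Rightarrow> real ^ 'p) \<Rightarrow> ('w \<Rightarrow> real) \<Rightarrow> bool" where
  "wiener_integral g X \<longleftrightarrow> g \<in> borel_measurable borel \<and> X \<in> borel_measurable M \<and>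
     (\<forall>\<epsilon>>0. \<forall>\<^sub>F n in sequentially. step_approx n \<epsilon> g X)"

lemma node_nonneg: "0 \<le> node n k"
  using T_pos by (simp add: node_def)

lemma node_mono: "k \<le> l \<Longrightarrow> node n k \<le> node n l"
  using T_pos by (simp add: node_def divide_right_mono mult_right_mono)

lemma node_le_T: "k \<le> Suc n \<Longrightarrow> node (Suc n) k \<le> T"
  using node_mono[of k "Suc n" "Suc n"] by (simp add: node_def)

lemma node_diff: "node n (Suc k) - node n k = T / real n"
  by (simp add: node_def distrib_right add_divide_distrib)

lemma borel_measurable_step [measurable]:
  fixes c :: "nat \<Rightarrow> 'v::{real_normed_vector, second_countable_topology}"
  shows "step n c \<in> borel_measurable borel"
  unfolding step_def[abs_def] by measurable

lemma borel_measurable_step_integral [measurable]: "step_integral n c \<in> borel_measurable M"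
  unfolding step_integral_def[abs_def]
  by (intro borel_measurable_sum borel_measurable_inner borel_measurable_const
      measurable_F_M[OF measurable_incr] node_nonneg node_mono) auto

section \<open>The squared mean-square norm and the distance of convergence in probability\<close>

lemma l2sq_add:
  assumes [measurable]: "f \<in> borel_measurable borel" "g \<in> borel_measurable borel" and \<delta>: "0 < \<delta>"
  shows "l2sq (\<lambda>u. f u + g u) \<le> ennreal (1 + \<delta>) * l2sq f + ennreal (1 + 1 / \<delta>) * l2sq g"
proof -
  have "l2sq (\<lambda>u. f u + g u) \<le> (\<integral>\<^sup>+u. ennreal (1 + \<delta>) * (ennreal ((norm (f u))\<^sup>2) * indicator {0..T} u)
      + ennreal (1 + 1 / \<delta>) * (ennreal ((norm (g u))\<^sup>2) * indicator {0..T} u) \<partial>lborel)"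
    unfolding l2sq_def
  proof (intro nn_integral_mono)
    fix u
    have "ennreal ((norm (f u + g u))\<^sup>2) \<le> ennreal ((1 + \<delta>) * (norm (f u))\<^sup>2 + (1 + 1 / \<delta>) * (norm (g u))\<^sup>2)"
      by (intro ennreal_leI norm_add_power2_le \<delta>)
    also have "\<dots> = ennreal (1 + \<delta>) * ennreal ((norm (f u))\<^sup>2) + ennreal (1 + 1 / \<delta>) * ennreal ((norm (g u))\<^sup>2)"
      using \<delta> by (simp add: ennreal_mult ennreal_plus)
    finally show "ennreal ((norm (f u + g u))\<^sup>2) * indicator {0..T} u \<le> ennreal (1 + \<delta>) * (ennreal ((norm (f u))\<^sup>2) * indicator {0..T} u)
      + ennreal (1 + 1 / \<delta>) * (ennreal ((norm (g u))\<^sup>2) * indicator {0..T} u)"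
      by (simp add: indicator_def)
  qed
  also have "\<dots> = ennreal (1 + \<delta>) * l2sq f + ennreal (1 + 1 / \<delta>) * l2sq g"
    unfolding l2sq_def by (simp add: nn_integral_add nn_integral_cmult)
  finally show ?thesis .
qed

lemma l2sq_add_less:
  assumes "f \<in> borel_measurable borel" "g \<in> borel_measurable borel"
    and "l2sq f < ennreal (\<epsilon> / 4)" "l2sq g < ennreal (\<epsilon> / 4)" "0 < \<epsilon>"
  shows "l2sq (\<lambda>u. f u + g u) < ennreal \<epsilon>"
proof -
  have "l2sq (\<lambda>u. f u + g u) \<le> 2 * l2sq f + 2 * l2sq g"
    using l2sq_add[OF assms(1,2), of 1] by simp
  also have "\<dots> < 2 * ennreal (\<epsilon> / 4) + 2 * ennreal (\<epsilon> / 4)"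
    using assms(3,4) by (intro add_strict_mono ennreal_mult_strict_left_mono) auto
  also have "\<dots> = ennreal 2 * ennreal (\<epsilon> / 4) + ennreal 2 * ennreal (\<epsilon> / 4)"
    by simp
  also have "\<dots> = ennreal \<epsilon>"
    using assms(5) by (simp del: ennreal_numeral add: ennreal_mult[symmetric] ennreal_plus[symmetric])
  finally show ?thesis .
qed

lemma l2sq_scaleR: "f \<in> borel_measurable borel \<Longrightarrow> l2sq (\<lambda>u. a *\<^sub>R f u) = ennreal (a\<^sup>2) * l2sq f"
  unfolding l2sq_def by (simp add: power_mult_distrib ennreal_mult mult.assoc nn_integral_cmult)

lemma l0_add:
  assumes [measurable]: "X \<in> borel_measurable M" "Y \<in> borel_measurable M"
  shows "l0 (\<lambda>\<omega>. X \<omega> + Y \<omega>) \<le> l0 X + l0 Y"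
proof -
  have "l0 (\<lambda>\<omega>. X \<omega> + Y \<omega>) \<le> (\<integral>\<^sup>+\<omega>. ennreal (min 1 \<bar>X \<omega>\<bar>) + ennreal (min 1 \<bar>Y \<omega>\<bar>) \<partial>M)"
    unfolding l0_def by (intro nn_integral_mono) (auto simp flip: ennreal_plus intro!: ennreal_leI)
  also have "\<dots> = l0 X + l0 Y"
    unfolding l0_def by (intro nn_integral_add) auto
  finally show ?thesis .
qed

lemma l0_add_less:
  assumes "X \<in> borel_measurable M" "Y \<in> borel_measurable M"
    and "l0 X < ennreal (\<epsilon> / 2)" "l0 Y < ennreal (\<epsilon> / 2)" "0 < \<epsilon>"
  shows "l0 (\<lambda>\<omega>. X \<omega> + Y \<omega>) < ennreal \<epsilon>"
proof -
  have "l0 (\<lambda>\<omega>. X \<omega> + Y \<omega>) \<le> l0 X + l0 Y"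
    by (rule l0_add[OF assms(1,2)])
  also have "\<dots> < ennreal (\<epsilon> / 2) + ennreal (\<epsilon> / 2)"
    using assms(3,4) by (rule add_strict_mono)
  also have "\<dots> = ennreal \<epsilon>"
    using assms(5) by (simp add: ennreal_plus[symmetric])
  finally show ?thesis .
qed

lemma l0_scale:
  assumes [measurable]: "X \<in> borel_measurable M"
  shows "l0 (\<lambda>\<omega>. a * X \<omega>) \<le> ennreal (max 1 \<bar>a\<bar>) * l0 X"
proof -
  have "min 1 \<bar>a * x\<bar> \<le> max 1 \<bar>a\<bar> * min 1 \<bar>x\<bar>" for x
  proof (cases "\<bar>x\<bar> \<le> 1")
    case True
    then show ?thesis by (auto simp: abs_mult intro!: min.coboundedI2 mult_right_mono)
  next
    case False
    then show ?thesis by auto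
  qed
  then have "l0 (\<lambda>\<omega>. a * X \<omega>) \<le> (\<integral>\<^sup>+\<omega>. ennreal (max 1 \<bar>a\<bar>) * ennreal (min 1 \<bar>X \<omega>\<bar>) \<partial>M)"
    unfolding l0_def by (intro nn_integral_mono) (auto simp flip: ennreal_mult intro!: ennreal_leI)
  also have "\<dots> = ennreal (max 1 \<bar>a\<bar>) * l0 X"
    unfolding l0_def by (intro nn_integral_cmult) auto
  finally show ?thesis .
qed

text \<open>Markov's inequality in the form \<open>min 1 |x| \<le> \<epsilon> + x\<^sup>2 / \<epsilon>\<close>.\<close>

lemma l0_le_second_moment:
  assumes [measurable]: "X \<in> borel_measurable M" and "0 < \<epsilon>"
    and X: "(\<integral>\<^sup>+\<omega>. ennreal ((X \<omega>)\<^sup>2) \<partial>M) < ennreal (\<epsilon>\<^sup>2 / 4)"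
  shows "l0 X < ennreal \<epsilon>"
proof -
  \<comment> \<open>With \<open>\<epsilon> / 2\<close> as the threshold, the assumed second moment
    below \<open>\<epsilon>\<^sup>2 / 4\<close> contributes less than the other half of
    \<open>\<epsilon>\<close>.\<close>
  have "min 1 \<bar>x\<bar> \<le> \<epsilon> / 2 + (2 / \<epsilon>) * x\<^sup>2" for x
  proof (cases "\<bar>x\<bar> \<le> \<epsilon> / 2")
    case True
    have "0 \<le> (2 / \<epsilon>) * x\<^sup>2" using \<open>0 < \<epsilon>\<close> by simp
    then show ?thesis using True by linarith
  next
    case False
    then have "\<bar>x\<bar> * (\<epsilon> / 2) \<le> \<bar>x\<bar> * \<bar>x\<bar>"
      by (intro mult_left_mono) auto
    then have "\<bar>x\<bar> \<le> (2 / \<epsilon>) * x\<^sup>2"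
      using \<open>0 < \<epsilon>\<close> by (simp add: field_simps power2_eq_square)
    then show ?thesis using \<open>0 < \<epsilon>\<close> by linarith
  qed
  then have "l0 X \<le> (\<integral>\<^sup>+\<omega>. ennreal (\<epsilon> / 2) + ennreal (2 / \<epsilon>) * ennreal ((X \<omega>)\<^sup>2) \<partial>M)"
    unfolding l0_def using \<open>0 < \<epsilon>\<close>
    by (intro nn_integral_mono) (auto simp flip: ennreal_mult ennreal_plus intro!: ennreal_leI)
  also have "\<dots> = ennreal (\<epsilon> / 2) + ennreal (2 / \<epsilon>) * (\<integral>\<^sup>+\<omega>. ennreal ((X \<omega>)\<^sup>2) \<partial>M)"
    by (simp add: nn_integral_add nn_integral_cmult emeasure_space_1)
  also have "\<dots> < ennreal (\<epsilon> / 2) + ennreal (2 / \<epsilon>) * ennreal (\<epsilon>\<^sup>2 / 4)"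
    using X \<open>0 < \<epsilon>\<close> by (intro ennreal_add_left_cancel_less[THEN iffD2] conjI ennreal_mult_strict_left_mono) auto
  also have "\<dots> = ennreal \<epsilon>"
    using \<open>0 < \<epsilon>\<close> by (simp add: ennreal_mult[symmetric] ennreal_plus[symmetric] power2_eq_square)
  finally show ?thesis .
qed

text \<open>The truncation at 1 is a dominating constant, so almost sure convergence is enough and
  no moments have to be controlled.\<close>

lemma l0_tendsto_zero:
  assumes [measurable]: "\<And>n. X n \<in> borel_measurable M" "Y \<in> borel_measurable M"
    and lim: "AE \<omega> in M. (\<lambda>n. X n \<omega>) \<longlonglongrightarrow> Y \<omega>"
  shows "(\<lambda>n. l0 (\<lambda>\<omega>. Y \<omega> - X n \<omega>)) \<longlonglongrightarrow> 0"
proof -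
  have "(\<lambda>n. \<integral>\<^sup>+\<omega>. ennreal (min 1 \<bar>Y \<omega> - X n \<omega>\<bar>) \<partial>M) \<longlonglongrightarrow> (\<integral>\<^sup>+\<omega>. 0 \<partial>M)"
  proof (rule nn_integral_dominated_convergence[where w = "\<lambda>_. 1"])
    show "AE \<omega> in M. (\<lambda>n. ennreal (min 1 \<bar>Y \<omega> - X n \<omega>\<bar>)) \<longlonglongrightarrow> 0"
      using lim
    proof eventually_elim
      case (elim \<omega>)
      have "(\<lambda>n. ennreal (min 1 \<bar>Y \<omega> - X n \<omega>\<bar>)) \<longlonglongrightarrow> ennreal (min 1 \<bar>Y \<omega> - Y \<omega>\<bar>)"
        by (intro tendsto_intros tendsto_ennrealI elim)
      then show ?case by simp
    qed
  qed (auto simp: emeasure_space_1)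
  then show ?thesis by (simp add: l0_def)
qed

section \<open>Linearity and limits of the Wiener integral\<close>

lemma step_add: "step n (\<lambda>k. c k + d k) u = step n c u + step n d u"
  by (simp add: step_def scaleR_add_right sum.distrib)

lemma step_scaleR: "step n (\<lambda>k. a *\<^sub>R c k) u = a *\<^sub>R step n c u"
  by (simp only: step_def scaleR_sum_right scaleR_left_commute)

lemma step_integral_add: "step_integral n (\<lambda>k. c k + d k) \<omega> = step_integral n c \<omega> + step_integral n d \<omega>"
  by (simp add: step_integral_def inner_add_left sum.distrib)

lemma step_integral_scaleR: "step_integral n (\<lambda>k. a *\<^sub>R c k) \<omega> = a * step_integral n c \<omega>"
  by (simp add: step_integral_def sum_distrib_left)

lemma wiener_integralD:
  assumes "wiener_integral g X"
  shows "g \<in> borel_measurable borel" "X \<in> borel_measurable M"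
  using assms unfolding wiener_integral_def by auto

lemma wiener_integral_approx:
  "wiener_integral g X \<Longrightarrow> 0 < \<epsilon> \<Longrightarrow> \<forall>\<^sub>F n in sequentially. step_approx n \<epsilon> g X"
  unfolding wiener_integral_def by blast

text \<open>Common core of sums and limits: the pair of \<open>h\<close> and \<open>Y\<close> is a
  small remainder, either what is left after approximating a second summand or the distance to a
  limit.\<close>

lemma step_approx_add_less:
  assumes X: "step_approx n (\<epsilon> / 4) g X" and c: "l2sq h < ennreal (\<epsilon> / 4)" "l0 Y < ennreal (\<epsilon> / 4)" and \<epsilon>: "0 < \<epsilon>"
    and [measurable]: "g \<in> borel_measurable borel" "h \<in> borel_measurable borel"
      "X \<in> borel_measurable M" "Y \<in> borel_measurable M"
  obtains d where "l2sq (\<lambda>u. g u + h u - step (Suc n) d u) < ennreal \<epsilon>"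
    "l0 (\<lambda>\<omega>. X \<omega> + Y \<omega> - step_integral (Suc n) d \<omega>) < ennreal \<epsilon>"
proof -
  obtain d where d: "l2sq (\<lambda>u. g u - step (Suc n) d u) < ennreal (\<epsilon> / 4)"
      "l0 (\<lambda>\<omega>. X \<omega> - step_integral (Suc n) d \<omega>) < ennreal (\<epsilon> / 4)"
    using X unfolding step_approx_def by blast
  have le: "ennreal (\<epsilon> / 4) \<le> ennreal (\<epsilon> / 2)" using \<epsilon> by (intro ennreal_leI) simp
  have "l2sq (\<lambda>u. (g u - step (Suc n) d u) + h u) < ennreal \<epsilon>"
    by (rule l2sq_add_less[OF _ _ d(1) c(1) \<epsilon>]) measurable
  moreover have "l0 (\<lambda>\<omega>. (X \<omega> - step_integral (Suc n) d \<omega>) + Y \<omega>) < ennreal \<epsilon>"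
    by (rule l0_add_less[OF _ _ less_le_trans[OF d(2) le] less_le_trans[OF c(2) le] \<epsilon>]) measurable
  ultimately show ?thesis
    by (intro that[of d]) (simp_all add: algebra_simps)
qed

lemma wiener_integral_add:
  assumes g: "wiener_integral g X" and h: "wiener_integral h Y"
  shows "wiener_integral (\<lambda>u. g u + h u) (\<lambda>\<omega>. X \<omega> + Y \<omega>)"
  unfolding wiener_integral_def
proof (intro conjI allI impI)
  note [measurable] = wiener_integralD[OF g] wiener_integralD[OF h]
  show "(\<lambda>u. g u + h u) \<in> borel_measurable borel" "(\<lambda>\<omega>. X \<omega> + Y \<omega>) \<in> borel_measurable M"
    by measurable
  fix \<epsilon> :: real assume \<epsilon>: "0 < \<epsilon>"
  then have \<epsilon>': "0 < \<epsilon> / 4" by simp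
  show "\<forall>\<^sub>F n in sequentially. step_approx n \<epsilon> (\<lambda>u. g u + h u) (\<lambda>\<omega>. X \<omega> + Y \<omega>)"
    using wiener_integral_approx[OF g \<epsilon>'] wiener_integral_approx[OF h \<epsilon>']
  proof eventually_elim
    case (elim n)
    obtain c where c: "l2sq (\<lambda>u. h u - step (Suc n) c u) < ennreal (\<epsilon> / 4)"
        "l0 (\<lambda>\<omega>. Y \<omega> - step_integral (Suc n) c \<omega>) < ennreal (\<epsilon> / 4)"
      using elim(2) unfolding step_approx_def by blast
    obtain d where "l2sq (\<lambda>u. g u + (h u - step (Suc n) c u) - step (Suc n) d u) < ennreal \<epsilon>"
      "l0 (\<lambda>\<omega>. X \<omega> + (Y \<omega> - step_integral (Suc n) c \<omega>) - step_integral (Suc n) d \<omega>) < ennreal \<epsilon>"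
      by (rule step_approx_add_less[OF elim(1) c \<epsilon>]) measurable
    then show ?case
      unfolding step_approx_def
      by (intro exI[of _ "\<lambda>k. c k + d k"]) (simp add: step_add step_integral_add algebra_simps)
  qed
qed

lemma wiener_integral_scaleR:
  assumes g: "wiener_integral g X"
  shows "wiener_integral (\<lambda>u. a *\<^sub>R g u) (\<lambda>\<omega>. a * X \<omega>)"
  unfolding wiener_integral_def
proof (intro conjI allI impI)
  note [measurable] = wiener_integralD[OF g]
  show "(\<lambda>u. a *\<^sub>R g u) \<in> borel_measurable borel" "(\<lambda>\<omega>. a * X \<omega>) \<in> borel_measurable M"
    by measurable
  fix \<epsilon> :: real assume \<epsilon>: "0 < \<epsilon>"
  \<comment> \<open>Scaling costs the factor \<open>a\<^sup>2\<close> in \<open>l2sq\<close> and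
    \<open>b\<close> in \<open>l0\<close>. Both are at most \<open>b\<^sup>2\<close>, so the
    tolerance \<open>\<epsilon> / b\<^sup>2\<close> serves for both.\<close>
  define b where "b = max 1 \<bar>a\<bar>"
  have b: "1 \<le> b" "\<bar>a\<bar> \<le> b" by (auto simp: b_def)
  have a2: "a\<^sup>2 \<le> b\<^sup>2" using b abs_le_square_iff[of a b] by simp
  have b2: "b \<le> b\<^sup>2" using b by (simp add: power2_eq_square)
  have \<epsilon>': "0 < \<epsilon> / b\<^sup>2" using b \<epsilon> by simp
  have scaled: "ennreal x * e < ennreal \<epsilon>" if "e < ennreal (\<epsilon> / b\<^sup>2)" "x \<le> b\<^sup>2" for x e
  proof -
    have "ennreal x * e \<le> ennreal (b\<^sup>2) * e"
      using that by (intro mult_right_mono ennreal_leI) auto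
    also have "\<dots> < ennreal (b\<^sup>2) * ennreal (\<epsilon> / b\<^sup>2)"
      using that b by (intro ennreal_mult_strict_left_mono) auto
    also have "\<dots> = ennreal \<epsilon>"
      using b \<epsilon> by (simp flip: ennreal_mult)
    finally show ?thesis .
  qed
  show "\<forall>\<^sub>F n in sequentially. step_approx n \<epsilon> (\<lambda>u. a *\<^sub>R g u) (\<lambda>\<omega>. a * X \<omega>)"
    using wiener_integral_approx[OF g \<epsilon>']
  proof eventually_elim
    case (elim n)
    then obtain c where c: "l2sq (\<lambda>u. g u - step (Suc n) c u) < ennreal (\<epsilon> / b\<^sup>2)"
        "l0 (\<lambda>\<omega>. X \<omega> - step_integral (Suc n) c \<omega>) < ennreal (\<epsilon> / b\<^sup>2)"
      unfolding step_approx_def by blast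
    have "l2sq (\<lambda>u. a *\<^sub>R (g u - step (Suc n) c u)) < ennreal \<epsilon>"
      using scaled[OF c(1) a2] by (subst l2sq_scaleR) auto
    moreover have "l0 (\<lambda>\<omega>. a * (X \<omega> - step_integral (Suc n) c \<omega>))
        \<le> ennreal b * l0 (\<lambda>\<omega>. X \<omega> - step_integral (Suc n) c \<omega>)"
      unfolding b_def by (rule l0_scale) measurable
    then have "l0 (\<lambda>\<omega>. a * (X \<omega> - step_integral (Suc n) c \<omega>)) < ennreal \<epsilon>"
      by (rule le_less_trans) (rule scaled[OF c(2) b2])
    ultimately show ?case
      unfolding step_approx_def
      by (intro exI[of _ "\<lambda>k. a *\<^sub>R c k"]) (simp add: step_scaleR step_integral_scaleR algebra_simps)
  qed
qed

lemma wiener_integral_zero: "wiener_integral (\<lambda>_. 0) (\<lambda>_. 0)"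
proof -
  have "step_approx n \<epsilon> (\<lambda>_. 0) (\<lambda>_. 0)" if "0 < \<epsilon>" for n \<epsilon>
    unfolding step_approx_def
    by (rule exI[of _ "\<lambda>_. 0"]) (use that in \<open>simp add: l2sq_def l0_def step_def step_integral_def\<close>)
  then show ?thesis by (simp add: wiener_integral_def)
qed

lemma wiener_integral_sum:
  assumes "finite A" "\<And>i. i \<in> A \<Longrightarrow> wiener_integral (g i) (X i)"
  shows "wiener_integral (\<lambda>u. \<Sum>i\<in>A. g i u) (\<lambda>\<omega>. \<Sum>i\<in>A. X i \<omega>)"
  using assms by (induction A) (auto intro: wiener_integral_zero wiener_integral_add)

lemma wiener_integral_cong_AE:
  assumes g: "wiener_integral g X" and [measurable]: "Y \<in> borel_measurable M" and eq: "AE \<omega> in M. X \<omega> = Y \<omega>"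
  shows "wiener_integral g Y"
proof -
  have "l0 (\<lambda>\<omega>. X \<omega> - S \<omega>) = l0 (\<lambda>\<omega>. Y \<omega> - S \<omega>)" for S
    unfolding l0_def using eq by (intro nn_integral_cong_AE) auto
  then show ?thesis using g by (simp add: wiener_integral_def step_approx_def)
qed

text \<open>A diagonal argument: a member of the sequence that is close to the limit in both
  distances is fixed, and its own step approximations are used for the limit.\<close>

lemma wiener_integral_limit:
  assumes X: "\<And>m. wiener_integral (g m) (X m)" and [measurable]: "h \<in> borel_measurable borel" "Y \<in> borel_measurable M"
    and g: "(\<lambda>m. l2sq (\<lambda>u. h u - g m u)) \<longlonglongrightarrow> 0" and lim: "AE \<omega> in M. (\<lambda>m. X m \<omega>) \<longlonglongrightarrow> Y \<omega>"
  shows "wiener_integral h Y"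
  unfolding wiener_integral_def
proof (intro conjI allI impI)
  note [measurable] = wiener_integralD[OF X]
  fix \<epsilon> :: real assume \<epsilon>: "0 < \<epsilon>"
  then have \<epsilon>': "0 < \<epsilon> / 4" and pos: "(0::ennreal) < ennreal (\<epsilon> / 4)" by simp_all
  have "\<forall>\<^sub>F m in sequentially. l2sq (\<lambda>u. h u - g m u) < ennreal (\<epsilon> / 4) \<and> l0 (\<lambda>\<omega>. Y \<omega> - X m \<omega>) < ennreal (\<epsilon> / 4)"
    using order_tendstoD(2)[OF g pos] order_tendstoD(2)[OF l0_tendsto_zero[OF _ _ lim] pos]
    by (auto intro: eventually_conj)
  then obtain m where m: "l2sq (\<lambda>u. h u - g m u) < ennreal (\<epsilon> / 4)" "l0 (\<lambda>\<omega>. Y \<omega> - X m \<omega>) < ennreal (\<epsilon> / 4)"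
    by (auto simp: eventually_sequentially)
  show "\<forall>\<^sub>F n in sequentially. step_approx n \<epsilon> h Y"
    using wiener_integral_approx[OF X \<epsilon>', of m]
  proof eventually_elim
    case (elim n)
    obtain d where "l2sq (\<lambda>u. g m u + (h u - g m u) - step (Suc n) d u) < ennreal \<epsilon>"
      "l0 (\<lambda>\<omega>. X m \<omega> + (Y \<omega> - X m \<omega>) - step_integral (Suc n) d \<omega>) < ennreal \<epsilon>"
      by (rule step_approx_add_less[OF elim m \<epsilon>]) measurable
    then show ?case
      unfolding step_approx_def by auto
  qed
qed measurable

section \<open>Step functions on uniform partitions\<close>

lemma sum_cell:
  fixes f :: "nat \<Rightarrow> 'v::real_vector"
  assumes "k < n" "u \<in> cell n k"
  shows "(\<Sum>l<n. indicator (cell n l) u *\<^sub>R f l) = f k"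
proof -
  have "u \<notin> cell n l" if "l \<noteq> k" for l
    using node_mono[of "Suc l" k n] node_mono[of "Suc k" l n] that assms(2) by (cases "l < k") auto
  then have "(\<Sum>l<n. indicator (cell n l) u *\<^sub>R f l) = (\<Sum>l<n. if l = k then f k else 0)"
    using assms(2) by (intro sum.cong) auto
  then show ?thesis using assms(1) by simp
qed

text \<open>The cell is the first one whose right end reaches \<open>u\<close>; minimality puts
  \<open>u\<close> beyond its left end. As the cells are open on the left, the point 0 belongs to
  none of them.\<close>

lemma cell_exists:
  assumes "0 < u" "u \<le> T" "0 < n"
  obtains k where "k < n" "u \<in> cell n k"
proof -
  have ex: "u \<le> node n (Suc (n - 1))"
    using assms by (simp add: node_def)
  define k where "k = (LEAST k. u \<le> node n (Suc k))"
  have "u \<le> node n (Suc k)"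
    unfolding k_def by (rule LeastI[of _ "n - 1"]) (rule ex)
  moreover have "k \<le> n - 1"
    unfolding k_def by (rule Least_le) (rule ex)
  moreover have "node n k < u"
  proof (cases k)
    case 0
    then show ?thesis using assms by (simp add: node_def)
  next
    case (Suc l)
    then have "\<not> u \<le> node n (Suc l)"
      unfolding k_def by (intro not_less_Least) simp
    then show ?thesis using Suc by simp
  qed
  ultimately show ?thesis
    using assms by (intro that[of k]) auto
qed

lemma step_cases:
  obtains (cell) k where "k < n" "u \<in> cell n k" "step n c u = c k"
  | (outside) "\<And>k. k < n \<Longrightarrow> u \<notin> cell n k" "step n c u = 0"
proof (cases "\<exists>k<n. u \<in> cell n k")
  case True
  then obtain k where k: "k < n" "u \<in> cell n k" by blast
  then show ?thesis using cell sum_cell[OF k] by (auto simp: step_def)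
next
  case False
  then show ?thesis by (intro outside) (auto simp: step_def intro!: sum.neutral)
qed

lemma l2sq_step: "l2sq (step (Suc n) c) = ennreal (\<Sum>k<Suc n. (norm (c k))\<^sup>2 * (T / real (Suc n)))"
proof -
  let ?I = "cell (Suc n)"
  have pw: "ennreal ((norm (step (Suc n) c u))\<^sup>2) * indicator {0..T} u =
      (\<Sum>k<Suc n. ennreal ((norm (c k))\<^sup>2) * indicator (?I k) u)" for u
  proof (cases rule: step_cases[where n = "Suc n" and c = c and u = u])
    case (cell k)
    have "u \<in> {0..T}"
      using cell node_nonneg[of "Suc n" k] node_le_T[of "Suc k" n] by auto
    moreover have "(\<Sum>l<Suc n. ennreal ((norm (c l))\<^sup>2) * indicator (?I l) u) =
        ennreal (\<Sum>l<Suc n. indicator (?I l) u *\<^sub>R (norm (c l))\<^sup>2)"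
      by (subst sum_ennreal[symmetric]) (auto simp: indicator_def intro!: sum.cong)
    ultimately show ?thesis
      using cell(3) sum_cell[OF cell(1,2), of "\<lambda>l. (norm (c l))\<^sup>2"] by simp
  next
    case outside
    then have "(\<Sum>k<Suc n. ennreal ((norm (c k))\<^sup>2) * indicator (?I k) u) = 0"
      by (intro sum.neutral) (auto simp: indicator_def)
    then show ?thesis using outside(2) by simp
  qed
  have "l2sq (step (Suc n) c) = (\<Sum>k<Suc n. ennreal ((norm (c k))\<^sup>2) * emeasure lborel (?I k))"
    unfolding l2sq_def pw by (subst nn_integral_sum) (auto simp: nn_integral_cmult_indicator)
  also have "\<dots> = (\<Sum>k<Suc n. ennreal ((norm (c k))\<^sup>2 * (T / real (Suc n))))"
    using T_pos by (intro sum.cong) (simp_all add: node_mono node_diff del: of_nat_Suc flip: ennreal_mult)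
  also have "\<dots> = ennreal (\<Sum>k<Suc n. (norm (c k))\<^sup>2 * (T / real (Suc n)))"
    using T_pos by (intro sum_ennreal) auto
  finally show ?thesis .
qed

text \<open>Induction over the cells: the partial sum is known at the left end of the next cell, so
  the next increment contributes an independent Gaussian factor.\<close>

lemma char_step_integral:
  "expectation (\<lambda>\<omega>. cis (step_integral n c \<omega>)) = of_real (exp (- (\<Sum>k<n. (norm (c k))\<^sup>2 * (T / real n)) / 2))"
proof -
  define S where "S m \<omega> = (\<Sum>k<m. c k \<bullet> incr (node n k) (node n (Suc k)) \<omega>)" for m \<omega>
  have "expectation (\<lambda>\<omega>. cis (S m \<omega>)) = of_real (exp (- (\<Sum>k<m. (norm (c k))\<^sup>2 * (T / real n)) / 2)) \<and>
      S m \<in> borel_measurable (F (node n m))" for m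
  proof (induction m)
    case 0
    then show ?case by (simp add: S_def[abs_def] prob_space)
  next
    case (Suc m)
    have Sm: "S (Suc m) \<omega> = S m \<omega> + c m \<bullet> incr (node n m) (node n (Suc m)) \<omega>" for \<omega>
      by (simp add: S_def)
    have meas: "S (Suc m) \<in> borel_measurable (F (node n (Suc m)))"
      unfolding Sm[abs_def] using Suc.IH node_mono[of m "Suc m" n] node_nonneg[of n m]
      by (intro borel_measurable_add borel_measurable_inner borel_measurable_const measurable_incr)
        (auto intro: measurable_F_mono)
    have "expectation (\<lambda>\<omega>. cis (S (Suc m) \<omega>)) = expectation (\<lambda>\<omega>. cis (S m \<omega>)) *
        of_real (exp (- ((norm (c m))\<^sup>2 * (T / real n)) / 2))"
      unfolding Sm using Suc.IH node_mono[of m "Suc m" n] node_nonneg[of n m]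
      by (subst char_add_incr) (auto simp: node_diff)
    also have "\<dots> = of_real (exp (- (\<Sum>k<Suc m. (norm (c k))\<^sup>2 * (T / real n)) / 2))"
      using Suc.IH by (simp add: exp_add[symmetric] diff_divide_distrib flip: of_real_mult)
    finally show ?case using meas by blast
  qed
  then show ?thesis by (simp add: S_def step_integral_def)
qed

lemma char_diff_le:
  assumes [measurable]: "X \<in> borel_measurable M" "Y \<in> borel_measurable M"
  shows "norm (expectation (\<lambda>\<omega>. cis (X \<omega>)) - expectation (\<lambda>\<omega>. cis (Y \<omega>))) \<le> 2 * enn2real (l0 (\<lambda>\<omega>. X \<omega> - Y \<omega>))"
proof -
  have int: "integrable M (\<lambda>\<omega>. cis (Z \<omega>))" if [measurable]: "Z \<in> borel_measurable M" for Z
    by (rule integrable_const_bound[of _ 1]) auto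
  have "norm (expectation (\<lambda>\<omega>. cis (X \<omega>)) - expectation (\<lambda>\<omega>. cis (Y \<omega>))) = norm (expectation (\<lambda>\<omega>. cis (X \<omega>) - cis (Y \<omega>)))"
    by (simp add: int)
  also have "\<dots> \<le> expectation (\<lambda>\<omega>. norm (cis (X \<omega>) - cis (Y \<omega>)))"
    by (rule integral_norm_bound)
  also have "\<dots> \<le> expectation (\<lambda>\<omega>. 2 * min 1 \<bar>X \<omega> - Y \<omega>\<bar>)"
    by (intro integral_mono norm_cis_diff_le integrable_norm Bochner_Integration.integrable_diff int integrable_const_bound[of _ 2])
      (auto simp: abs_mult)
  also have "\<dots> = 2 * enn2real (l0 (\<lambda>\<omega>. X \<omega> - Y \<omega>))"
    unfolding l0_def by (simp add: integral_eq_nn_integral)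
  finally show ?thesis .
qed

text \<open>Step integrals are Gaussian with variance equal to the squared norm of the step
  function. These norms converge to \<open>l2sq g\<close>, and convergence in probability carries
  the characteristic functions to that of \<open>X\<close>.\<close>

theorem char_wiener_integral:
  assumes X: "wiener_integral g X" and fin: "l2sq g < \<infinity>"
  shows "expectation (\<lambda>\<omega>. cis (X \<omega>)) = of_real (exp (- enn2real (l2sq g) / 2))"
proof -
  note [measurable] = wiener_integralD[OF X]
  \<comment> \<open>Young's inequality is applied with parameter \<open>\<delta> m\<close> while the
    errors are below its square: the large factor \<open>1 + 1 / \<delta> m\<close> then leaves
    \<open>\<delta> m + (\<delta> m)\<^sup>2\<close>, which tends to 0.\<close>
  define \<delta> where "\<delta> m = 1 / real (Suc m)" for m
  have \<delta>: "0 < \<delta> m" for m by (simp add: \<delta>_def)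
  have \<delta>0: "\<delta> \<longlonglongrightarrow> 0"
    unfolding \<delta>_def using LIMSEQ_inverse_real_of_nat by (simp add: inverse_eq_divide)
  have "\<exists>n c. l2sq (\<lambda>u. g u - step (Suc n) c u) < ennreal ((\<delta> m)\<^sup>2) \<and>
        l0 (\<lambda>\<omega>. X \<omega> - step_integral (Suc n) c \<omega>) < ennreal ((\<delta> m)\<^sup>2)" for m
  proof -
    have "0 < (\<delta> m)\<^sup>2" using \<delta>[of m] by simp
    from wiener_integral_approx[OF X this] show ?thesis
      unfolding step_approx_def eventually_sequentially by blast
  qed
  then obtain n c where nc: "\<And>m. l2sq (\<lambda>u. g u - step (Suc (n m)) (c m) u) < ennreal ((\<delta> m)\<^sup>2)"
        "\<And>m. l0 (\<lambda>\<omega>. X \<omega> - step_integral (Suc (n m)) (c m) \<omega>) < ennreal ((\<delta> m)\<^sup>2)" by metis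
  define A where "A = enn2real (l2sq g)"
  define a where "a m = (\<Sum>k<Suc (n m). (norm (c m k))\<^sup>2 * (T / real (Suc (n m))))" for m
  have a0: "0 \<le> a m" for m
    unfolding a_def using T_pos by (intro sum_nonneg mult_nonneg_nonneg divide_nonneg_nonneg) auto
  have A0: "0 \<le> A"
    by (simp add: A_def)
  have A: "l2sq g = ennreal A" using fin by (simp add: A_def less_top)
  have a: "l2sq (step (Suc (n m)) (c m)) = ennreal (a m)" for m unfolding a_def by (rule l2sq_step)
  have bound: "x \<le> (1 + \<delta> m) * y + (\<delta> m + (\<delta> m)\<^sup>2)"
    if "ennreal x \<le> ennreal (1 + \<delta> m) * ennreal y + ennreal (1 + 1 / \<delta> m) * e" "e < ennreal ((\<delta> m)\<^sup>2)" "0 \<le> y" for x y e m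
  proof -
    have "ennreal x \<le> ennreal (1 + \<delta> m) * ennreal y + ennreal (1 + 1 / \<delta> m) * ennreal ((\<delta> m)\<^sup>2)"
      using that(2) by (intro order_trans[OF that(1)] add_left_mono mult_left_mono) auto
    also have "\<dots> = ennreal ((1 + \<delta> m) * y + (1 + 1 / \<delta> m) * (\<delta> m)\<^sup>2)"
      using \<delta>[of m] that(3) by (simp add: ennreal_mult ennreal_plus)
    finally have "x \<le> (1 + \<delta> m) * y + (1 + 1 / \<delta> m) * (\<delta> m)\<^sup>2"
      using \<delta>[of m] that(3) by (subst (asm) ennreal_le_iff) auto
    also have "(1 + 1 / \<delta> m) * (\<delta> m)\<^sup>2 = \<delta> m + (\<delta> m)\<^sup>2"
      using \<delta>[of m] by (simp add: field_simps power2_eq_square)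
    finally show ?thesis .
  qed
  have upper: "a m \<le> (1 + \<delta> m) * A + (\<delta> m + (\<delta> m)\<^sup>2)" for m
  proof (rule bound[OF _ nc(1)[of m] A0])
    have "l2sq (step (Suc (n m)) (c m)) = l2sq (\<lambda>u. g u + (-1) *\<^sub>R (g u - step (Suc (n m)) (c m) u))"
      by simp
    also have "\<dots> \<le> ennreal (1 + \<delta> m) * l2sq g +
        ennreal (1 + 1 / \<delta> m) * l2sq (\<lambda>u. (-1) *\<^sub>R (g u - step (Suc (n m)) (c m) u))"
      by (rule l2sq_add[OF _ _ \<delta>]) measurable
    finally show "ennreal (a m) \<le> ennreal (1 + \<delta> m) * ennreal A +
        ennreal (1 + 1 / \<delta> m) * l2sq (\<lambda>u. g u - step (Suc (n m)) (c m) u)"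
      by (simp only: a A) (subst (asm) l2sq_scaleR, auto)
  qed
  have lower: "A \<le> (1 + \<delta> m) * a m + (\<delta> m + (\<delta> m)\<^sup>2)" for m
  proof (rule bound[OF _ nc(1)[of m] a0])
    have "l2sq g = l2sq (\<lambda>u. step (Suc (n m)) (c m) u + (g u - step (Suc (n m)) (c m) u))"
      by simp
    also have "\<dots> \<le> ennreal (1 + \<delta> m) * l2sq (step (Suc (n m)) (c m)) +
        ennreal (1 + 1 / \<delta> m) * l2sq (\<lambda>u. g u - step (Suc (n m)) (c m) u)"
      by (rule l2sq_add[OF _ _ \<delta>]) measurable
    finally show "ennreal A \<le> ennreal (1 + \<delta> m) * ennreal (a m) +
        ennreal (1 + 1 / \<delta> m) * l2sq (\<lambda>u. g u - step (Suc (n m)) (c m) u)"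
      by (simp only: a A)
  qed
  have "a \<longlonglongrightarrow> A"
  proof (rule tendsto_sandwich)
    show "\<forall>\<^sub>F m in sequentially. (A - (\<delta> m + (\<delta> m)\<^sup>2)) / (1 + \<delta> m) \<le> a m"
    proof (intro always_eventually allI)
      show "(A - (\<delta> m + (\<delta> m)\<^sup>2)) / (1 + \<delta> m) \<le> a m" for m
        using lower[of m] \<delta>[of m] by (subst pos_divide_le_eq) (auto simp: algebra_simps)
    qed
    show "\<forall>\<^sub>F m in sequentially. a m \<le> (1 + \<delta> m) * A + (\<delta> m + (\<delta> m)\<^sup>2)"
      using upper by simp
    show "(\<lambda>m. (A - (\<delta> m + (\<delta> m)\<^sup>2)) / (1 + \<delta> m)) \<longlonglongrightarrow> A"
      by (rule tendsto_eq_intros \<delta>0 refl | simp)+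
    show "(\<lambda>m. (1 + \<delta> m) * A + (\<delta> m + (\<delta> m)\<^sup>2)) \<longlonglongrightarrow> A"
      by (rule tendsto_eq_intros \<delta>0 refl | simp)+
  qed
  then have "(\<lambda>m. of_real (exp (- a m / 2))) \<longlonglongrightarrow> (of_real (exp (- A / 2)) :: complex)"
    by (intro tendsto_intros) auto
  moreover have "(\<lambda>m. of_real (exp (- a m / 2))) \<longlonglongrightarrow> expectation (\<lambda>\<omega>. cis (X \<omega>))"
  proof (rule Lim_transform_bound[of _ "\<lambda>m. 2 * (\<delta> m)\<^sup>2", THEN Lim_null[THEN iffD2]])
    show "\<forall>\<^sub>F m in sequentially. norm (of_real (exp (- a m / 2)) - expectation (\<lambda>\<omega>. cis (X \<omega>))) \<le> norm (2 * (\<delta> m)\<^sup>2)"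
    proof (intro always_eventually allI)
      fix m
      have "norm (expectation (\<lambda>\<omega>. cis (X \<omega>)) - expectation (\<lambda>\<omega>. cis (step_integral (Suc (n m)) (c m) \<omega>))) \<le>
          2 * enn2real (l0 (\<lambda>\<omega>. X \<omega> - step_integral (Suc (n m)) (c m) \<omega>))"
        by (rule char_diff_le) measurable
      also have "\<dots> \<le> 2 * (\<delta> m)\<^sup>2"
        using nc(2)[of m] by (intro mult_left_mono enn2real_leI) auto
      finally show "norm (of_real (exp (- a m / 2)) - expectation (\<lambda>\<omega>. cis (X \<omega>))) \<le> norm (2 * (\<delta> m)\<^sup>2)"
        unfolding char_step_integral a_def[symmetric] by (simp add: norm_minus_commute)
    qed
    show "(\<lambda>m. 2 * (\<delta> m)\<^sup>2) \<longlonglongrightarrow> 0"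
      by (rule tendsto_eq_intros \<delta>0 refl | simp)+
  qed
  ultimately show ?thesis
    using LIMSEQ_unique A_def by blast
qed

section \<open>Convergence of step functions and Riemann sums\<close>

lemma step_outside: "u \<notin> {0..T} \<Longrightarrow> step (Suc n) c u = 0"
  using step_cases[of "Suc n" u c "step (Suc n) c u = 0"] node_nonneg node_le_T
  by (metis atLeastAtMost_iff greaterThanAtMost_iff Suc_leI less_imp_le order_trans)

lemma norm_step_le:
  assumes "\<And>k. norm (c k) \<le> C"
  shows "norm (step n c u) \<le> C"
  using assms order_trans[OF norm_ge_zero assms]
  by (cases rule: step_cases[where n = n and c = c and u = u]) auto

text \<open>The left end of the cell containing \<open>u\<close> is within \<open>T / Suc n\<close>
  of \<open>u\<close>, so continuity at this single point suffices.\<close>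

lemma step_tendsto:
  fixes \<phi> :: "real \<Rightarrow> 'v::real_normed_vector"
  assumes u: "0 < u" "u < T" and cont: "isCont \<phi> u"
  shows "(\<lambda>n. step (Suc n) (\<lambda>k. \<phi> (node (Suc n) k)) u) \<longlonglongrightarrow> \<phi> u"
proof -
  have "\<exists>k. k < Suc n \<and> u \<in> cell (Suc n) k" for n
    using cell_exists[of u "Suc n"] u by (metis less_imp_le zero_less_Suc)
  then obtain k where k: "\<And>n. k n < Suc n" "\<And>n. u \<in> {node (Suc n) (k n)<..node (Suc n) (Suc (k n))}"
    by metis
  have s: "step (Suc n) (\<lambda>k. \<phi> (node (Suc n) k)) u = \<phi> (node (Suc n) (k n))" for n
    unfolding step_def by (rule sum_cell[OF k(1)[of n] k(2)[of n]])
  have "(\<lambda>n. node (Suc n) (k n)) \<longlonglongrightarrow> u"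
  proof (rule tendsto_sandwich)
    show "\<forall>\<^sub>F n in sequentially. u - T * inverse (real (Suc n)) \<le> node (Suc n) (k n)"
    proof (intro always_eventually allI)
      fix n
      show "u - T * inverse (real (Suc n)) \<le> node (Suc n) (k n)"
        using k(2)[of n] node_diff[of "Suc n" "k n"] by (simp add: divide_inverse)
    qed
    show "\<forall>\<^sub>F n in sequentially. node (Suc n) (k n) \<le> u"
      using k(2) by (auto intro!: always_eventually less_imp_le)
    show "(\<lambda>n. u - T * inverse (real (Suc n))) \<longlonglongrightarrow> u"
      by (rule tendsto_eq_intros LIMSEQ_inverse_real_of_nat refl | simp)+
  qed simp
  then show ?thesis
    unfolding s by (rule isCont_tendsto_compose[OF cont])
qed

lemma l2sq_tendsto_zero:
  assumes [measurable]: "\<And>n. g n \<in> borel_measurable borel" and C: "\<And>n u. u \<in> {0..T} \<Longrightarrow> norm (g n u) \<le> C"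
    and lim: "AE u in lborel. 0 < u \<longrightarrow> u < T \<longrightarrow> (\<lambda>n. g n u) \<longlonglongrightarrow> 0"
  shows "(\<lambda>n. l2sq (g n)) \<longlonglongrightarrow> 0"
proof -
  have "(\<lambda>n. \<integral>\<^sup>+u\<in>{0..T}. ennreal ((norm (g n u))\<^sup>2) \<partial>lborel) \<longlonglongrightarrow> (\<integral>\<^sup>+(u::real). 0 \<partial>lborel)"
  proof (rule nn_integral_dominated_convergence[where w = "\<lambda>u. ennreal (C\<^sup>2) * indicator {0..T} u"])
    show "AE u in lborel. ennreal ((norm (g n u))\<^sup>2) * indicator {0..T} u \<le> ennreal (C\<^sup>2) * indicator {0..T} u" for n
      using C by (intro AE_I2) (auto simp: indicator_def intro!: ennreal_leI power_mono)
    show "(\<integral>\<^sup>+u. ennreal (C\<^sup>2) * indicator {0..T} u \<partial>lborel) < \<infinity>"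
      using T_pos by (simp add: nn_integral_cmult_indicator ennreal_mult_less_top)
    have "AE u in lborel. u \<noteq> 0" "AE u in lborel. u \<noteq> T"
      by (rule AE_lborel_singleton)+
    with lim show "AE u in lborel. (\<lambda>n. ennreal ((norm (g n u))\<^sup>2) * indicator {0..T} u) \<longlonglongrightarrow> 0"
    proof eventually_elim
      case (elim u)
      show ?case
      proof (cases "0 < u \<and> u < T")
        case True
        then have "(\<lambda>n. g n u) \<longlonglongrightarrow> 0"
          using elim by blast
        then have "(\<lambda>n. ennreal ((norm (g n u))\<^sup>2)) \<longlonglongrightarrow> ennreal ((norm (0 :: real ^ 'p))\<^sup>2)"
          by (intro tendsto_intros tendsto_ennrealI)
        then show ?thesis using True by simp
      next
        case False
        then show ?thesis using elim by (auto simp: indicator_def)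
      qed
    qed
  qed auto
  then show ?thesis by (simp add: l2sq_def)
qed

lemma l2sq_step_tendsto:
  assumes [measurable]: "\<phi> \<in> borel_measurable borel" and C: "\<And>u. norm (\<phi> u) \<le> C"
    and cont: "AE u in lborel. 0 < u \<longrightarrow> u < T \<longrightarrow> isCont \<phi> u"
  shows "(\<lambda>n. l2sq (\<lambda>u. \<phi> u - step (Suc n) (\<lambda>k. \<phi> (node (Suc n) k)) u)) \<longlonglongrightarrow> 0"
proof (rule l2sq_tendsto_zero)
  show "norm (\<phi> u - step (Suc n) (\<lambda>k. \<phi> (node (Suc n) k)) u) \<le> C + C" for n u
    by (intro order_trans[OF norm_triangle_ineq4] add_mono C norm_step_le)
  show "AE u in lborel. 0 < u \<longrightarrow> u < T \<longrightarrow> (\<lambda>n. \<phi> u - step (Suc n) (\<lambda>k. \<phi> (node (Suc n) k)) u) \<longlonglongrightarrow> 0"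
    using cont
  proof eventually_elim
    case (elim u)
    show ?case
    proof (intro impI)
      assume u: "0 < u" "u < T"
      then have "(\<lambda>n. \<phi> u - step (Suc n) (\<lambda>k. \<phi> (node (Suc n) k)) u) \<longlonglongrightarrow> \<phi> u - \<phi> u"
        using elim by (intro tendsto_intros step_tendsto) auto
      then show "(\<lambda>n. \<phi> u - step (Suc n) (\<lambda>k. \<phi> (node (Suc n) k)) u) \<longlonglongrightarrow> 0" by simp
    qed
  qed
qed measurable

text \<open>A Riemann sum is the integral of the step function with values at the left nodes, and
  dominated convergence applies. Continuity almost everywhere admits integrands that are cut off by
  an indicator.\<close>

theorem riemann_sums_tendsto:
  fixes \<phi> :: "real \<Rightarrow> 'v::euclidean_space"
  assumes [measurable]: "\<phi> \<in> borel_measurable borel" and C: "\<And>u. norm (\<phi> u) \<le> C"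
    and cont: "AE u in lborel. 0 < u \<longrightarrow> u < T \<longrightarrow> isCont \<phi> u"
  shows "(\<lambda>n. \<Sum>k<Suc n. (T / real (Suc n)) *\<^sub>R \<phi> (node (Suc n) k)) \<longlonglongrightarrow> integral {0..T} \<phi>"
proof -
  have C0: "0 \<le> C" using C[of 0] norm_ge_zero order_trans by blast
  let ?s = "\<lambda>n. step (Suc n) (\<lambda>k. \<phi> (node (Suc n) k))"
  have fin: "integrable lborel (\<lambda>u. C * indicator {0..T} u)"
    by (intro integrable_mult_right integrable_real_indicator) (simp_all add: emeasure_lborel_Icc_eq)
  have "(\<lambda>n. LINT u|lborel. indicator {0..T} u *\<^sub>R ?s n u) \<longlonglongrightarrow> (LINT u|lborel. indicator {0..T} u *\<^sub>R \<phi> u)"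
  proof (rule integral_dominated_convergence[where w = "\<lambda>u. C * indicator {0..T} u"])
    show "AE u in lborel. norm (indicator {0..T} u *\<^sub>R ?s n u) \<le> C * indicator {0..T} u" for n
      using C by (intro AE_I2) (auto simp: indicator_def intro: norm_step_le)
    have "AE u in lborel. u \<noteq> 0" "AE u in lborel. u \<noteq> T"
      by (rule AE_lborel_singleton)+
    with cont show "AE u in lborel. (\<lambda>n. indicator {0..T} u *\<^sub>R ?s n u) \<longlonglongrightarrow> indicator {0..T} u *\<^sub>R \<phi> u"
    proof eventually_elim
      case (elim u)
      show ?case
      proof (cases "0 < u \<and> u < T")
        case True
        then have "isCont \<phi> u" using elim by blast
        then show ?thesis using True by (intro tendsto_intros step_tendsto) auto
      next
        case False
        then show ?thesis using elim by (auto simp: indicator_def)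
      qed
    qed
  qed (use fin in measurable)
  moreover have "(LINT u|lborel. indicator {0..T} u *\<^sub>R ?s n u) = (\<Sum>k<Suc n. (T / real (Suc n)) *\<^sub>R \<phi> (node (Suc n) k))" for n
  proof -
    let ?I = "cell (Suc n)"
    have eq: "indicator {0..T} u *\<^sub>R ?s n u = (\<Sum>k<Suc n. indicator (?I k) u *\<^sub>R \<phi> (node (Suc n) k))" for u
      using step_outside[of u n] by (cases "u \<in> {0..T}") (simp_all add: step_def)
    have int: "integrable lborel (indicator (?I k) :: real \<Rightarrow> real)" for k
      by (rule integrable_real_indicator) (auto simp: node_mono)
    have "(LINT u|lborel. indicator {0..T} u *\<^sub>R ?s n u) = (\<Sum>k<Suc n. LINT u|lborel. indicator (?I k) u *\<^sub>R \<phi> (node (Suc n) k))"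
      unfolding eq by (intro Bochner_Integration.integral_sum integrable_scaleR_left int)
    also have "\<dots> = (\<Sum>k<Suc n. (T / real (Suc n)) *\<^sub>R \<phi> (node (Suc n) k))"
      using int by (intro sum.cong) (simp_all add: node_mono node_diff del: of_nat_Suc)
    finally show ?thesis .
  qed
  moreover have "(LINT u|lborel. indicator {0..T} u *\<^sub>R \<phi> u) = integral {0..T} \<phi>"
  proof -
    have "set_integrable lborel {0..T} \<phi>"
      unfolding set_integrable_def using C C0
      by (intro Bochner_Integration.integrable_bound[OF fin]) (auto simp: indicator_def)
    then show ?thesis
      using set_borel_integral_eq_integral(2) by (simp add: set_lebesgue_integral_def)
  qed
  ultimately show ?thesis by simp
qed

section \<open>Simple processes and the passage from Ito to Wiener integrals\<close>

lemma simple_process_Cons: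
  "simple_process M F t ((a, b, \<xi>) # H) \<longleftrightarrow> 0 \<le> a \<and> a \<le> b \<and> b \<le> t \<and>
     \<xi> \<in> borel_measurable (F a) \<and> bounded (\<xi> ` space M) \<and> simple_process M F t H"
  by (auto simp: simple_process_def)

lemma simple_process_append:
  "simple_process M F t (H @ H') \<longleftrightarrow> simple_process M F t H \<and> simple_process M F t H'"
  unfolding simple_process_def by (simp add: ball_Un)

lemma simple_process_mono: "simple_process M F t H \<Longrightarrow> t \<le> t' \<Longrightarrow> simple_process M F t' H"
  unfolding simple_process_def by fastforce

lemma simple_value_Cons:
  "simple_value ((a, b, \<xi>) # H) u \<omega> = \<xi> \<omega> * indicator {a<..b} u + simple_value H u \<omega>"
  by (simp add: simple_value_def)

lemma simple_integral_Cons: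
  "simple_integral W ((a, b, \<xi>) # H) \<omega> = \<xi> \<omega> * (W b \<omega> - W a \<omega>) + simple_integral W H \<omega>"
  by (simp add: simple_integral_def)

lemma borel_measurable_simple_value:
  assumes "simple_process M F t H"
  shows "(\<lambda>(\<omega>, u). simple_value H u \<omega>) \<in> borel_measurable (M \<Otimes>\<^sub>M borel)"
  using assms
proof (induction H)
  case Nil
  then show ?case by (simp add: simple_value_def)
next
  case (Cons h H)
  obtain a b \<xi> where h: "h = (a, b, \<xi>)" by (cases h)
  have [measurable]: "\<xi> \<in> borel_measurable M"
    using Cons.prems by (auto simp: h simple_process_Cons intro: measurable_F_M)
  have [measurable]: "(\<lambda>(\<omega>, u). simple_value H u \<omega>) \<in> borel_measurable (M \<Otimes>\<^sub>M borel)"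
    using Cons by (simp add: h simple_process_Cons)
  show ?case
    unfolding h simple_value_Cons by measurable
qed

lemma borel_measurable_simple_integral:
  assumes "simple_process M F t H"
  shows "simple_int j H \<in> borel_measurable M"
  using assms
proof (induction H)
  case Nil
  then show ?case by (simp add: simple_integral_def[abs_def])
next
  case (Cons h H)
  obtain a b \<xi> where h: "h = (a, b, \<xi>)" by (cases h)
  have [measurable]: "\<xi> \<in> borel_measurable M"
    using Cons.prems by (auto simp: h simple_process_Cons intro: measurable_F_M)
  have [measurable]: "simple_int j H \<in> borel_measurable M"
    using Cons by (simp add: h simple_process_Cons)
  have [measurable]: "(\<lambda>\<omega>. B b \<omega> $ j - B a \<omega> $ j) \<in> borel_measurable M"
    using Cons.prems measurable_F_M[OF measurable_incr_component[of a b j]]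
    by (simp add: h simple_process_Cons incr_def)
  show ?case
    unfolding h simple_integral_Cons[abs_def] by measurable
qed

lemma simple_value_outside:
  assumes "simple_process M F t H" "u \<notin> {0..t}"
  shows "simple_value H u \<omega> = 0"
  using assms
proof (induction H)
  case Nil
  then show ?case by (simp add: simple_value_def)
next
  case (Cons h H)
  obtain a b \<xi> where h: "h = (a, b, \<xi>)" by (cases h)
  show ?case
    using Cons by (auto simp: h simple_process_Cons simple_value_Cons indicator_def)
qed

text \<open>The step function is appended, with a minus sign, to the list that encodes the simple process, so
  that the isometry applies to the difference.\<close>

lemma simple_step_integral_dist:
  fixes d :: "nat \<Rightarrow> real" and f :: "real \<Rightarrow> real" and j :: 'p
  defines "c \<equiv> \<lambda>k. d k *\<^sub>R (axis j 1 :: real ^ 'p)"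
  assumes H: "simple_process M F t H" and t: "t \<le> T"
    and f[measurable]: "(\<lambda>u. indicator {0..t} u * f u) \<in> borel_measurable borel"
  shows "(\<integral>\<^sup>+\<omega>. ennreal ((simple_int j H \<omega> - step_integral (Suc n) c \<omega>)\<^sup>2) \<partial>M) \<le>
    2 * (\<integral>\<^sup>+\<omega>. (\<integral>\<^sup>+u\<in>{0..t}. ennreal ((f u - simple_value H u \<omega>)\<^sup>2) \<partial>lborel) \<partial>M) +
    2 * l2sq (\<lambda>u. (indicator {0..t} u * f u) *\<^sub>R axis j 1 - step (Suc n) c u)"
proof -
  define D where "D = map (\<lambda>k. (node (Suc n) k, node (Suc n) (Suc k), \<lambda>_::'w. - d k)) [0..<Suc n]"
  define dv where "dv u = (\<Sum>k<Suc n. indicator (cell (Suc n) k) u * d k)" for u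
  have "simple_process M F T D"
    unfolding simple_process_def D_def using node_nonneg node_mono node_le_T
    by (auto simp: image_constant_conv simp del: upt_Suc)
  then have HD: "simple_process M F T (H @ D)"
    using simple_process_mono[OF H t] by (simp add: simple_process_append)
  have step: "step (Suc n) c u = dv u *\<^sub>R axis j 1" for u
    unfolding step_def c_def dv_def by (simp only: scaleR_sum_left scaleR_scaleR)
  have "simple_value D u \<omega> = - dv u" for u \<omega>
    unfolding simple_value_def D_def dv_def
    by (simp add: comp_def interv_sum_list_conv_sum_set_nat atLeast0LessThan sum_negf mult.commute del: upt_Suc sum.lessThan_Suc)
  then have val: "simple_value (H @ D) u \<omega> = simple_value H u \<omega> - dv u" for u \<omega>
    by (simp add: simple_value_def)
  have "simple_int j D \<omega> = - step_integral (Suc n) c \<omega>" for \<omega>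
    unfolding simple_integral_def D_def step_integral_def c_def
    by (simp add: comp_def interv_sum_list_conv_sum_set_nat atLeast0LessThan sum_negf incr_def inner_axis' del: upt_Suc sum.lessThan_Suc)
  then have integ: "simple_int j (H @ D) \<omega> =
      simple_int j H \<omega> - step_integral (Suc n) c \<omega>" for \<omega>
    by (simp add: simple_integral_def)
  define a where "a \<omega> = (\<integral>\<^sup>+u\<in>{0..t}. ennreal ((f u - simple_value H u \<omega>)\<^sup>2) \<partial>lborel)" for \<omega>
  define e where "e = l2sq (\<lambda>u. (indicator {0..t} u * f u) *\<^sub>R axis j 1 - step (Suc n) c u)"
  have [measurable]: "dv \<in> borel_measurable borel"
    unfolding dv_def[abs_def] by measurable
  have [measurable]: "(\<lambda>(\<omega>, u). simple_value H u \<omega>) \<in> borel_measurable (M \<Otimes>\<^sub>M borel)"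
    by (rule borel_measurable_simple_value[OF H])
  have a_eq: "a \<omega> = (\<integral>\<^sup>+u. ennreal ((indicator {0..t} u * f u - simple_value H u \<omega>)\<^sup>2) * indicator {0..t} u \<partial>lborel)" for \<omega>
    unfolding a_def by (intro nn_integral_cong) (auto simp: indicator_def)
  have [measurable]: "a \<in> borel_measurable M"
    unfolding a_eq[abs_def] by measurable
  have e_eq: "e = (\<integral>\<^sup>+u. ennreal ((indicator {0..t} u * f u - dv u)\<^sup>2) * indicator {0..T} u \<partial>lborel)"
    unfolding e_def l2sq_def step
    by (intro nn_integral_cong) (simp add: scaleR_diff_left[symmetric] norm_axis_1)
  have "(\<integral>\<^sup>+u. ennreal ((simple_value (H @ D) u \<omega>)\<^sup>2) \<partial>lborel) \<le> 2 * a \<omega> + 2 * e" if \<omega>: "\<omega> \<in> space M" for \<omega>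
  proof -
    have [measurable]: "(\<lambda>u. simple_value H u \<omega>) \<in> borel_measurable borel"
      using measurable_compose[OF measurable_Pair1'[OF \<omega>] borel_measurable_simple_value[OF H]] by simp
    have "(\<integral>\<^sup>+u. ennreal ((simple_value (H @ D) u \<omega>)\<^sup>2) \<partial>lborel) \<le>
      (\<integral>\<^sup>+u. 2 * (ennreal ((indicator {0..t} u * f u - simple_value H u \<omega>)\<^sup>2) * indicator {0..t} u)
        + 2 * (ennreal ((indicator {0..t} u * f u - dv u)\<^sup>2) * indicator {0..T} u) \<partial>lborel)"
    proof (intro nn_integral_mono)
      fix u
      have two: "2 * ennreal (x\<^sup>2) = ennreal (2 * x\<^sup>2)" for x
        by (simp add: ennreal_mult)
      \<comment> \<open>Both terms matter on \<open>{0..t}\<close>. Between \<open>t\<close> and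
        \<open>T\<close> only the step function can be nonzero, and there it is itself the error
        measured by \<open>e\<close>. Beyond \<open>T\<close> everything vanishes.\<close>
      consider "u \<in> {0..t}" | "u \<notin> {0..t}" "u \<in> {0..T}" | "u \<notin> {0..T}" "u \<notin> {0..t}"
        using t by fastforce
      then show "ennreal ((simple_value (H @ D) u \<omega>)\<^sup>2) \<le>
        2 * (ennreal ((indicator {0..t} u * f u - simple_value H u \<omega>)\<^sup>2) * indicator {0..t} u)
        + 2 * (ennreal ((indicator {0..t} u * f u - dv u)\<^sup>2) * indicator {0..T} u)"
      proof cases
        case 1
        then have "u \<in> {0..T}" using t by auto
        moreover have "(simple_value H u \<omega> - dv u)\<^sup>2 \<le> 2 * (f u - simple_value H u \<omega>)\<^sup>2 + 2 * (f u - dv u)\<^sup>2"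
          using norm_add_power2_le[of 1 "simple_value H u \<omega> - f u" "f u - dv u"] by (simp add: power2_commute)
        ultimately show ?thesis
          using 1 by (simp add: val two flip: ennreal_plus)
      next
        case 2
        then show ?thesis
          using simple_value_outside[OF H 2(1)] by (simp add: val two)
      next
        case 3
        then have "dv u = 0"
          using step_outside[OF 3(1), of n c] by (simp add: step)
        then show ?thesis
          using simple_value_outside[OF H 3(2)] by (simp add: val)
      qed
    qed
    also have "\<dots> = 2 * a \<omega> + 2 * e"
      unfolding a_eq e_eq by (simp add: nn_integral_add nn_integral_cmult)
    finally show ?thesis .
  qed
  then have "(\<integral>\<^sup>+\<omega>. (\<integral>\<^sup>+u. ennreal ((simple_value (H @ D) u \<omega>)\<^sup>2) \<partial>lborel) \<partial>M) \<le> (\<integral>\<^sup>+\<omega>. 2 * a \<omega> + 2 * e \<partial>M)"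
    by (intro nn_integral_mono)
  also have "\<dots> = 2 * (\<integral>\<^sup>+\<omega>. a \<omega> \<partial>M) + 2 * e"
    by (simp add: nn_integral_add nn_integral_cmult emeasure_space_1)
  finally show ?thesis
    using ito_isometry_simple[OF HD, of j] unfolding integ a_def e_def by simp
qed

text \<open>The Ito integral comes with random simple processes on arbitrary intervals, whereas
  \<open>wiener_integral\<close> asks for deterministic steps on uniform partitions. The isometry
  compares the two, and the random approximations disappear in the limit.\<close>

theorem wiener_integral_ito:
  assumes I: "has_ito_integral M F (\<lambda>u \<omega>. B u \<omega> $ j) t (\<lambda>u \<omega>. f u) I"
    and f: "continuous_on {0..t} f" and t: "t \<le> T"
  shows "wiener_integral (\<lambda>u. (indicator {0..t} u * f u) *\<^sub>R axis j 1) I"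
proof -
  define \<phi> :: "real \<Rightarrow> real ^ 'p" where "\<phi> u = (indicator {0..t} u * f u) *\<^sub>R axis j 1" for u
  have ind[measurable]: "(\<lambda>u. indicator {0..t} u * f u) \<in> borel_measurable borel"
    using borel_measurable_continuous_on_indicator[OF _ f] by simp
  have [measurable]: "\<phi> \<in> borel_measurable borel"
    unfolding \<phi>_def[abs_def] by measurable
  have [measurable]: "I \<in> borel_measurable M"
    using I unfolding has_ito_integral_def by blast
  obtain H where H: "\<And>m. simple_process M F t (H m)"
    and lim1: "(\<lambda>m. \<integral>\<^sup>+\<omega>. (\<integral>\<^sup>+u\<in>{0..t}. ennreal ((f u - simple_value (H m) u \<omega>)\<^sup>2) \<partial>lborel) \<partial>M) \<longlonglongrightarrow> 0"
    and lim2: "(\<lambda>m. \<integral>\<^sup>+\<omega>. ennreal ((I \<omega> - simple_int j (H m) \<omega>)\<^sup>2) \<partial>M) \<longlonglongrightarrow> 0"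
    using I unfolding has_ito_integral_def by blast
  have contf: "continuous_on {0..t} (\<lambda>u. f u *\<^sub>R (axis j 1 :: real ^ 'p))"
    by (intro continuous_intros f)
  obtain C where C: "\<And>u. norm (\<phi> u) \<le> C"
    using truncated_continuous(2)[OF contf] by (auto simp: \<phi>_def)
  have cont: "AE u in lborel. 0 < u \<longrightarrow> u < T \<longrightarrow> isCont \<phi> u"
    using truncated_continuous(3)[OF contf] by (auto simp: \<phi>_def[abs_def] elim!: eventually_mono)
  define c where "c n = (\<lambda>k. \<phi> (node (Suc n) k))" for n
  define e where "e n = l2sq (\<lambda>u. \<phi> u - step (Suc n) (c n) u)" for n
  have e: "e \<longlonglongrightarrow> 0"
    unfolding e_def c_def by (rule l2sq_step_tendsto[OF _ C cont]) measurable
  \<comment> \<open>For fixed \<open>n\<close> the estimate holds for every \<open>m\<close>, and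
    letting \<open>m\<close> grow removes both terms that involve \<open>H m\<close>. The factor 4
    comes from using the inequality for the square of a sum twice.\<close>
  have dist: "(\<integral>\<^sup>+\<omega>. ennreal ((I \<omega> - step_integral (Suc n) (c n) \<omega>)\<^sup>2) \<partial>M) \<le> 4 * e n" for n
  proof -
    let ?A = "\<lambda>m. \<integral>\<^sup>+\<omega>. ennreal ((I \<omega> - simple_int j (H m) \<omega>)\<^sup>2) \<partial>M"
    let ?B = "\<lambda>m. \<integral>\<^sup>+\<omega>. (\<integral>\<^sup>+u\<in>{0..t}. ennreal ((f u - simple_value (H m) u \<omega>)\<^sup>2) \<partial>lborel) \<partial>M"
    have "(\<integral>\<^sup>+\<omega>. ennreal ((I \<omega> - step_integral (Suc n) (c n) \<omega>)\<^sup>2) \<partial>M) \<le> 2 * ?A m + 2 * (2 * ?B m + 2 * e n)" for m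
    proof -
      have [measurable]: "simple_int j (H m) \<in> borel_measurable M"
        by (rule borel_measurable_simple_integral[OF H])
      have "(\<integral>\<^sup>+\<omega>. ennreal (((I \<omega> - simple_int j (H m) \<omega>) +
          (simple_int j (H m) \<omega> - step_integral (Suc n) (c n) \<omega>))\<^sup>2) \<partial>M) \<le>
          2 * ?A m + 2 * (\<integral>\<^sup>+\<omega>. ennreal ((simple_int j (H m) \<omega> - step_integral (Suc n) (c n) \<omega>)\<^sup>2) \<partial>M)"
        by (rule nn_integral_power2_add_le) measurable
      also have "\<dots> \<le> 2 * ?A m + 2 * (2 * ?B m + 2 * e n)"
        unfolding e_def c_def \<phi>_def
        by (intro add_left_mono mult_left_mono simple_step_integral_dist[OF H t ind]) auto
      finally show ?thesis by simp
    qed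
    moreover have "(\<lambda>m. 2 * ?A m + 2 * (2 * ?B m + 2 * e n)) \<longlonglongrightarrow> 2 * 0 + 2 * (2 * 0 + 2 * e n)"
      by (intro tendsto_add ennreal_tendsto_cmult lim1 lim2 tendsto_const) auto
    ultimately have "(\<integral>\<^sup>+\<omega>. ennreal ((I \<omega> - step_integral (Suc n) (c n) \<omega>)\<^sup>2) \<partial>M) \<le> 2 * 0 + 2 * (2 * 0 + 2 * e n)"
      by (intro LIMSEQ_le_const) auto
    also have "\<dots> = 4 * e n"
      by (simp add: mult.assoc[symmetric])
    finally show ?thesis .
  qed
  have "wiener_integral \<phi> I"
    unfolding wiener_integral_def
  proof (intro conjI allI impI)
    fix \<epsilon> :: real assume \<epsilon>: "0 < \<epsilon>"
    \<comment> \<open>The bound \<open>\<epsilon>\<^sup>2 / 16\<close> times the factor 4 of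
      \<open>dist\<close> is the second moment \<open>\<epsilon>\<^sup>2 / 4\<close> required by
      \<open>l0_le_second_moment\<close>.\<close>
    have "\<forall>\<^sub>F n in sequentially. e n < ennreal \<epsilon>" "\<forall>\<^sub>F n in sequentially. e n < ennreal (\<epsilon>\<^sup>2 / 16)"
      using order_tendstoD(2)[OF e] \<epsilon> by simp_all
    then show "\<forall>\<^sub>F n in sequentially. step_approx n \<epsilon> \<phi> I"
    proof eventually_elim
      case (elim n)
      have "4 * e n < 4 * ennreal (\<epsilon>\<^sup>2 / 16)"
        using elim(2) by (intro ennreal_mult_strict_left_mono) auto
      also have "\<dots> = ennreal 4 * ennreal (\<epsilon>\<^sup>2 / 16)"
        by simp
      also have "\<dots> = ennreal (\<epsilon>\<^sup>2 / 4)"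
        by (simp del: ennreal_numeral add: ennreal_mult[symmetric])
      finally have "l0 (\<lambda>\<omega>. I \<omega> - step_integral (Suc n) (c n) \<omega>) < ennreal \<epsilon>"
        by (intro l0_le_second_moment \<epsilon> le_less_trans[OF dist[of n]]) measurable
      then show ?case
        using elim(1) unfolding e_def step_approx_def by blast
    qed
  qed measurable
  then show ?thesis by (simp add: \<phi>_def[abs_def])
qed

subsection \<open>Matrix-valued integrands\<close>

text \<open>Tested against all row vectors, so that only scalar integrals are involved and
  multiplication by a matrix merely changes the test vector.\<close>

definition vec_integral :: "(real \<Rightarrow> real ^ 'p ^ 'd) \<Rightarrow> ('w \<Rightarrow> real ^ 'd) \<Rightarrow> bool" where
  "vec_integral G X \<longleftrightarrow> (\<forall>\<theta>. wiener_integral (\<lambda>u. \<theta> v* G u) (\<lambda>\<omega>. \<theta> \<bullet> X \<omega>))"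

lemma vec_integral_zero: "vec_integral (\<lambda>_. 0) (\<lambda>_. 0)"
  by (simp add: vec_integral_def wiener_integral_zero)

lemma vec_integral_add:
  "vec_integral G X \<Longrightarrow> vec_integral H Y \<Longrightarrow> vec_integral (\<lambda>u. G u + H u) (\<lambda>\<omega>. X \<omega> + Y \<omega>)"
  by (simp add: vec_integral_def inner_add_right vector_matrix_mult_add_rdistrib wiener_integral_add)

lemma vec_integral_mult:
  fixes A :: "real ^ 'd ^ 'e"
  assumes "vec_integral G X"
  shows "vec_integral (\<lambda>u. A ** G u) (\<lambda>\<omega>. A *v X \<omega>)"
  using assms by (simp add: vec_integral_def vector_matrix_mult_assoc dot_lmul_matrix[symmetric])

lemma vec_integral_sum:
  assumes "finite S" "\<And>i. i \<in> S \<Longrightarrow> vec_integral (G i) (X i)"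
  shows "vec_integral (\<lambda>u. \<Sum>i\<in>S. G i u) (\<lambda>\<omega>. \<Sum>i\<in>S. X i \<omega>)"
  using assms by (induction S) (auto intro: vec_integral_zero vec_integral_add)

lemma vec_integral_diff:
  assumes "vec_integral G X" "vec_integral H Y"
  shows "vec_integral (\<lambda>u. G u - H u) (\<lambda>\<omega>. X \<omega> - Y \<omega>)"
proof -
  have minus: "(- mat 1) ** A = - A" for A :: "real ^ 'p ^ 'd"
    by (simp add: matrix_matrix.minus_left)
  have minus': "(- mat 1) *v x = - x" for x :: "real ^ 'd"
    by (simp add: matrix_vector.minus_left)
  show ?thesis
    using vec_integral_add[OF assms(1) vec_integral_mult[OF assms(2), of "- mat 1"]]
    by (simp add: minus minus')
qed

lemma vec_integral_measurable:
  assumes "vec_integral G X"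
  shows "X \<in> borel_measurable M"
proof (rule borel_measurable_vec_componentsI)
  fix i
  have "(\<lambda>\<omega>. axis i 1 \<bullet> X \<omega>) \<in> borel_measurable M"
    using assms wiener_integralD(2) unfolding vec_integral_def by blast
  then show "(\<lambda>\<omega>. X \<omega> $ i) \<in> borel_measurable M"
    by (simp add: inner_axis')
qed

lemma vec_integral_cong_AE:
  assumes "vec_integral G X" and [measurable]: "Y \<in> borel_measurable M" and eq: "AE \<omega> in M. X \<omega> = Y \<omega>"
  shows "vec_integral G Y"
  unfolding vec_integral_def
proof
  fix \<theta>
  show "wiener_integral (\<lambda>u. \<theta> v* G u) (\<lambda>\<omega>. \<theta> \<bullet> Y \<omega>)"
  proof (rule wiener_integral_cong_AE)
    show "wiener_integral (\<lambda>u. \<theta> v* G u) (\<lambda>\<omega>. \<theta> \<bullet> X \<omega>)"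
      using assms(1) unfolding vec_integral_def by blast
    show "AE \<omega> in M. \<theta> \<bullet> X \<omega> = \<theta> \<bullet> Y \<omega>"
      using eq by eventually_elim simp
  qed measurable
qed

theorem vec_integral_ito:
  assumes I: "has_ito_integral_matrix M F B t (\<lambda>u \<omega>. G u) I" and G: "continuous_on {0..t} G" and t: "t \<le> T"
  shows "vec_integral (\<lambda>u. indicator {0..t} u *\<^sub>R G u) I"
proof -
  obtain J where J: "\<And>i j. has_ito_integral M F (\<lambda>u \<omega>. B u \<omega> $ j) t (\<lambda>u \<omega>. G u $ i $ j) (J i j)"
    and IJ: "\<And>\<omega> i. \<omega> \<in> space M \<Longrightarrow> I \<omega> $ i = (\<Sum>j\<in>UNIV. J i j \<omega>)"
    using I unfolding has_ito_integral_matrix_def by blast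
  have [measurable]: "J i j \<in> borel_measurable M" for i j
    using J unfolding has_ito_integral_def by blast
  have wJ: "wiener_integral (\<lambda>u. (indicator {0..t} u * G u $ i $ j) *\<^sub>R axis j 1) (J i j)" for i j
    by (rule wiener_integral_ito[OF J _ t]) (intro continuous_on_component G)
  have [measurable]: "I \<in> borel_measurable M"
    by (rule borel_measurable_vec_componentsI) (simp add: IJ cong: measurable_cong)
  show ?thesis
    unfolding vec_integral_def
  proof
    fix \<theta>
    have "wiener_integral (\<lambda>u. \<Sum>i\<in>UNIV. \<Sum>j\<in>UNIV. \<theta> $ i *\<^sub>R (indicator {0..t} u * G u $ i $ j) *\<^sub>R axis j 1)
        (\<lambda>\<omega>. \<Sum>i\<in>UNIV. \<Sum>j\<in>UNIV. \<theta> $ i * J i j \<omega>)"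
      by (intro wiener_integral_sum wiener_integral_scaleR wJ finite)
    also have "(\<lambda>u. \<Sum>i\<in>UNIV. \<Sum>j\<in>UNIV. \<theta> $ i *\<^sub>R (indicator {0..t} u * G u $ i $ j) *\<^sub>R axis j 1) =
        (\<lambda>u. \<theta> v* (indicator {0..t} u *\<^sub>R G u))"
      using sum_inner_mult_axis[of \<theta> "indicator {0..t} u *\<^sub>R G u" for u] by simp
    finally show "wiener_integral (\<lambda>u. \<theta> v* (indicator {0..t} u *\<^sub>R G u)) (\<lambda>\<omega>. \<theta> \<bullet> I \<omega>)"
    proof (rule wiener_integral_cong_AE)
      show "AE \<omega> in M. (\<Sum>i\<in>UNIV. \<Sum>j\<in>UNIV. \<theta> $ i * J i j \<omega>) = \<theta> \<bullet> I \<omega>"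
        by (rule AE_I2) (simp add: inner_vec_def IJ sum_distrib_left)
    qed measurable
  qed
qed

text \<open>The hypotheses fit Riemann sums: pointwise convergence with a uniform bound gives
  mean-square convergence of the integrands, and the variables converge path by path.\<close>

lemma vec_integral_limit:
  fixes G :: "nat \<Rightarrow> real \<Rightarrow> real ^ 'p ^ 'd"
  assumes X: "\<And>n. vec_integral (G n) (X n)"
    and [measurable]: "H \<in> borel_measurable borel" "\<And>n. G n \<in> borel_measurable borel" "Y \<in> borel_measurable M"
    and bound: "\<And>n u. u \<in> {0..T} \<Longrightarrow> norm (H u - G n u) \<le> C"
    and G: "\<And>u. 0 < u \<Longrightarrow> u < T \<Longrightarrow> (\<lambda>n. G n u) \<longlonglongrightarrow> H u"
    and lim: "AE \<omega> in M. (\<lambda>n. X n \<omega>) \<longlonglongrightarrow> Y \<omega>"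
  shows "vec_integral H Y"
  unfolding vec_integral_def
proof
  fix \<theta> :: "real ^ 'd"
  obtain K where K: "norm (x v* A) \<le> norm x * norm A * K" "0 \<le> K" for A :: "real ^ 'p ^ 'd" and x
    using vector_matrix.nonneg_bounded by blast
  show "wiener_integral (\<lambda>u. \<theta> v* H u) (\<lambda>\<omega>. \<theta> \<bullet> Y \<omega>)"
  proof (rule wiener_integral_limit)
    show "wiener_integral (\<lambda>u. \<theta> v* G n u) (\<lambda>\<omega>. \<theta> \<bullet> X n \<omega>)" for n
      using X unfolding vec_integral_def by blast
    show "AE \<omega> in M. (\<lambda>n. \<theta> \<bullet> X n \<omega>) \<longlonglongrightarrow> \<theta> \<bullet> Y \<omega>"
      using lim by eventually_elim (intro tendsto_intros)
    show "(\<lambda>n. l2sq (\<lambda>u. \<theta> v* H u - \<theta> v* G n u)) \<longlonglongrightarrow> 0"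
    proof (rule l2sq_tendsto_zero)
      show "norm (\<theta> v* H u - \<theta> v* G n u) \<le> norm \<theta> * C * K" if "u \<in> {0..T}" for n u
        using order_trans[OF K(1) mult_right_mono[OF mult_left_mono[OF bound[OF that] norm_ge_zero] K(2)]]
        by (simp add: vector_matrix_mult_diff_rdistrib[symmetric])
      show "AE u in lborel. 0 < u \<longrightarrow> u < T \<longrightarrow> (\<lambda>n. \<theta> v* H u - \<theta> v* G n u) \<longlonglongrightarrow> 0"
      proof (intro AE_I2 impI)
        fix u assume u: "0 < u" "u < T"
        have "(\<lambda>n. \<theta> v* H u - \<theta> v* G n u) \<longlonglongrightarrow> \<theta> v* H u - \<theta> v* H u"
          by (intro tendsto_intros vector_matrix.tendsto G u)
        then show "(\<lambda>n. \<theta> v* H u - \<theta> v* G n u) \<longlonglongrightarrow> 0" by simp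
      qed
    qed measurable
  qed measurable
qed

text \<open>The linear combination is a single Wiener integral with integrand \<open>g\<close>, and
  expanding its squared norm gives the double sum. Since the covariances are a parameter
  \<open>C\<close>, two families with the same \<open>m\<close> and \<open>C\<close> have equal
  characteristic functions.\<close>

theorem char_vec_integrals:
  fixes G :: "'i \<Rightarrow> real \<Rightarrow> real ^ 'p ^ 'd"
  assumes J: "finite J" and X: "\<And>t. t \<in> J \<Longrightarrow> vec_integral (G t) (X t)"
    and C: "\<And>s t. s \<in> J \<Longrightarrow> t \<in> J \<Longrightarrow> ((\<lambda>u. (\<theta> s v* G s u) \<bullet> (\<theta> t v* G t u)) has_integral C s t) {0..T}"
  shows "expectation (\<lambda>\<omega>. cis (\<Sum>t\<in>J. \<theta> t \<bullet> (m t + X t \<omega>))) =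
    cis (\<Sum>t\<in>J. \<theta> t \<bullet> m t) * of_real (exp (- (\<Sum>s\<in>J. \<Sum>t\<in>J. C s t) / 2))"
proof -
  define g where "g u = (\<Sum>t\<in>J. \<theta> t v* G t u)" for u
  have W: "wiener_integral g (\<lambda>\<omega>. \<Sum>t\<in>J. \<theta> t \<bullet> X t \<omega>)"
    unfolding g_def[abs_def] using X by (intro wiener_integral_sum J) (auto simp: vec_integral_def)
  note [measurable] = wiener_integralD[OF W]
  have "((\<lambda>u. \<Sum>s\<in>J. \<Sum>t\<in>J. (\<theta> s v* G s u) \<bullet> (\<theta> t v* G t u)) has_integral (\<Sum>s\<in>J. \<Sum>t\<in>J. C s t)) {0..T}"
    by (intro has_integral_sum J C)
  moreover have "(\<Sum>s\<in>J. \<Sum>t\<in>J. (\<theta> s v* G s u) \<bullet> (\<theta> t v* G t u)) = (norm (g u))\<^sup>2" for u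
    unfolding g_def power2_norm_eq_inner by (subst inner_sum_left) (simp only: inner_sum_right)
  ultimately have int: "((\<lambda>u. (norm (g u))\<^sup>2) has_integral (\<Sum>s\<in>J. \<Sum>t\<in>J. C s t)) {0..T}"
    by simp
  have "((\<lambda>u. indicator {0..T} u * (norm (g u))\<^sup>2) has_integral (\<Sum>s\<in>J. \<Sum>t\<in>J. C s t)) UNIV"
  proof -
    have "indicator {0..T} u * (norm (g u))\<^sup>2 = (if u \<in> {0..T} then (norm (g u))\<^sup>2 else 0)" for u
      by simp
    then show ?thesis
      using int by (simp only: has_integral_restrict_UNIV)
  qed
  then have "(\<integral>\<^sup>+u. ennreal (indicator {0..T} u * (norm (g u))\<^sup>2) \<partial>lborel) = ennreal (\<Sum>s\<in>J. \<Sum>t\<in>J. C s t)"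
    by (intro nn_integral_has_integral_lborel) auto
  moreover have "l2sq g = (\<integral>\<^sup>+u. ennreal (indicator {0..T} u * (norm (g u))\<^sup>2) \<partial>lborel)"
    unfolding l2sq_def by (intro nn_integral_cong) (simp add: indicator_def)
  ultimately have l2: "l2sq g = ennreal (\<Sum>s\<in>J. \<Sum>t\<in>J. C s t)"
    by simp
  have "0 \<le> (\<Sum>s\<in>J. \<Sum>t\<in>J. C s t)"
    using int by (rule has_integral_nonneg) simp
  then have char: "expectation (\<lambda>\<omega>. cis (\<Sum>t\<in>J. \<theta> t \<bullet> X t \<omega>)) = of_real (exp (- (\<Sum>s\<in>J. \<Sum>t\<in>J. C s t) / 2))"
    using char_wiener_integral[OF W] l2 by simp
  have "cis (\<Sum>t\<in>J. \<theta> t \<bullet> (m t + X t \<omega>)) = cis (\<Sum>t\<in>J. \<theta> t \<bullet> m t) * cis (\<Sum>t\<in>J. \<theta> t \<bullet> X t \<omega>)" for \<omega>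
    by (simp add: cis_mult inner_add_right sum.distrib)
  then show ?thesis
    by (simp add: char)
qed

end

section \<open>The solution of the linear equation\<close>

locale linear_process = wiener_horizon M F B T + linear_evolution Q E
  for M :: "'w measure" and F and B :: "real \<Rightarrow> 'w \<Rightarrow> real ^ 'p" and T
    and Q :: "real \<Rightarrow> real ^ 'd ^ 'd" and E +
  fixes \<Sigma> :: "real \<Rightarrow> real ^ 'p ^ 'd" and r :: "real \<Rightarrow> real ^ 'd"
  assumes cont_\<Sigma>: "continuous_on {0..} \<Sigma>" and cont_r: "continuous_on {0..} r"
begin

text \<open>Diffusion coefficient of \<open>ev_inv t *v Z t\<close>, a process in whose equation
  \<open>Q\<close> no longer occurs; \<open>drift\<close> is the integral of its forcing
  term.\<close>

definition sig :: "real \<Rightarrow> real ^ 'p ^ 'd" where "sig v = ev_inv v ** \<Sigma> v"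

definition drift :: "real \<Rightarrow> real ^ 'd" where "drift t = integral {0..t} (\<lambda>u. ev_inv u *v r u)"

lemma continuous_on_sig: "continuous_on {0..} sig"
  unfolding sig_def[abs_def] by (intro continuous_intros continuous_on_ev_inv cont_\<Sigma>)

lemma continuous_on_Icc:
  fixes f :: "real \<Rightarrow> 'v::topological_space"
  assumes "continuous_on {0..} f" "0 \<le> a"
  shows "continuous_on {a..b} f"
  by (rule continuous_on_subset[OF assms(1)]) (use assms(2) in auto)

text \<open>The nodes are always those of the partition of \<open>{0..T}\<close> and the interval is
  selected by an indicator, so sums over different intervals share their nodes.\<close>

abbreviation riemann_sum :: "real \<Rightarrow> real \<Rightarrow> (real \<Rightarrow> 'v::real_vector) \<Rightarrow> nat \<Rightarrow> 'v" where
  "riemann_sum a b f n \<equiv>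
     \<Sum>k<Suc n. (T / real (Suc n)) *\<^sub>R (indicator {a..b} (node (Suc n) k) *\<^sub>R f (node (Suc n) k))"

lemma riemann_sums_Icc:
  fixes f :: "real \<Rightarrow> 'v::euclidean_space"
  assumes f: "continuous_on {a..b} f" and ab: "0 \<le> a" "b \<le> T"
  shows "(\<lambda>n. riemann_sum a b f n)
    \<longlonglongrightarrow> integral {a..b} f"
proof -
  obtain C where C: "\<And>u. norm (indicator {a..b} u *\<^sub>R f u) \<le> C"
    using truncated_continuous(2)[OF f] by blast
  have "(\<lambda>n. riemann_sum a b f n)
    \<longlonglongrightarrow> integral {0..T} (\<lambda>u. indicator {a..b} u *\<^sub>R f u)"
    using truncated_continuous(3)[OF f]
    by (intro riemann_sums_tendsto[where C = C] truncated_continuous(1)[OF f] C) auto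
  also have "integral {0..T} (\<lambda>u. indicator {a..b} u *\<^sub>R f u) = integral {0..T} (\<lambda>u. if u \<in> {a..b} then f u else 0)"
    by (intro integral_cong) simp
  also have "\<dots> = integral {a..b} f"
  proof -
    have "{0..T} \<inter> {a..b} = {a..b}" "{a..b} \<inter> {0..T} = {a..b}" using ab by auto
    then show ?thesis
      by (simp only: integral_restrict_Int)
  qed
  finally show ?thesis .
qed

text \<open>Variation of constants adds to \<open>ev_inv t *v I t\<close> the time integral of
  \<open>ev_inv u ** Q u\<close> applied to the noise. In its Riemann sums the noise increment at
  time \<open>v\<close> carries the sum of these matrices over the nodes between \<open>v\<close>
  and \<open>t\<close>, which tends to \<open>ev_inv v - ev_inv t\<close>: an exchange of the two
  integrations. Together with the first term the coefficient of the noise becomes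
  \<open>sig v\<close>.\<close>

theorem vec_integral_solution:
  assumes Z: "linear_sde_solution M F B Q r \<Sigma> 0 Z" and t: "0 \<le> t" "t \<le> T"
  shows "vec_integral (\<lambda>v. indicator {0..t} v *\<^sub>R sig v) (\<lambda>\<omega>. ev_inv t *v Z t \<omega> - drift t)"
proof -
  have "\<forall>s\<in>{0..}. \<exists>I. has_ito_integral_matrix M F B s (\<lambda>u \<omega>. \<Sigma> u) I \<and>
        (AE \<omega> in M. Z s \<omega> = 0 + integral {0..s} (\<lambda>u. Q u *v Z u \<omega> + r u) + I \<omega>)"
    using Z unfolding linear_sde_solution_def by simp
  from bchoice[OF this] obtain I where
      I': "\<forall>s\<in>{0..}. has_ito_integral_matrix M F B s (\<lambda>u \<omega>. \<Sigma> u) (I s) \<and>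
        (AE \<omega> in M. Z s \<omega> = 0 + integral {0..s} (\<lambda>u. Q u *v Z u \<omega> + r u) + I s \<omega>)" ..
  have I: "has_ito_integral_matrix M F B s (\<lambda>u \<omega>. \<Sigma> u) (I s)"
    and ZI: "AE \<omega> in M. Z s \<omega> = 0 + integral {0..s} (\<lambda>u. Q u *v Z u \<omega> + r u) + I s \<omega>" if "0 \<le> s" for s
    using bspec[OF I', of s] that by simp_all
  have contZ: "AE \<omega> in M. continuous_on {0..} (\<lambda>t. Z t \<omega>)"
    using Z unfolding linear_sde_solution_def by blast
  have [measurable]: "Z t \<in> borel_measurable M"
    using Z t unfolding linear_sde_solution_def by (intro measurable_F_M) auto
  have WI: "vec_integral (\<lambda>v. indicator {0..s} v *\<^sub>R \<Sigma> v) (I s)" if "0 \<le> s" "s \<le> T" for s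
    by (rule vec_integral_ito[OF I[OF that(1)] continuous_on_Icc[OF cont_\<Sigma>] that(2)]) simp
  note [measurable] = vec_integral_measurable[OF WI[OF t]]
  \<comment> \<open>The variables \<open>I s\<close> are chosen separately for each \<open>s\<close>
    and need not have continuous paths. \<open>c\<close> is a version of them that is continuous
    wherever the path of \<open>Z\<close> is.\<close>
  define c where "c \<omega> s = Z s \<omega> - integral {0..s} (\<lambda>u. Q u *v Z u \<omega> + r u)" for \<omega> s
  define K where "K u = ev_inv u ** Q u" for u
  have cont_K: "continuous_on {0..} K"
    unfolding K_def[abs_def] by (intro continuous_intros continuous_on_ev_inv cont_Q)
  have Ic: "AE \<omega> in M. I s \<omega> = c \<omega> s" if "0 \<le> s" for s
    using ZI[OF that] by eventually_elim (simp add: c_def)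
  define A where "A n k = (T / real (Suc n)) *\<^sub>R (indicator {0..t} (node (Suc n) k) *\<^sub>R K (node (Suc n) k))" for n k
  define X where "X n \<omega> = (\<Sum>k<Suc n. A n k *v I (node (Suc n) k) \<omega>)" for n \<omega>
  define G where "G n v = (\<Sum>k<Suc n. A n k ** (indicator {0..node (Suc n) k} v *\<^sub>R \<Sigma> v))" for n v
  define H where "H v = indicator {0..t} v *\<^sub>R ((ev_inv v - ev_inv t) ** \<Sigma> v)" for v
  define Y where "Y \<omega> = ev_inv t *v Z t \<omega> - ev_inv t *v I t \<omega> - drift t" for \<omega>
  \<comment> \<open>Exchange of the order of summation: for \<open>0 \<le> v\<close> a node lies in
    \<open>{0..t}\<close> and beyond \<open>v\<close> exactly if it lies in
    \<open>{v..t}\<close>.\<close>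
  have G_eq: "G n v = riemann_sum v t K n ** \<Sigma> v"
    if "0 \<le> v" for n v
  proof -
    have "A n k ** (indicator {0..node (Suc n) k} v *\<^sub>R \<Sigma> v) =
        ((T / real (Suc n)) *\<^sub>R (indicator {v..t} (node (Suc n) k) *\<^sub>R K (node (Suc n) k))) ** \<Sigma> v" for k
      using that node_nonneg[of "Suc n" k]
      by (auto simp: A_def indicator_def matrix_matrix.zero_left
          matrix_matrix.zero_right)
    then show ?thesis
      unfolding G_def by (simp only: matrix_matrix.sum_left)
  qed
  \<comment> \<open>\<open>K\<close> is the derivative of \<open>- ev_inv\<close>. For
    \<open>v > t\<close> the interval is empty and the integral is 0, in agreement with the
    indicator in \<open>H\<close>.\<close>
  have int_K: "integral {v..t} K = (if v \<le> t then ev_inv v - ev_inv t else 0)" if "0 \<le> v" for v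
  proof (cases "v \<le> t")
    case True
    have "((\<lambda>u. - ev_inv u) has_vector_derivative K u) (at u within {v..t})" if "u \<in> {v..t}" for u
    proof -
      have "((\<lambda>u. - ev_inv u) has_vector_derivative - (- (ev_inv u ** Q u))) (at u within {0..})"
        using that \<open>0 \<le> v\<close> by (intro has_vector_derivative_minus deriv_ev_inv) auto
      then show ?thesis
        unfolding K_def minus_minus by (rule has_vector_derivative_within_subset) (use \<open>0 \<le> v\<close> in auto)
    qed
    from fundamental_theorem_of_calculus[OF True this]
    show ?thesis using True by (simp add: integral_unique)
  qed simp
  have contH: "continuous_on {0..t} (\<lambda>v. (ev_inv v - ev_inv t) ** \<Sigma> v)"
    by (intro continuous_intros continuous_on_Icc continuous_on_ev_inv cont_\<Sigma>) auto
  have "vec_integral H Y"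
  proof -
    obtain KM where KM: "norm (x ** y) \<le> norm x * norm y * KM" "0 \<le> KM" for x :: "real ^ 'd ^ 'd" and y :: "real ^ 'p ^ 'd"
      using matrix_matrix.nonneg_bounded by blast
    obtain CH where CH: "norm (H v) \<le> CH" for v
      using truncated_continuous(2)[OF contH] unfolding H_def by blast
    obtain CK where CK: "0 \<le> CK" "norm (indicator {0..t} u *\<^sub>R K u) \<le> CK" for u
      using truncated_continuous(2)[OF continuous_on_Icc[OF cont_K order_refl]] by blast
    obtain CS where CS: "0 \<le> CS" "norm (indicator {0..T} u *\<^sub>R \<Sigma> u) \<le> CS" for u
      using truncated_continuous(2)[OF continuous_on_Icc[OF cont_\<Sigma> order_refl]] by blast
    show ?thesis
    proof (rule vec_integral_limit)
      show "vec_integral (G n) (X n)" for n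
        unfolding G_def[abs_def] X_def[abs_def]
        by (intro vec_integral_sum vec_integral_mult WI node_nonneg node_le_T) auto
      show "H \<in> borel_measurable borel"
        unfolding H_def[abs_def] by (rule truncated_continuous(1)[OF contH])
      have [measurable]: "(\<lambda>v. indicator {0..s} v *\<^sub>R \<Sigma> v) \<in> borel_measurable borel" for s
        by (rule truncated_continuous(1)[OF continuous_on_Icc[OF cont_\<Sigma> order_refl]])
      show "G n \<in> borel_measurable borel" for n
        unfolding G_def[abs_def] by measurable
      show "Y \<in> borel_measurable M"
        unfolding Y_def[abs_def] by measurable
      show "norm (H u - G n u) \<le> CH + T * CK * CS * KM" if u: "u \<in> {0..T}" for n u
      proof -
        have "norm (riemann_sum u t K n)
            \<le> (\<Sum>k<Suc n. (T / real (Suc n)) * CK)"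
        proof (rule sum_norm_le)
          fix k
          have "norm (indicator {u..t} (node (Suc n) k) *\<^sub>R K (node (Suc n) k)) \<le> CK"
            using CK(1) CK(2)[of "node (Suc n) k"] u by (auto simp: indicator_def)
          then show "norm ((T / real (Suc n)) *\<^sub>R (indicator {u..t} (node (Suc n) k) *\<^sub>R K (node (Suc n) k)))
              \<le> (T / real (Suc n)) * CK"
            using T_pos by (simp add: divide_right_mono mult_left_mono del: of_nat_Suc)
        qed
        also have "\<dots> = T * CK" by (simp add: field_simps)
        finally have "norm (G n u) \<le> (T * CK) * norm (\<Sigma> u) * KM"
          unfolding G_eq[OF atLeastAtMost_iff[THEN iffD1, OF u, THEN conjunct1]]
          using KM(2) by (intro order_trans[OF KM(1)] mult_right_mono) auto
        also have "\<dots> \<le> (T * CK) * CS * KM"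
          using CS(2)[of u] u KM(2) CK(1) T_pos by (intro mult_right_mono mult_left_mono) auto
        finally show ?thesis
          using norm_triangle_ineq4[of "H u" "G n u"] CH[of u] by linarith
      qed
      show "(\<lambda>n. G n u) \<longlonglongrightarrow> H u" if u: "0 < u" "u < T" for u
      proof -
        have "(\<lambda>n. riemann_sum u t K n ** \<Sigma> u)
            \<longlonglongrightarrow> integral {u..t} K ** \<Sigma> u"
          using u t by (intro matrix_matrix.tendsto tendsto_const
              riemann_sums_Icc continuous_on_Icc[OF cont_K]) auto
        moreover have "integral {u..t} K ** \<Sigma> u = H u"
          using u by (simp add: int_K H_def matrix_matrix.zero_left)
        ultimately show ?thesis
          using u by (simp add: G_eq)
      qed
      \<comment> \<open>Each time has its own null set, but all partitions together have countably
        many nodes, so one null set serves for all Riemann sums.\<close>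
      have "AE \<omega> in M. \<forall>n k. I (node (Suc n) k) \<omega> = c \<omega> (node (Suc n) k)"
        by (intro AE_all_countable[THEN iffD2] allI Ic node_nonneg)
      with contZ Ic[OF t(1)] show "AE \<omega> in M. (\<lambda>n. X n \<omega>) \<longlonglongrightarrow> Y \<omega>"
      proof eventually_elim
        case (elim \<omega>)
        have c_eq: "c \<omega> u = Z u \<omega> - integral {0..u} (\<lambda>v. Q v *v Z v \<omega> + r v)" for u
          by (simp add: c_def)
        note voc = variation_of_constants[OF elim(1) cont_r t(1) c_eq]
        have "(\<lambda>n. riemann_sum 0 t (\<lambda>u. K u *v c \<omega> u) n)
            \<longlonglongrightarrow> integral {0..t} (\<lambda>u. K u *v c \<omega> u)"
          using t by (intro riemann_sums_Icc continuous_intros continuous_on_Icc cont_K voc(2)) auto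
        moreover have "X n \<omega> = riemann_sum 0 t (\<lambda>u. K u *v c \<omega> u) n" for n
          unfolding X_def A_def using elim(3) by (intro sum.cong) (simp_all add: scaleR_matrix_vector_assoc)
        moreover have "integral {0..t} (\<lambda>u. K u *v c \<omega> u) = Y \<omega>"
          using voc(1) elim(2) by (simp add: Y_def K_def drift_def)
        ultimately show ?case by simp
      qed
    qed
  qed
  from vec_integral_add[OF vec_integral_mult[OF WI[OF t], of "ev_inv t"] this]
  have "vec_integral (\<lambda>v. ev_inv t ** (indicator {0..t} v *\<^sub>R \<Sigma> v) + H v) (\<lambda>\<omega>. ev_inv t *v I t \<omega> + Y \<omega>)" .
  moreover have "ev_inv t ** (indicator {0..t} v *\<^sub>R \<Sigma> v) + H v = indicator {0..t} v *\<^sub>R sig v" for v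
    by (simp add: H_def sig_def indicator_def matrix_matrix.diff_left
        matrix_matrix.zero_right)
  ultimately show ?thesis
    by (simp add: Y_def)
qed

end

section \<open>The bridge\<close>

locale bridge_setup = linear_process M F B T Q E \<Sigma> r
  for M :: "'w measure" and F and B :: "real \<Rightarrow> 'w \<Rightarrow> real ^ 'p" and T
    and Q :: "real \<Rightarrow> real ^ 'd ^ 'd" and E \<Sigma> r +
  assumes pos_def: "\<And>s t. 0 \<le> s \<Longrightarrow> s < t \<Longrightarrow> positive_definite (kappa E \<Sigma> s t)"
begin

definition S :: "real \<Rightarrow> real ^ 'd ^ 'd" where "S u = sig u ** transpose (sig u)"

definition P :: "real \<Rightarrow> real ^ 'd ^ 'd" where "P t = integral {0..t} S"

definition D :: "real \<Rightarrow> real ^ 'd ^ 'd" where "D t = P T - P t"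

text \<open>At \<open>T\<close> the matrix \<open>D T\<close> is 0, so \<open>K T\<close> carries no
  information; where it occurs in an integrand, the factor \<open>D T\<close> removes it.\<close>

definition K :: "real \<Rightarrow> real ^ 'd ^ 'd" where "K t = matrix_inv (D t)"

section \<open>The variance function and the matrices Gamma\<close>

lemma continuous_on_S: "continuous_on {0..} S"
  unfolding S_def[abs_def] by (intro continuous_intros continuous_on_sig)

lemma S_has_integral: "0 \<le> t \<Longrightarrow> (S has_integral P t) {0..t}"
  unfolding P_def
  by (intro integrable_integral integrable_continuous_real continuous_on_Icc continuous_on_S) simp

lemma P_0 [simp]: "P 0 = 0"
  by (simp add: P_def)

lemma integral_S:
  assumes "0 \<le> s" "s \<le> t"
  shows "integral {s..t} S = P t - P s"
proof -
  have "integral {0..s} S + integral {s..t} S = integral {0..t} S"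
    using assms by (intro Henstock_Kurzweil_Integration.integral_combine integrable_continuous_real
        continuous_on_Icc continuous_on_S) auto
  then show ?thesis by (simp add: P_def algebra_simps)
qed

lemma transpose_P: "transpose (P t) = P t"
proof (cases "0 \<le> t")
  case True
  have "((transpose \<circ> S) has_integral transpose (P t)) {0..t}"
    by (rule has_integral_linear[OF S_has_integral[OF True] bounded_linear_transpose])
  moreover have "transpose \<circ> S = S"
    by (simp add: fun_eq_iff S_def matrix_transpose_mul)
  ultimately show ?thesis
    using has_integral_unique S_has_integral[OF True] by metis
next
  case False
  then have "P t = 0" by (simp add: P_def)
  then show ?thesis by (simp add: transpose_def vec_eq_iff)
qed

lemma transpose_D: "transpose (D t) = D t"
  by (simp add: D_def transpose_P linear_diff[OF bounded_linear.linear[OF bounded_linear_transpose]])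

lemma kappa_eq:
  assumes "0 \<le> s" "s \<le> t"
  shows "kappa E \<Sigma> s t = ev t ** (P t - P s) ** transpose (ev t)"
proof -
  let ?h = "\<lambda>A. ev t ** A ** transpose (ev t)"
  have "bounded_linear ?h"
    by (rule bounded_linear_compose[OF matrix_matrix.bounded_linear_left
          matrix_matrix.bounded_linear_right])
  then have "integral {s..t} (?h \<circ> S) = ?h (integral {s..t} S)"
    using assms by (intro integral_linear integrable_continuous_real continuous_on_Icc continuous_on_S) auto
  moreover have "kappa E \<Sigma> s t = integral {s..t} (?h \<circ> S)"
    unfolding kappa_def
  proof (rule integral_cong)
    fix u assume "u \<in> {s..t}"
    then have "E t u = ev t ** ev_inv u"
      using assms by (intro E_eq) auto
    then show "E t u ** \<Sigma> u ** transpose (\<Sigma> u) ** transpose (E t u) = (?h \<circ> S) u"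
      by (simp add: S_def sig_def matrix_transpose_mul matrix_mul_assoc)
  qed
  ultimately show ?thesis
    by (simp add: integral_S[OF assms])
qed

lemma Gam_eq:
  assumes "0 \<le> s" "s \<le> t"
  shows "Gam E \<Sigma> s t = ev s ** (P t - P s) ** transpose (ev t)"
proof -
  have "Gam E \<Sigma> s t = ev s ** (ev_inv t ** ev t) ** (P t - P s) ** transpose (ev t)"
    unfolding Gam_def kappa_eq[OF assms] using assms by (simp add: E_eq matrix_mul_assoc)
  then show ?thesis
    using assms by (simp add: ev_inverse)
qed

lemma ev_0 [simp]: "ev 0 = mat 1"
  by (simp add: ev_def E_refl)

lemma ev_inv_0 [simp]: "ev_inv 0 = mat 1"
  using ev_inverse(1)[of 0] by simp

lemma transpose_ev_inverse:
  assumes "0 \<le> t"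
  shows "transpose (ev t) ** transpose (ev_inv t) = mat 1" "transpose (ev_inv t) ** transpose (ev t) = mat 1"
  using ev_inverse[OF assms] by (simp_all add: matrix_transpose_mul[symmetric])

text \<open>\<open>kappa E \<Sigma> s T\<close> is congruent to \<open>D s\<close> through the
  invertible matrix \<open>ev T\<close>, so a kernel vector of \<open>D s\<close> would contradict
  positive definiteness.\<close>

lemma D_inverse:
  assumes s: "0 \<le> s" "s < T"
  shows "D s ** K s = mat 1" "K s ** D s = mat 1"
proof -
  have T: "0 \<le> T" using T_pos by simp
  have "x = 0" if x: "D s *v x = 0" for x
  proof (rule ccontr)
    assume "x \<noteq> 0"
    define y where "y = transpose (ev_inv T) *v x"
    have xy: "transpose (ev T) *v y = x"
      unfolding y_def matrix_vector_mul_assoc transpose_ev_inverse(1)[OF T] by simp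
    then have "y \<noteq> 0" using \<open>x \<noteq> 0\<close> by auto
    then have "0 < y \<bullet> (kappa E \<Sigma> s T *v y)"
      using pos_def[OF s] unfolding positive_definite_def by blast
    also have "kappa E \<Sigma> s T *v y = ev T *v (D s *v (transpose (ev T) *v y))"
      using s by (simp only: kappa_eq[OF s(1) less_imp_le[OF s(2)]] D_def matrix_vector_mul_assoc matrix_mul_assoc)
    finally show False unfolding xy x by simp
  qed
  then obtain C where "C ** D s = mat 1"
    using matrix_left_invertible_ker[of "D s"] by blast
  then have "D s ** C = mat 1"
    using matrix_left_right_inverse by blast
  then show "D s ** K s = mat 1"
    unfolding K_def by (simp add: matrix_inv_eq)
  then show "K s ** D s = mat 1"
    using matrix_left_right_inverse by blast
qed

lemma transpose_K:
  assumes s: "0 \<le> s" "s < T"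
  shows "transpose (K s) = K s"
proof -
  have "transpose (K s) ** D s = mat 1"
    using D_inverse(1)[OF s] matrix_transpose_mul[of "D s" "K s"] by (simp add: transpose_D)
  then have "transpose (K s) ** (D s ** K s) = K s"
    by (simp add: matrix_mul_assoc)
  then show ?thesis by (simp add: D_inverse(1)[OF s])
qed

lemma matrix_inv_Gam:
  assumes s: "0 \<le> s" "s < T"
  shows "matrix_inv (Gam E \<Sigma> s T) = transpose (ev_inv T) ** K s ** ev_inv s"
proof (rule matrix_inv_eq)
  have T: "0 \<le> T" using T_pos by simp
  have "Gam E \<Sigma> s T ** (transpose (ev_inv T) ** K s ** ev_inv s) =
      ev s ** (D s ** (transpose (ev T) ** transpose (ev_inv T)) ** K s) ** ev_inv s"
    using s by (simp add: Gam_eq D_def matrix_mul_assoc)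
  then show "Gam E \<Sigma> s T ** (transpose (ev_inv T) ** K s ** ev_inv s) = mat 1"
    using s by (simp add: transpose_ev_inverse[OF T] D_inverse ev_inverse)
qed

text \<open>Here and in \<open>Gam_mult_inverse_minus\<close> the factors at \<open>T\<close>
  cancel. What remains, after \<open>ev t\<close> is split off, are the weights
  \<open>D t ** K 0\<close> and \<open>P t ** K 0\<close>, whose sum is the identity.\<close>

lemma Gam_mult_inverse_plus:
  assumes t: "0 \<le> t" "t \<le> T"
  shows "Gam E \<Sigma> t T ** matrix_inv (Gam E \<Sigma> 0 T) = ev t ** (D t ** K 0)"
proof -
  have T: "0 \<le> T" using T_pos by simp
  have "Gam E \<Sigma> t T ** matrix_inv (Gam E \<Sigma> 0 T) =
      ev t ** D t ** (transpose (ev T) ** transpose (ev_inv T)) ** K 0"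
    unfolding matrix_inv_Gam[OF order_refl T_pos] Gam_eq[OF t] by (simp add: D_def matrix_mul_assoc)
  then show ?thesis
    by (simp add: transpose_ev_inverse[OF T] matrix_mul_assoc)
qed

lemma Gam_mult_inverse_minus:
  assumes t: "0 \<le> t" "t \<le> T"
  shows "transpose (Gam E \<Sigma> 0 t) ** matrix_inv (transpose (Gam E \<Sigma> 0 T)) = ev t ** (P t ** K 0) ** ev_inv T"
proof -
  have T: "0 \<le> T" using T_pos by simp
  have "Gam E \<Sigma> 0 T = D 0 ** transpose (ev T)"
    using T by (simp add: Gam_eq D_def)
  then have "transpose (Gam E \<Sigma> 0 T) ** (K 0 ** ev_inv T) = ev T ** (D 0 ** K 0) ** ev_inv T"
    by (simp add: matrix_transpose_mul transpose_D matrix_mul_assoc)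
  then have "matrix_inv (transpose (Gam E \<Sigma> 0 T)) = K 0 ** ev_inv T"
    using T_pos by (intro matrix_inv_eq) (simp add: D_inverse ev_inverse)
  moreover have "transpose (Gam E \<Sigma> 0 t) = ev t ** P t"
    using t by (simp add: Gam_eq matrix_transpose_mul transpose_P)
  ultimately show ?thesis
    by (simp add: matrix_mul_assoc)
qed

text \<open>\<open>D\<close> has derivative \<open>- S\<close>, so its inverse \<open>K\<close> has
  derivative \<open>K u ** S u ** K u\<close>. The restriction to \<open>s < T\<close> keeps
  \<open>D\<close> invertible on the closed interval.\<close>

lemma KSK_has_integral:
  assumes s: "0 \<le> s" "s < T"
  shows "((\<lambda>u. K u ** S u ** K u) has_integral K s - K 0) {0..s}" and "continuous_on {0..s} K"
proof -
  have dD: "(D has_vector_derivative - S u) (at u within {0..s})" if "u \<in> {0..s}" for u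
  proof -
    have "(P has_vector_derivative S u) (at u within {0..s})"
      unfolding P_def[abs_def]
      by (rule integral_has_vector_derivative[OF continuous_on_Icc[OF continuous_on_S order_refl] that])
    then have "((\<lambda>u. P T - P u) has_vector_derivative 0 - S u) (at u within {0..s})"
      by (intro has_vector_derivative_diff has_vector_derivative_const)
    then show ?thesis by (simp add: D_def[abs_def])
  qed
  have contD: "continuous_on {0..s} D"
    by (rule continuous_on_vector_derivative[OF dD])
  show "continuous_on {0..s} K"
    by (rule continuous_on_matrix_inverse[OF contD]) (use s in \<open>auto intro: D_inverse\<close>)
  have "(K has_vector_derivative K u ** S u ** K u) (at u within {0..s})" if u: "u \<in> {0..s}" for u
  proof -
    have "(K has_vector_derivative - (K u ** (- S u) ** K u)) (at u within {0..s})"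
      by (rule has_vector_derivative_matrix_inverse[OF dD[OF u] contD _ u]) (use s in \<open>auto intro: D_inverse\<close>)
    then show ?thesis
      by (simp add: matrix_matrix.minus_left
          matrix_matrix.minus_right)
  qed
  from fundamental_theorem_of_calculus[OF s(1) this]
  show "((\<lambda>u. K u ** S u ** K u) has_integral K s - K 0) {0..s}" .
qed

text \<open>The mean of both processes after multiplication by \<open>ev_inv t\<close>. As the two
  weights add up to the identity, \<open>drift t\<close> enters with coefficient one, besides the
  weighted start \<open>a\<close> and the weighted end
  \<open>ev_inv T *v b - drift T\<close>.\<close>

definition mean :: "real ^ 'd \<Rightarrow> real ^ 'd \<Rightarrow> real \<Rightarrow> real ^ 'd" where
  "mean a b t = (D t ** K 0) *v (a + drift t) + (P t ** K 0) *v (ev_inv T *v b - drift T + drift t)"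

definition integrand_U :: "real \<Rightarrow> real \<Rightarrow> real ^ 'p ^ 'd" where
  "integrand_U t u = D t ** (indicator {0..t} u *\<^sub>R (K u ** sig u))"

text \<open>\<open>P t ** K 0\<close> is the regression coefficient of the value at \<open>t\<close>
  on the terminal value: their covariance is \<open>P t\<close> and the terminal variance is
  \<open>P T = D 0\<close>.\<close>

definition integrand_Y :: "real \<Rightarrow> real \<Rightarrow> real ^ 'p ^ 'd" where
  "integrand_Y t u = indicator {0..t} u *\<^sub>R sig u - (P t ** K 0) ** (indicator {0..T} u *\<^sub>R sig u)"

section \<open>Covariances of the two integrands\<close>

lemma P_K_eq: "P t ** K 0 = mat 1 - D t ** K 0"
proof -
  have "P t = D 0 - D t" by (simp add: D_def)
  then show ?thesis
    using D_inverse(1)[of 0] T_pos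
    by (simp add: matrix_matrix.diff_left)
qed

text \<open>Only \<open>{0..s}\<close> contributes, and \<open>D s ** (K s - K 0)\<close> equals the
  identity minus \<open>D s ** K 0\<close>, that is \<open>P s ** K 0\<close>. For
  \<open>s = T\<close> there is no inverse of \<open>D s\<close>, but both integrands and the
  covariance vanish.\<close>

lemma covariance_U:
  assumes st: "0 \<le> s" "s \<le> t" "t \<le> T"
  shows "((\<lambda>u. (\<eta> v* integrand_U s u) \<bullet> (\<zeta> v* integrand_U t u)) has_integral
    \<eta> \<bullet> ((P s ** K 0 ** D t) *v \<zeta>)) {0..T}"
proof (cases "s < T")
  case False
  then have "s = T" "t = T" using st by auto
  then have "D s = 0" "D t = 0" by (simp_all add: D_def)
  then show ?thesis
    by (simp add: integrand_U_def matrix_matrix.zero_left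
        matrix_matrix.zero_right)
next
  case True
  let ?f = "\<lambda>u. (\<eta> v* D s) \<bullet> ((K u ** S u ** K u) *v (\<zeta> v* D t))"
  have "((\<lambda>A. (\<eta> v* D s) \<bullet> (A *v (\<zeta> v* D t))) \<circ> (\<lambda>u. K u ** S u ** K u) has_integral
      (\<eta> v* D s) \<bullet> ((K s - K 0) *v (\<zeta> v* D t))) {0..s}"
    by (rule has_integral_linear[OF KSK_has_integral(1)[OF st(1) True] bounded_linear_quadratic])
  then have "(?f has_integral (\<eta> v* D s) \<bullet> ((K s - K 0) *v (\<zeta> v* D t))) {0..s}"
    by (simp add: comp_def)
  then have "((\<lambda>u. indicator {0..s} u * ?f u) has_integral (\<eta> v* D s) \<bullet> ((K s - K 0) *v (\<zeta> v* D t))) {0..T}"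
    by (rule has_integral_indicator) (use st in auto)
  moreover have "(\<eta> v* D s) \<bullet> ((K s - K 0) *v (\<zeta> v* D t)) = \<eta> \<bullet> ((P s ** K 0 ** D t) *v \<zeta>)"
  proof -
    have "\<zeta> v* D t = D t *v \<zeta>"
      using transpose_D[of t] vector_transpose_matrix[of \<zeta> "D t"] by simp
    then have "(\<eta> v* D s) \<bullet> ((K s - K 0) *v (\<zeta> v* D t)) = \<eta> \<bullet> ((D s ** (K s - K 0) ** D t) *v \<zeta>)"
      by (simp only: dot_lmul_matrix matrix_vector_mul_assoc matrix_mul_assoc)
    also have "D s ** (K s - K 0) = P s ** K 0"
      using D_inverse(1)[OF st(1) True]
      by (simp add: P_K_eq matrix_matrix.diff_right)
    finally show ?thesis .
  qed
  moreover have "indicator {0..s} u * ?f u = (\<eta> v* integrand_U s u) \<bullet> (\<zeta> v* integrand_U t u)" for u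
  proof (cases "u \<in> {0..s}")
    case u: True
    then have [simp]: "transpose (K u) = K u"
      using True by (intro transpose_K) auto
    have "(\<eta> v* integrand_U s u) \<bullet> (\<zeta> v* integrand_U t u) =
        ((\<eta> v* D s) v* (K u ** sig u)) \<bullet> ((\<zeta> v* D t) v* (K u ** sig u))"
      using u st by (simp add: integrand_U_def vector_matrix_mult_assoc)
    also have "\<dots> = ?f u"
      by (simp only: inner_vector_matrix_mult) (simp add: S_def matrix_transpose_mul matrix_mul_assoc)
    finally show ?thesis using u by simp
  next
    case False
    then show ?thesis
      by (simp add: integrand_U_def matrix_matrix.zero_right)
  qed
  ultimately show ?thesis by simp
qed

lemma quadratic_S_has_integral:
  assumes "0 \<le> t" "t \<le> T"
  shows "((\<lambda>u. indicator {0..t} u * (x \<bullet> (S u *v y))) has_integral x \<bullet> (P t *v y)) {0..T}"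
proof (rule has_integral_indicator[OF _ assms(2)])
  have "((\<lambda>A. x \<bullet> (A *v y)) \<circ> S has_integral x \<bullet> (P t *v y)) {0..t}"
    by (rule has_integral_linear[OF S_has_integral[OF assms(1)] bounded_linear_quadratic])
  then show "((\<lambda>u. x \<bullet> (S u *v y)) has_integral x \<bullet> (P t *v y)) {0..t}"
    by (simp add: comp_def)
qed

text \<open>Expanding gives four terms. Both mixed terms are \<open>P s ** K 0 ** P t\<close> with a
  minus sign; the last one contains \<open>K 0 ** P T = mat 1\<close> and cancels one of them. What
  is left is \<open>P s - P s ** K 0 ** P t\<close>.\<close>

lemma covariance_Y:
  assumes st: "0 \<le> s" "s \<le> t" "t \<le> T"
  shows "((\<lambda>u. (\<eta> v* integrand_Y s u) \<bullet> (\<zeta> v* integrand_Y t u)) has_integral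
    \<eta> \<bullet> ((P s ** K 0 ** D t) *v \<zeta>)) {0..T}"
proof -
  define q where "q = \<eta> v* (P s ** K 0)"
  define q' where "q' = \<zeta> v* (P t ** K 0)"
  have T: "0 \<le> T" and T0: "(0::real) < T" using T_pos by auto
  have "((\<lambda>u. indicator {0..s} u * (\<eta> \<bullet> (S u *v \<zeta>)) - indicator {0..s} u * (\<eta> \<bullet> (S u *v q'))
      - indicator {0..t} u * (q \<bullet> (S u *v \<zeta>)) + indicator {0..T} u * (q \<bullet> (S u *v q'))) has_integral
      \<eta> \<bullet> (P s *v \<zeta>) - \<eta> \<bullet> (P s *v q') - q \<bullet> (P t *v \<zeta>) + q \<bullet> (P T *v q')) {0..T}"
    using st T by (intro has_integral_add has_integral_diff quadratic_S_has_integral) auto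
  moreover have "indicator {0..s} u * (\<eta> \<bullet> (S u *v \<zeta>)) - indicator {0..s} u * (\<eta> \<bullet> (S u *v q'))
      - indicator {0..t} u * (q \<bullet> (S u *v \<zeta>)) + indicator {0..T} u * (q \<bullet> (S u *v q')) =
      (\<eta> v* integrand_Y s u) \<bullet> (\<zeta> v* integrand_Y t u)" for u
  proof -
    have Y: "\<eta> v* integrand_Y s u = (indicator {0..s} u *\<^sub>R \<eta> - indicator {0..T} u *\<^sub>R q) v* sig u"
      "\<zeta> v* integrand_Y t u = (indicator {0..t} u *\<^sub>R \<zeta> - indicator {0..T} u *\<^sub>R q') v* sig u"
      by (simp_all add: integrand_Y_def q_def q'_def vector_matrix_mult_diff_rdistrib vector_matrix_mult_diff_distrib
          vector_matrix_mult_assoc scaleR_vector_matrix_assoc vector_scaleR_matrix_ac)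
    show ?thesis
      unfolding Y inner_vector_matrix_mult S_def[symmetric]
      by (simp only: matrix_vector_mult_diff_distrib inner_diff_left inner_diff_right inner_scaleR_left
          inner_scaleR_right matrix_vector_mult_scaleR) (use st in \<open>auto simp: indicator_def\<close>)
  qed
  moreover have "\<eta> \<bullet> (P s *v \<zeta>) - \<eta> \<bullet> (P s *v q') - q \<bullet> (P t *v \<zeta>) + q \<bullet> (P T *v q') =
      \<eta> \<bullet> ((P s ** K 0 ** D t) *v \<zeta>)"
  proof -
    have D0: "P T = D 0" by (simp add: D_def)
    have q': "q' = (K 0 ** P t) *v \<zeta>"
      unfolding q'_def using vector_transpose_matrix[of \<zeta> "K 0 ** P t"] T0
      by (simp add: matrix_transpose_mul transpose_P transpose_K)
    have 1: "\<eta> \<bullet> (P s *v q') = \<eta> \<bullet> ((P s ** K 0 ** P t) *v \<zeta>)"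
      unfolding q' by (simp only: matrix_vector_mul_assoc matrix_mul_assoc)
    have 2: "q \<bullet> (P t *v \<zeta>) = \<eta> \<bullet> ((P s ** K 0 ** P t) *v \<zeta>)"
      unfolding q_def by (simp only: dot_lmul_matrix matrix_vector_mul_assoc matrix_mul_assoc)
    have "q \<bullet> (P T *v q') = \<eta> \<bullet> ((P s ** (K 0 ** D 0) ** K 0 ** P t) *v \<zeta>)"
      unfolding q_def q' D0 by (simp only: dot_lmul_matrix matrix_vector_mul_assoc matrix_mul_assoc)
    then have 3: "q \<bullet> (P T *v q') = \<eta> \<bullet> ((P s ** K 0 ** P t) *v \<zeta>)"
      using T0 by (simp add: D_inverse)
    have "P s ** K 0 ** D t = P s ** (K 0 ** D 0) - P s ** K 0 ** P t"
      unfolding D_def P_0 by (simp add: matrix_matrix.diff_right matrix_mul_assoc)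
    then have "P s ** K 0 ** D t = P s - P s ** K 0 ** P t"
      using T0 by (simp add: D_inverse)
    then show ?thesis
      unfolding 1 2 3 by (simp add: matrix_vector_mult_diff_rdistrib inner_diff_right)
  qed
  ultimately show ?thesis by simp
qed

section \<open>Both processes as Wiener integrals, and the comparison of their laws\<close>

definition bridge_of :: "real ^ 'd \<Rightarrow> real ^ 'd \<Rightarrow> (real \<Rightarrow> 'w \<Rightarrow> real ^ 'd) \<Rightarrow> real \<Rightarrow> 'w \<Rightarrow> real ^ 'd" where
  "bridge_of a b Z t \<omega> = (Gam E \<Sigma> t T ** matrix_inv (Gam E \<Sigma> 0 T)) *v a + Z t \<omega>
     - (transpose (Gam E \<Sigma> 0 t) ** matrix_inv (transpose (Gam E \<Sigma> 0 T))) *v (Z T \<omega> - b)"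

lemma vec_integral_Y:
  assumes Z: "linear_sde_solution M F B Q r \<Sigma> 0 Z" and t: "0 \<le> t" "t \<le> T"
  shows "vec_integral (integrand_Y t) (\<lambda>\<omega>. ev_inv t *v bridge_of a b Z t \<omega> - mean a b t)"
proof -
  have T: "0 \<le> T" using T_pos by simp
  have "vec_integral (\<lambda>u. indicator {0..t} u *\<^sub>R sig u - (P t ** K 0) ** (indicator {0..T} u *\<^sub>R sig u))
      (\<lambda>\<omega>. (ev_inv t *v Z t \<omega> - drift t) - (P t ** K 0) *v (ev_inv T *v Z T \<omega> - drift T))"
    by (intro vec_integral_diff vec_integral_mult vec_integral_solution[OF Z] t T order_refl)
  \<comment> \<open>An identity for every outcome: the terms with \<open>a\<close>, \<open>b\<close>
    and \<open>drift\<close> match those of \<open>mean\<close> once \<open>P t ** K 0\<close> is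
    rewritten by \<open>P_K_eq\<close>.\<close>
  moreover have "(ev_inv t *v Z t \<omega> - drift t) - (P t ** K 0) *v (ev_inv T *v Z T \<omega> - drift T) =
      ev_inv t *v bridge_of a b Z t \<omega> - mean a b t" for \<omega>
  proof -
    have e: "ev_inv t *v ((ev t ** A) *v x) = A *v x" for A :: "real ^ 'd ^ 'd" and x
      using t by (simp only: matrix_vector_mul_assoc matrix_mul_assoc ev_inverse matrix_mul_lid)
    have "ev_inv t *v bridge_of a b Z t \<omega> = (D t ** K 0) *v a + ev_inv t *v Z t \<omega> - (P t ** K 0) *v (ev_inv T *v (Z T \<omega> - b))"
      unfolding bridge_of_def Gam_mult_inverse_plus[OF t] Gam_mult_inverse_minus[OF t]
      by (simp only: matrix_vector_right_distrib matrix_vector_mult_diff_distrib e matrix_mul_assoc[symmetric])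
        (simp only: matrix_vector_mul_assoc matrix_mul_assoc)
    then show ?thesis
      unfolding mean_def P_K_eq by (simp add: algebra_simps)
  qed
  ultimately show ?thesis
    by (simp add: integrand_Y_def[abs_def])
qed

lemma bridge_mean_eq:
  assumes t: "0 \<le> t" "t \<le> T"
  shows "bridge_mean E r \<Sigma> T a b 0 t = ev t *v mean a b t"
proof -
  have T: "0 \<le> T" using T_pos by simp
  have cont: "continuous_on {0..} (\<lambda>u. ev_inv u *v r u)"
    by (intro continuous_intros continuous_on_ev_inv cont_r)
  have "integral {0..t} (\<lambda>u. E 0 u *v r u) = drift t"
    unfolding drift_def by (rule integral_cong) (simp add: E_eq)
  moreover have "integral {t..T} (\<lambda>u. E T u *v r u) = ev T *v (drift T - drift t)"
  proof -
    have "integral {0..t} (\<lambda>u. ev_inv u *v r u) + integral {t..T} (\<lambda>u. ev_inv u *v r u) =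
        integral {0..T} (\<lambda>u. ev_inv u *v r u)"
      using t by (intro Henstock_Kurzweil_Integration.integral_combine integrable_continuous_real
          continuous_on_Icc cont) auto
    then have d: "integral {t..T} (\<lambda>u. ev_inv u *v r u) = drift T - drift t"
      by (simp add: drift_def algebra_simps)
    have "integral {t..T} ((*v) (ev T) \<circ> (\<lambda>u. ev_inv u *v r u)) = ev T *v integral {t..T} (\<lambda>u. ev_inv u *v r u)"
      using t by (intro integral_linear integrable_continuous_real continuous_on_Icc cont) auto
    moreover have "integral {t..T} (\<lambda>u. E T u *v r u) = integral {t..T} ((*v) (ev T) \<circ> (\<lambda>u. ev_inv u *v r u))"
      using t T by (intro integral_cong) (simp add: E_eq matrix_vector_mul_assoc)
    ultimately show ?thesis by (simp add: d)
  qed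
  moreover have "ev_inv T *v (ev T *v x) = x" for x
    using ev_inverse[OF T] by (simp add: matrix_vector_mul_assoc)
  ultimately show ?thesis
    unfolding bridge_mean_def m_plus_def m_minus_def mean_def Gam_mult_inverse_plus[OF t] Gam_mult_inverse_minus[OF t]
    by (simp only: matrix_vector_mul_assoc[symmetric] matrix_vector_right_distrib matrix_vector_mult_diff_distrib)
      (simp add: algebra_simps)
qed

text \<open>Before \<open>T\<close> the representation comes from the Ito integral. At
  \<open>T\<close> the definition of the bridge prescribes the value \<open>b\<close> instead; this
  fits because \<open>D T = 0\<close> makes the integrand vanish and the mean equal to
  \<open>ev_inv T *v b\<close>.\<close>

lemma vec_integral_U:
  assumes U: "linear_process_bridge M F B E r \<Sigma> T a b U" and t: "0 \<le> t" "t \<le> T"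
  shows "vec_integral (integrand_U t) (\<lambda>\<omega>. ev_inv t *v U t \<omega> - mean a b t)"
proof (cases "t < T")
  case True
  have T: "0 \<le> T" using T_pos by simp
  have [measurable]: "U t \<in> borel_measurable M"
    using U t unfolding linear_process_bridge_def by auto
  have "\<exists>I. has_ito_integral_matrix M F B t (\<lambda>u \<omega>. matrix_inv (Gam E \<Sigma> u T) ** \<Sigma> u) I \<and>
        (AE \<omega> in M. U t \<omega> = bridge_mean E r \<Sigma> T a b 0 t + Gam E \<Sigma> t T *v I \<omega>)"
    using U t True unfolding linear_process_bridge_def by simp
  then obtain I where I: "has_ito_integral_matrix M F B t (\<lambda>u \<omega>. matrix_inv (Gam E \<Sigma> u T) ** \<Sigma> u) I"
    and UI: "AE \<omega> in M. U t \<omega> = bridge_mean E r \<Sigma> T a b 0 t + Gam E \<Sigma> t T *v I \<omega>" by blast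
  have eq: "matrix_inv (Gam E \<Sigma> u T) ** \<Sigma> u = transpose (ev_inv T) ** (K u ** sig u)" if "u \<in> {0..t}" for u
    using that True by (simp add: matrix_inv_Gam sig_def matrix_mul_assoc)
  have "continuous_on {0..t} (\<lambda>u. transpose (ev_inv T) ** (K u ** sig u))"
    by (intro continuous_intros KSK_has_integral(2) continuous_on_Icc continuous_on_sig t True order_refl)
  then have "continuous_on {0..t} (\<lambda>u. matrix_inv (Gam E \<Sigma> u T) ** \<Sigma> u)"
    by (rule continuous_on_eq) (simp add: eq)
  \<comment> \<open>This factor is what remains of \<open>Gam E \<Sigma> t T\<close> after
    \<open>ev_inv t\<close> has removed \<open>ev t\<close>; its \<open>transpose (ev T)\<close>
    cancels against the inverse inside \<open>matrix_inv (Gam E \<Sigma> u T)\<close>.\<close>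
  from vec_integral_mult[OF vec_integral_ito[OF I this t(2)], of "D t ** transpose (ev T)"]
  have "vec_integral (\<lambda>u. (D t ** transpose (ev T)) ** (indicator {0..t} u *\<^sub>R (matrix_inv (Gam E \<Sigma> u T) ** \<Sigma> u)))
      (\<lambda>\<omega>. (D t ** transpose (ev T)) *v I \<omega>)" .
  moreover have "(D t ** transpose (ev T)) ** (indicator {0..t} u *\<^sub>R (matrix_inv (Gam E \<Sigma> u T) ** \<Sigma> u)) =
      integrand_U t u" for u
  proof (cases "u \<in> {0..t}")
    case u: True
    have "(D t ** transpose (ev T)) ** (transpose (ev_inv T) ** (K u ** sig u)) =
        D t ** (transpose (ev T) ** transpose (ev_inv T)) ** (K u ** sig u)"
      by (simp only: matrix_mul_assoc)
    then show ?thesis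
      using u by (simp add: integrand_U_def eq transpose_ev_inverse[OF T])
  next
    case False
    then show ?thesis
      by (simp add: integrand_U_def matrix_matrix.zero_right)
  qed
  ultimately have "vec_integral (integrand_U t) (\<lambda>\<omega>. (D t ** transpose (ev T)) *v I \<omega>)"
    by (simp add: fun_eq_iff)
  then show ?thesis
  proof (rule vec_integral_cong_AE)
    show "AE \<omega> in M. (D t ** transpose (ev T)) *v I \<omega> = ev_inv t *v U t \<omega> - mean a b t"
      using UI
    proof eventually_elim
      case (elim \<omega>)
      have "ev_inv t *v U t \<omega> = (ev_inv t ** ev t) *v mean a b t + (ev_inv t ** ev t ** (D t ** transpose (ev T))) *v I \<omega>"
        unfolding elim bridge_mean_eq[OF t] Gam_eq[OF t] D_def
        by (simp only: matrix_vector_right_distrib matrix_vector_mul_assoc matrix_mul_assoc)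
      then show ?case
        by (simp add: ev_inverse[OF t(1)])
    qed
  qed measurable
next
  case False
  then have [simp]: "t = T" using t by simp
  have T: "0 \<le> T" using T_pos by simp
  have [measurable]: "U T \<in> borel_measurable M"
    using U T unfolding linear_process_bridge_def by auto
  have D: "D T = 0" by (simp add: D_def)
  have "integrand_U T = (\<lambda>_. 0)"
    by (simp add: fun_eq_iff integrand_U_def D matrix_matrix.zero_left)
  moreover have "vec_integral (\<lambda>_. 0) (\<lambda>\<omega>. ev_inv T *v U T \<omega> - mean a b T)"
  proof (rule vec_integral_cong_AE[OF vec_integral_zero])
    have "mean a b T = ev_inv T *v b"
      by (simp add: mean_def P_K_eq D matrix_matrix.zero_left)
    moreover have "AE \<omega> in M. U T \<omega> = b"
      using U unfolding linear_process_bridge_def by blast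
    ultimately show "AE \<omega> in M. 0 = ev_inv T *v U T \<omega> - mean a b T"
      by (auto elim!: eventually_mono)
  qed measurable
  ultimately show ?thesis by simp
qed

theorem bridge_equal_in_law:
  assumes Z: "linear_sde_solution M F B Q r \<Sigma> 0 Z" and U: "linear_process_bridge M F B E r \<Sigma> T a b U"
  shows "equal_in_law {0..T} M (bridge_of a b Z) M U"
proof (rule equal_in_law_if_char_eq[OF prob_space_axioms prob_space_axioms])
  have Z_meas: "Z t \<in> borel_measurable M" if "0 \<le> t" for t
    using Z that unfolding linear_sde_solution_def by (intro measurable_F_M) auto
  show "bridge_of a b Z t \<in> borel_measurable M"
    if "t \<in> {0..T}" for t
  proof -
    have [measurable]: "Z t \<in> borel_measurable M" "Z T \<in> borel_measurable M"
      using that T_pos by (auto intro: Z_meas)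
    show ?thesis unfolding bridge_of_def[abs_def] by measurable
  qed
  show "U t \<in> borel_measurable M" if "t \<in> {0..T}" for t
    using U that unfolding linear_process_bridge_def by blast
  fix J :: "real set" and \<theta> :: "real \<Rightarrow> real ^ 'd"
  assume J: "finite J" "J \<subseteq> {0..T}"
  \<comment> \<open>The test vectors absorb \<open>ev t\<close>, so that both processes are compared
    after multiplication by \<open>ev_inv t\<close>.\<close>
  define \<eta> where "\<eta> t = \<theta> t v* ev t" for t
  \<comment> \<open>The covariance lemmas assume \<open>s \<le> t\<close>; the second branch extends
    their formula to all pairs by symmetry of the inner product.\<close>
  define C where "C s t = (if s \<le> t then \<eta> s \<bullet> ((P s ** K 0 ** D t) *v \<eta> t) else \<eta> t \<bullet> ((P t ** K 0 ** D s) *v \<eta> s))" for s t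
  have J': "0 \<le> t" "t \<le> T" if "t \<in> J" for t
    using that J(2) by auto
  have CU: "((\<lambda>u. (\<eta> s v* integrand_U s u) \<bullet> (\<eta> t v* integrand_U t u)) has_integral C s t) {0..T}"
    if "s \<in> J" "t \<in> J" for s t
    using covariance_U[of s t "\<eta> s" "\<eta> t"] covariance_U[of t s "\<eta> t" "\<eta> s"] J'[OF that(1)] J'[OF that(2)]
    by (cases "s \<le> t") (auto simp: C_def inner_commute)
  have CY: "((\<lambda>u. (\<eta> s v* integrand_Y s u) \<bullet> (\<eta> t v* integrand_Y t u)) has_integral C s t) {0..T}"
    if "s \<in> J" "t \<in> J" for s t
    using covariance_Y[of s t "\<eta> s" "\<eta> t"] covariance_Y[of t s "\<eta> t" "\<eta> s"] J'[OF that(1)] J'[OF that(2)]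
    by (cases "s \<le> t") (auto simp: C_def inner_commute)
  have eq: "\<theta> t \<bullet> x = \<eta> t \<bullet> (mean a b t + (ev_inv t *v x - mean a b t))" if "t \<in> J" for t x
    using ev_inverse(1)[OF J'(1)[OF that]] by (simp add: \<eta>_def dot_lmul_matrix matrix_vector_mul_assoc)
  have "expectation (\<lambda>\<omega>. cis (\<Sum>t\<in>J. \<eta> t \<bullet> (mean a b t + (ev_inv t *v bridge_of a b Z t \<omega> - mean a b t)))) =
      expectation (\<lambda>\<omega>. cis (\<Sum>t\<in>J. \<eta> t \<bullet> (mean a b t + (ev_inv t *v U t \<omega> - mean a b t))))"
    by (simp only: char_vec_integrals[OF J(1) vec_integral_Y[OF Z J'] CY]
        char_vec_integrals[OF J(1) vec_integral_U[OF U J'] CU])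
  then show "expectation (\<lambda>\<omega>. cis (\<Sum>t\<in>J. \<theta> t \<bullet> bridge_of a b Z t \<omega>)) =
      expectation (\<lambda>\<omega>. cis (\<Sum>t\<in>J. \<theta> t \<bullet> U t \<omega>))"
    by (simp add: eq cong: sum.cong)
qed

end

theorem theorem2p3:
  fixes M :: "'w measure" and F :: "real \<Rightarrow> 'w measure"
    and B :: "real \<Rightarrow> 'w \<Rightarrow> real ^ 'p"
    and Q :: "real \<Rightarrow> real ^ 'd ^ 'd" and \<Sigma> :: "real \<Rightarrow> real ^ 'p ^ 'd" and r :: "real \<Rightarrow> real ^ 'd"
    and E :: "real \<Rightarrow> real \<Rightarrow> real ^ 'd ^ 'd"
    and Z U :: "real \<Rightarrow> 'w \<Rightarrow> real ^ 'd"
    and a b :: "real ^ 'd" and T :: real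
  assumes "filtered_prob_space M F" and "usual_conditions M F"
    and "wiener_process M F B"
    and "continuous_on {0..} Q" and "continuous_on {0..} \<Sigma>" and "continuous_on {0..} r"
    and "evolution_matrices Q E"
    and "T > 0"
    and "linear_sde_solution M F B Q r \<Sigma> 0 Z"
    and "\<And>s t. 0 \<le> s \<Longrightarrow> s < t \<Longrightarrow> positive_definite (kappa E \<Sigma> s t)"
    and "linear_process_bridge M F B E r \<Sigma> T a b U"
  shows "equal_in_law {0..T}
           M (\<lambda>t \<omega>. (Gam E \<Sigma> t T ** matrix_inv (Gam E \<Sigma> 0 T)) *v a + Z t \<omega>
                     - (transpose (Gam E \<Sigma> 0 t) ** matrix_inv (transpose (Gam E \<Sigma> 0 T))) *v (Z T \<omega> - b))
           M U"
proof -
  interpret prob_space M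
    using assms(1) unfolding filtered_prob_space_def by blast
  interpret bridge_setup M F B T Q E \<Sigma> r
    using assms by unfold_locales auto
  show ?thesis
    using bridge_equal_in_law[OF assms(9,11)] by (simp only: bridge_of_def[abs_def])
qed

end
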